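(* Let $(M,\mathscr{L})$ be a pseudo-Finsler space modeled on a pseudo-Minkowski space $(V,L)$, with local vierbein $e^a_\mu(x)$ and commutation coefficients $c^a{}_{bc}(x)$. Then the mean Landsberg curvature is \begin{align*} J_c:=L^a{}_{ac}&=-\tfrac12\,c^e{}_{mn}\Big(y^mI_e\delta^n_c+I^mg_{ec}y^n+I^my_e\delta^n_c+2\Big(\frac{\partial}{\partial y^c}I^m+C^m_{sc}I^s\Big)y_ey^n\Big)\\ &=k_{mne}\,y^e\Big[I^m\delta^n_c+y^n\Big(\frac{\partial}{\partial y^c}I^m+C^m_{sc}I^s\Big)\Big]\\ &=k_{mne}\,y^e\Big[h^{[n}_cI^{m]}+y^{[n}\big(h^a_ch^{m]}_b\nabla^{VC}_aI^b\big)\Big]. \end{align*}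
   Context: Einstein's summation convention is used. A pseudo-Minkowski space is a pair $(V,L)$ where $V$ is a finite-dimensional real vector space and $L\colon\bar\omega\to\mathbb{R}$ is defined on the closure of an open cone $\omega\subset V$ with vertex the origin, with $L\in C^4(\omega)\cap C^0(\bar\omega)$, $L(sy)=s^2L(y)$ for $s>0$, and non-degenerate Hessian on $\omega$. A pseudo-Finsler space is a pair $(M,\mathscr{L})$, $\dim M=\dim V$, $\mathscr{L}\colon\bar\Omega\to\mathbb{R}$, $\Omega\subset TM$ projecting onto $M$, such that each $(T_xM,\mathscr{L}_x)$, with $\mathscr{L}_x$ the restriction of $\mathscr{L}$ to the fibre (cone $\Omega_x=\Omega\cap T_xM$), is a pseudo-Minkowski space with signature independent of $x$; the dependence of $\mathscr{L}$ on $x$ is $C^2$. It is modeled on $(V,L)$ if locally, for $x\in U\subset M$, there are linear isomorphisms $\varphi_x\colon T_xM\to V$, sufficiently differentiable in $x$, with $\varphi_x(\Omega_x)=\omega$ and $L(\varphi_x(y))=\mathscr{L}_x(y)$ for every $y\in\bar\Omega_x$. Fix a basis $\{\tilde e_a\}$ of $V$ and put $e_a=\varphi_x^{-1}(\tilde e_a)=e^\mu_a\partial_\mu$, with dual basis $e^a=e^a_\mu dx^\mu$ (the vierbein), in local coordinates $x^\mu$ of $M$. A tangent vector is $y=y^\mu\partial_\mu=y^ae_a$, $y^\mu=y^ae^\mu_a$; regarding $L$ as a function of $(y^a)$, $\mathscr{L}(x^\mu,y^\nu)=L(e^a_\nu(x)y^\nu)$. The commutation coefficients are defined by $[e_a,e_b]=c^c{}_{ab}e_c$.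 With $\partial_a=\partial/\partial y^a$: $y_a=\partial_aL$, $g_{ab}=\partial_a\partial_bL$, $g^{ab}$ the inverse of $g_{ab}$, $C_{abc}=\frac12\partial_a\partial_b\partial_cL$, $C^m_{bc}=g^{ma}C_{abc}$, $I_a=g^{bc}C_{abc}$, $I^a=g^{ab}I_b$. The upper index of $c$ is lowered to the left: $c_{abc}=g_{ad}c^d{}_{bc}$, and $k_{mne}=\frac12(c_{mne}+c_{nem}-c_{emn})$, antisymmetric in its first two indices. Square brackets on indices denote antisymmetrization in $n,m$ with factor $\frac12$. Moreover $h^a_b:=\delta^a_b-\frac1{g_y(y,y)}y^ay_b$, where $g_y(y,y):=2L$, is the projection on the space tangent to the indicatrix, and $\nabla^{VC}$ is the vertical Cartan derivative, with connection coefficients $C^c_{ab}$ in the coordinates $y^a$: $\nabla^{VC}_aI^b=\partial_aI^b+C^b_{ac}I^c$. With $g_{\mu\nu}=\partial^2\mathscr{L}/\partial y^\mu\partial y^\nu$ and inverse $g^{\mu\nu}$, the spray is $G^\mu:=\frac12g^{\mu\sigma}\big(\frac{\partial^2\mathscr{L}}{\partial x^\rho\partial y^\sigma}y^\rho-\frac{\partial\mathscr{L}}{\partial x^\sigma}\big)$; the Berwald curvature is $G^\rho_{\alpha\beta\gamma}:=\frac{\partial^3G^\rho}{\partial y^\alpha\partial y^\beta\partial y^\gamma}$, with vierbein components $G^r_{abc}:=G^\rho_{\alpha\beta\gamma}e^r_\rho e^\alpha_ae^\beta_be^\gamma_c$. The Landsberg tensor is $L_{abc}=-\frac12y_rG^r_{abc}$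 (not to be confused with the function $L$), and $L^a{}_{ac}=g^{ab}L_{bac}$. *)

theory Defs
  imports "HOL-Analysis.Analysis"
begin

section \<open>Differentiability\<close>

text \<open>Functions of class \<open>C^k\<close> on a set \<open>S\<close>; only meaningful for open \<open>S\<close>.\<close>

fun Ck_on :: "nat \<Rightarrow> ('a::euclidean_space \<Rightarrow> 'b::real_normed_vector) \<Rightarrow> 'a set \<Rightarrow> bool" where
  "Ck_on 0 f S \<longleftrightarrow> continuous_on S f"
| "Ck_on (Suc k) f S \<longleftrightarrow>
     (\<forall>x\<in>S. f differentiable (at x)) \<and> (\<forall>v. Ck_on k (\<lambda>x. frechet_derivative f (at x) v) S)"

definition pderiv_exists :: "'n::finite \<Rightarrow> (real^'n \<Rightarrow> real) \<Rightarrow> real^'n \<Rightarrow> bool" where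
  "pderiv_exists i f x \<longleftrightarrow> (\<lambda>t. f (x + t *\<^sub>R axis i 1)) differentiable (at (0::real))"

definition pd :: "'n::finite \<Rightarrow> (real^'n \<Rightarrow> real) \<Rightarrow> real^'n \<Rightarrow> real" where
  "pd i f x = deriv (\<lambda>t. f (x + t *\<^sub>R axis i 1)) 0"

definition hess :: "('v::euclidean_space \<Rightarrow> real) \<Rightarrow> 'v \<Rightarrow> 'v \<Rightarrow> 'v \<Rightarrow> real" where
  "hess L y u w = frechet_derivative (\<lambda>z. frechet_derivative L (at z) u) (at y) w"

text \<open>Positive and negative index of inertia of a symmetric bilinear form.\<close>

definition signature :: "('v::euclidean_space \<Rightarrow> 'v \<Rightarrow> real) \<Rightarrow> nat \<times> nat" where
  "signature B =
    (Max {dim S | S. subspace S \<and> (\<forall>v\<in>S - {0}. B v v > 0)},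
     Max {dim S | S. subspace S \<and> (\<forall>v\<in>S - {0}. B v v < 0)})"

section \<open>Pseudo-Minkowski spaces\<close>

text \<open>The cone is closed under multiplication by positive scalars only: it need not contain the
  origin, so the library's \<open>cone\<close> and \<open>conic\<close> do not apply. The values of \<open>L\<close> outside
  \<open>closure \<omega>\<close> are irrelevant.\<close>

definition pseudo_minkowski :: "'v::euclidean_space set \<Rightarrow> ('v \<Rightarrow> real) \<Rightarrow> bool" where
  "pseudo_minkowski \<omega> L \<longleftrightarrow>
     open \<omega> \<and> (\<forall>y\<in>\<omega>. \<forall>s>0. s *\<^sub>R y \<in> \<omega>) \<and>
     Ck_on 4 L \<omega> \<and> continuous_on (closure \<omega>) L \<and>
     (\<forall>y\<in>closure \<omega>. \<forall>s>0. L (s *\<^sub>R y) = s^2 * L y) \<and>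
     (\<forall>y\<in>\<omega>. \<forall>u. u \<noteq> 0 \<longrightarrow> (\<exists>w. hess L y u w \<noteq> 0))"

section \<open>Manifolds and tangent vectors\<close>

text \<open>The manifold is the whole type \<open>'m\<close>; a chart is its domain together with its coordinate map,
  whose values outside the domain are irrelevant.\<close>

type_synonym ('m, 'n) chart = "'m set \<times> ('m \<Rightarrow> real^'n)"

abbreviation chart_inv :: "('m, 'n::finite) chart \<Rightarrow> real^'n \<Rightarrow> 'm" where
  "chart_inv c \<equiv> inv_into (fst c) (snd c)"

definition smooth_atlas :: "('m::topological_space, 'n::finite) chart set \<Rightarrow> bool" where
  "smooth_atlas A \<longleftrightarrow>
     \<Union> (fst ` A) = UNIV \<and>
     (\<forall>c\<in>A. open (fst c) \<and> open (snd c ` fst c) \<and>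
        homeomorphism (fst c) (snd c ` fst c) (snd c) (chart_inv c)) \<and>
     (\<forall>c\<in>A. \<forall>d\<in>A. \<forall>k. Ck_on k (snd d \<circ> chart_inv c) (snd c ` (fst c \<inter> fst d)))"

text \<open>A tangent vector at \<open>x\<close> is the family of its coordinate vectors in all charts at \<open>x\<close>, which
  transform by the Jacobians of the coordinate changes; it is \<open>0\<close> at the other pairs, so that
  distinct functions are distinct vectors and the vector space operations are pointwise.\<close>

type_synonym ('m, 'n) tvec = "('m, 'n) chart \<Rightarrow> real^'n"

definition coord_change ::
  "('m, 'n::finite) chart \<Rightarrow> ('m, 'n) chart \<Rightarrow> 'm \<Rightarrow> real^'n \<Rightarrow> real^'n" where
  "coord_change c d x = frechet_derivative (snd d \<circ> chart_inv c) (at (snd c x))"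

definition tangent_space :: "('m, 'n::finite) chart set \<Rightarrow> 'm \<Rightarrow> ('m, 'n) tvec set" where
  "tangent_space A x = {v.
     (\<forall>c. \<not> (c \<in> A \<and> x \<in> fst c) \<longrightarrow> v c = 0) \<and>
     (\<forall>c\<in>A. \<forall>d\<in>A. x \<in> fst c \<and> x \<in> fst d \<longrightarrow> v d = coord_change c d x (v c))}"

definition tangent_bundle :: "('m, 'n::finite) chart set \<Rightarrow> ('m \<times> ('m, 'n) tvec) set" where
  "tangent_bundle A = Sigma UNIV (tangent_space A)"

text \<open>The tangent vector \<open>y\<^sup>\<mu> \<partial>\<^sub>\<mu>\<close> at \<open>x\<close>, in the coordinates of the chart \<open>c\<close>.\<close>

definition tvec_of ::
  "('m, 'n::finite) chart set \<Rightarrow> ('m, 'n) chart \<Rightarrow> 'm \<Rightarrow> real^'n \<Rightarrow> ('m, 'n) tvec" where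
  "tvec_of A c x y = (\<lambda>d. if d \<in> A \<and> x \<in> fst d then coord_change c d x y else 0)"

section \<open>Pseudo-Finsler spaces\<close>

definition coord_cone ::
  "('m, 'n::finite) chart set \<Rightarrow> ('m \<times> ('m, 'n) tvec) set \<Rightarrow> ('m, 'n) chart \<Rightarrow> real^'n \<Rightarrow> (real^'n) set"
  where "coord_cone A \<Omega> c \<xi> = {y. (chart_inv c \<xi>, tvec_of A c (chart_inv c \<xi>) y) \<in> \<Omega>}"

definition coord_fun ::
  "('m, 'n::finite) chart set \<Rightarrow> ('m \<times> ('m, 'n) tvec \<Rightarrow> real) \<Rightarrow> ('m, 'n) chart
     \<Rightarrow> real^'n \<Rightarrow> real^'n \<Rightarrow> real"
  where "coord_fun A F c \<xi> y = F (chart_inv c \<xi>, tvec_of A c (chart_inv c \<xi>) y)"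

text \<open>The closure of the cone \<open>\<Omega>\<^sub>x\<close> within \<open>T\<^sub>xM\<close>.\<close>

definition fibre_closure ::
  "('m, 'n::finite) chart set \<Rightarrow> ('m \<times> ('m, 'n) tvec) set \<Rightarrow> 'm \<Rightarrow> ('m, 'n) tvec set" where
  "fibre_closure A \<Omega> x = {v \<in> tangent_space A x.
     \<forall>c\<in>A. x \<in> fst c \<longrightarrow> v c \<in> closure ((\<lambda>w. w c) ` (\<Omega> `` {x}))}"

definition pseudo_finsler ::
  "('m::topological_space, 'n::finite) chart set \<Rightarrow> ('m \<times> ('m, 'n) tvec) set
     \<Rightarrow> ('m \<times> ('m, 'n) tvec \<Rightarrow> real) \<Rightarrow> bool" where
  "pseudo_finsler A \<Omega> F \<longleftrightarrow>
     smooth_atlas A \<and> \<Omega> \<subseteq> tangent_bundle A \<and> fst ` \<Omega> = UNIV \<and>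
     (\<forall>c\<in>A. open {(\<xi>, y). \<xi> \<in> snd c ` fst c \<and> y \<in> coord_cone A \<Omega> c \<xi>}) \<and>
     (\<forall>c\<in>A. \<forall>\<xi>\<in>snd c ` fst c. pseudo_minkowski (coord_cone A \<Omega> c \<xi>) (coord_fun A F c \<xi>)) \<and>
     (\<forall>c\<in>A. \<forall>d\<in>A. \<forall>\<xi>\<in>snd c ` fst c. \<forall>\<zeta>\<in>snd d ` fst d.
        (\<lambda>y. signature (hess (coord_fun A F c \<xi>) y)) ` coord_cone A \<Omega> c \<xi> =
        (\<lambda>y. signature (hess (coord_fun A F d \<zeta>) y)) ` coord_cone A \<Omega> d \<zeta>) \<and>
     (\<forall>c\<in>A. \<forall>y. Ck_on 2 (\<lambda>\<xi>. coord_fun A F c \<xi> y)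
        {\<xi> \<in> snd c ` fst c. y \<in> coord_cone A \<Omega> c \<xi>})"

definition linear_iso_on ::
  "('m, 'n::finite) tvec set \<Rightarrow> (('m, 'n) tvec \<Rightarrow> 'v::real_vector) \<Rightarrow> bool" where
  "linear_iso_on T f \<longleftrightarrow> bij_betw f T UNIV \<and>
     (\<forall>v\<in>T. \<forall>w\<in>T. \<forall>a b. f (\<lambda>c. a *\<^sub>R v c + b *\<^sub>R w c) = a *\<^sub>R f v + b *\<^sub>R f w)"

text \<open>A local family of isomorphisms \<open>\<phi>\<^sub>x\<close>, \<open>x \<in> U\<close>, identifying \<open>(T\<^sub>xM, F\<^sub>x)\<close> with \<open>(V, L)\<close>.
  It is required to be \<open>C^1\<close> in \<open>x\<close>, the least for which commutation coefficients make sense.\<close>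

definition local_model ::
  "('m::topological_space, 'n::finite) chart set \<Rightarrow> ('m \<times> ('m, 'n) tvec) set
     \<Rightarrow> ('m \<times> ('m, 'n) tvec \<Rightarrow> real) \<Rightarrow> 'v::euclidean_space set \<Rightarrow> ('v \<Rightarrow> real)
     \<Rightarrow> 'm set \<Rightarrow> ('m \<Rightarrow> ('m, 'n) tvec \<Rightarrow> 'v) \<Rightarrow> bool" where
  "local_model A \<Omega> F \<omega> L U \<phi> \<longleftrightarrow> open U \<and>
     (\<forall>x\<in>U. linear_iso_on (tangent_space A x) (\<phi> x) \<and> \<phi> x ` (\<Omega> `` {x}) = \<omega> \<and>
        (\<forall>v\<in>fibre_closure A \<Omega> x. L (\<phi> x v) = F (x, v))) \<and>
     (\<forall>c\<in>A. \<forall>y. Ck_on 1 (\<lambda>\<xi>. \<phi> (chart_inv c \<xi>) (tvec_of A c (chart_inv c \<xi>) y))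
        (snd c ` (U \<inter> fst c)))"

definition modeled_on ::
  "('m::topological_space, 'n::finite) chart set \<Rightarrow> ('m \<times> ('m, 'n) tvec) set
     \<Rightarrow> ('m \<times> ('m, 'n) tvec \<Rightarrow> real) \<Rightarrow> 'v::euclidean_space set \<Rightarrow> ('v \<Rightarrow> real) \<Rightarrow> bool" where
  "modeled_on A \<Omega> F \<omega> L \<longleftrightarrow> (\<forall>x. \<exists>U \<phi>. x \<in> U \<and> local_model A \<Omega> F \<omega> L U \<phi>)"

section \<open>Vierbein\<close>

definition is_basis :: "('n::finite \<Rightarrow> 'v::euclidean_space) \<Rightarrow> bool" where
  "is_basis b \<longleftrightarrow> inj b \<and> independent (range b) \<and> span (range b) = UNIV"

text \<open>The matrix \<open>e\<^sup>\<mu>\<^sub>a\<close> (row \<open>\<mu>\<close>, column \<open>a\<close>) of \<open>e\<^sub>a = \<phi>\<^sub>x\<^sup>-\<^sup>1(b\<^sub>a)\<close> in the chart \<open>c\<close>, and the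
  matrix \<open>e\<^sup>a\<^sub>\<mu>\<close> (row \<open>a\<close>, column \<open>\<mu>\<close>) of the dual basis.\<close>

definition vierbein ::
  "('m, 'n::finite) chart set \<Rightarrow> ('m \<Rightarrow> ('m, 'n) tvec \<Rightarrow> 'v) \<Rightarrow> ('n \<Rightarrow> 'v)
     \<Rightarrow> ('m, 'n) chart \<Rightarrow> real^'n \<Rightarrow> real^'n^'n" where
  "vierbein A \<phi> b c \<xi> = (\<chi> \<mu> a.
     inv_into (tangent_space A (chart_inv c \<xi>)) (\<phi> (chart_inv c \<xi>)) (b a) c $ \<mu>)"

definition dual_vierbein ::
  "('m, 'n::finite) chart set \<Rightarrow> ('m \<Rightarrow> ('m, 'n) tvec \<Rightarrow> 'v) \<Rightarrow> ('n \<Rightarrow> 'v)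
     \<Rightarrow> ('m, 'n) chart \<Rightarrow> real^'n \<Rightarrow> real^'n^'n" where
  "dual_vierbein A \<phi> b c \<xi> = matrix_inv (vierbein A \<phi> b c \<xi>)"

definition lie_bracket ::
  "(real^'n \<Rightarrow> real^'n) \<Rightarrow> (real^'n \<Rightarrow> real^'n) \<Rightarrow> real^'n \<Rightarrow> real^'n::finite" where
  "lie_bracket X Y \<xi> = (\<chi> \<mu>. \<Sum>\<nu>\<in>UNIV.
     X \<xi> $ \<nu> * pd \<nu> (\<lambda>z. Y z $ \<mu>) \<xi> - Y \<xi> $ \<nu> * pd \<nu> (\<lambda>z. X z $ \<mu>) \<xi>)"

text \<open>\<open>L\<close> as a function of the components \<open>y\<^sup>a\<close> with respect to the basis \<open>b\<close>.\<close>

definition frame_fun :: "('n::finite \<Rightarrow> 'v::euclidean_space) \<Rightarrow> ('v \<Rightarrow> real) \<Rightarrow> real^'n \<Rightarrow> real" where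
  "frame_fun b L y = L (\<Sum>a\<in>UNIV. y $ a *\<^sub>R b a)"

section \<open>Tensors on the fibre\<close>

text \<open>Below, \<open>f\<close> is the pseudo-Minkowski function in linear coordinates and \<open>y\<close> the point at which
  the components are evaluated.\<close>

definition y_low :: "(real^'n \<Rightarrow> real) \<Rightarrow> real^'n \<Rightarrow> 'n::finite \<Rightarrow> real" where
  "y_low f y a = pd a f y"

definition metric_tensor :: "(real^'n \<Rightarrow> real) \<Rightarrow> real^'n \<Rightarrow> real^'n^'n::finite" where
  "metric_tensor f y = (\<chi> a b. pd a (pd b f) y)"

definition inv_metric :: "(real^'n \<Rightarrow> real) \<Rightarrow> real^'n \<Rightarrow> real^'n^'n::finite" where
  "inv_metric f y = matrix_inv (metric_tensor f y)"

definition cartan :: "(real^'n \<Rightarrow> real) \<Rightarrow> real^'n \<Rightarrow> 'n::finite \<Rightarrow> 'n \<Rightarrow> 'n \<Rightarrow> real" where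
  "cartan f y a b c = 1/2 * pd a (pd b (pd c f)) y"

text \<open>\<open>cartan_up f y m b c\<close> is \<open>C\<^sup>m\<^sub>b\<^sub>c\<close>.\<close>

definition cartan_up :: "(real^'n \<Rightarrow> real) \<Rightarrow> real^'n \<Rightarrow> 'n::finite \<Rightarrow> 'n \<Rightarrow> 'n \<Rightarrow> real" where
  "cartan_up f y m b c = (\<Sum>a\<in>UNIV. inv_metric f y $ m $ a * cartan f y a b c)"

definition mean_cartan :: "(real^'n \<Rightarrow> real) \<Rightarrow> real^'n \<Rightarrow> 'n::finite \<Rightarrow> real" where
  "mean_cartan f y a = (\<Sum>b\<in>UNIV. \<Sum>c\<in>UNIV. inv_metric f y $ b $ c * cartan f y a b c)"

definition mean_cartan_up :: "(real^'n \<Rightarrow> real) \<Rightarrow> real^'n \<Rightarrow> 'n::finite \<Rightarrow> real" where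
  "mean_cartan_up f y a = (\<Sum>b\<in>UNIV. inv_metric f y $ a $ b * mean_cartan f y b)"

text \<open>\<open>vcartan_I f y a b\<close> is the component \<open>\<nabla>\<^sub>a I\<^sup>b\<close> of the vertical Cartan derivative of the mean
  Cartan vector.\<close>

definition vcartan_I :: "(real^'n \<Rightarrow> real) \<Rightarrow> real^'n \<Rightarrow> 'n::finite \<Rightarrow> 'n \<Rightarrow> real" where
  "vcartan_I f y a b = pd a (\<lambda>z. mean_cartan_up f z b) y
     + (\<Sum>c\<in>UNIV. cartan_up f y b a c * mean_cartan_up f y c)"

definition kdelta :: "'n \<Rightarrow> 'n \<Rightarrow> real" where
  "kdelta a b = (if a = b then 1 else 0)"

text \<open>\<open>g\<^sub>y(y,y)\<close>, which is \<open>2L\<close> by convention.\<close>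

definition g_yy :: "(real^'n \<Rightarrow> real) \<Rightarrow> real^'n::finite \<Rightarrow> real" where
  "g_yy f y = 2 * f y"

text \<open>\<open>hproj f y a b\<close> is \<open>h\<^sup>a\<^sub>b\<close>; only meaningful where \<open>g_yy f y \<noteq> 0\<close>.\<close>

definition hproj :: "(real^'n \<Rightarrow> real) \<Rightarrow> real^'n \<Rightarrow> 'n::finite \<Rightarrow> 'n \<Rightarrow> real" where
  "hproj f y a b = kdelta a b - 1 / g_yy f y * (y $ a) * y_low f y b"

text \<open>For coefficients \<open>C d a b = c\<^sup>d\<^sub>a\<^sub>b\<close>: the lowered \<open>c\<^sub>a\<^sub>b\<^sub>c\<close> and \<open>k\<^sub>m\<^sub>n\<^sub>e\<close>.\<close>

definition comm_low ::
  "(real^'n \<Rightarrow> real) \<Rightarrow> real^'n \<Rightarrow> ('n \<Rightarrow> 'n \<Rightarrow> 'n \<Rightarrow> real) \<Rightarrow> 'n::finite \<Rightarrow> 'n \<Rightarrow> 'n \<Rightarrow> real" where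
  "comm_low f y C a b c = (\<Sum>d\<in>UNIV. metric_tensor f y $ a $ d * C d b c)"

definition kcoef ::
  "(real^'n \<Rightarrow> real) \<Rightarrow> real^'n \<Rightarrow> ('n \<Rightarrow> 'n \<Rightarrow> 'n \<Rightarrow> real) \<Rightarrow> 'n::finite \<Rightarrow> 'n \<Rightarrow> 'n \<Rightarrow> real" where
  "kcoef f y C m n e =
     1/2 * (comm_low f y C m n e + comm_low f y C n e m - comm_low f y C e m n)"

definition antisym2 :: "('n \<Rightarrow> 'n \<Rightarrow> real) \<Rightarrow> 'n \<Rightarrow> 'n \<Rightarrow> real" where
  "antisym2 X n m = 1/2 * (X n m - X m n)"

section \<open>Spray, Berwald and Landsberg curvature\<close>

text \<open>\<open>\<L> \<xi> y\<close> is the pseudo-Finsler function in local coordinates.\<close>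

definition spray :: "(real^'n \<Rightarrow> real^'n \<Rightarrow> real) \<Rightarrow> real^'n \<Rightarrow> real^'n \<Rightarrow> 'n::finite \<Rightarrow> real" where
  "spray \<L> \<xi> y \<mu> = 1/2 * (\<Sum>\<sigma>\<in>UNIV. inv_metric (\<L> \<xi>) y $ \<mu> $ \<sigma> *
     ((\<Sum>\<rho>\<in>UNIV. pd \<rho> (\<lambda>x. pd \<sigma> (\<L> x) y) \<xi> * y $ \<rho>) - pd \<sigma> (\<lambda>x. \<L> x y) \<xi>))"

definition berwald ::
  "(real^'n \<Rightarrow> real^'n \<Rightarrow> real) \<Rightarrow> real^'n \<Rightarrow> real^'n \<Rightarrow> 'n::finite \<Rightarrow> 'n \<Rightarrow> 'n \<Rightarrow> 'n \<Rightarrow> real" where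
  "berwald \<L> \<xi> y \<rho> \<alpha> \<beta> \<gamma> = pd \<alpha> (pd \<beta> (pd \<gamma> (\<lambda>z. spray \<L> \<xi> z \<rho>))) y"

text \<open>The third derivatives of the spray involve fifth derivatives of the pseudo-Finsler function,
  which need not exist for a function of class \<open>C^4\<close> on the fibres. (On a space modeled on a
  pseudo-Minkowski space the derivatives inside the
  outermost one always exist.)\<close>

definition berwald_exists ::
  "(real^'n \<Rightarrow> real^'n \<Rightarrow> real) \<Rightarrow> real^'n \<Rightarrow> real^'n::finite \<Rightarrow> bool" where
  "berwald_exists \<L> \<xi> y \<longleftrightarrow>
     (\<forall>\<rho> \<alpha> \<beta> \<gamma>. pderiv_exists \<alpha> (pd \<beta> (pd \<gamma> (\<lambda>z. spray \<L> \<xi> z \<rho>))) y)"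

text \<open>\<open>G\<^sup>r\<^sub>a\<^sub>b\<^sub>c\<close>, for a vierbein \<open>E\<close> with dual \<open>D\<close>.\<close>

definition berwald_frame ::
  "(real^'n \<Rightarrow> real^'n \<Rightarrow> real) \<Rightarrow> real^'n^'n \<Rightarrow> real^'n^'n \<Rightarrow> real^'n \<Rightarrow> real^'n
     \<Rightarrow> 'n::finite \<Rightarrow> 'n \<Rightarrow> 'n \<Rightarrow> 'n \<Rightarrow> real" where
  "berwald_frame \<L> E D \<xi> \<eta> r a b c =
     (\<Sum>\<rho>\<in>UNIV. \<Sum>\<alpha>\<in>UNIV. \<Sum>\<beta>\<in>UNIV. \<Sum>\<gamma>\<in>UNIV.
        berwald \<L> \<xi> \<eta> \<rho> \<alpha> \<beta> \<gamma> * D $ r $ \<rho> * E $ \<alpha> $ a * E $ \<beta> $ b * E $ \<gamma> $ c)"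

text \<open>\<open>L\<^sub>a\<^sub>b\<^sub>c\<close> and its trace \<open>J\<^sub>c = L\<^sup>a\<^sub>a\<^sub>c\<close>; \<open>f\<close> and \<open>\<L>\<close> are the same function in frame and in local
  coordinates, \<open>\<eta>\<close> has the components \<open>y\<^sup>\<mu>\<close> and \<open>D *v \<eta>\<close> the components \<open>y\<^sup>a\<close>.\<close>

definition landsberg ::
  "(real^'n \<Rightarrow> real) \<Rightarrow> (real^'n \<Rightarrow> real^'n \<Rightarrow> real) \<Rightarrow> real^'n^'n \<Rightarrow> real^'n^'n
     \<Rightarrow> real^'n \<Rightarrow> real^'n \<Rightarrow> 'n::finite \<Rightarrow> 'n \<Rightarrow> 'n \<Rightarrow> real" where
  "landsberg f \<L> E D \<xi> \<eta> a b c =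
     - 1/2 * (\<Sum>r\<in>UNIV. y_low f (D *v \<eta>) r * berwald_frame \<L> E D \<xi> \<eta> r a b c)"

definition mean_landsberg ::
  "(real^'n \<Rightarrow> real) \<Rightarrow> (real^'n \<Rightarrow> real^'n \<Rightarrow> real) \<Rightarrow> real^'n^'n \<Rightarrow> real^'n^'n
     \<Rightarrow> real^'n \<Rightarrow> real^'n \<Rightarrow> 'n::finite \<Rightarrow> real" where
  "mean_landsberg f \<L> E D \<xi> \<eta> c =
     (\<Sum>a\<in>UNIV. \<Sum>b\<in>UNIV. inv_metric f (D *v \<eta>) $ a $ b * landsberg f \<L> E D \<xi> \<eta> b a c)"

end

theory Submission
  imports Defs
begin

text \<open>In a frame the spray is a quadratic form in \<open>y\<close> plus \<open>Q\<^sup>r = 1/2 g\<^sup>r\<^sup>d c\<^sup>s\<^sub>d\<^sub>e y\<^sup>e y\<^sub>s\<close>, so only \<open>Q\<close> contributes to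
  the Berwald curvature. Since \<open>c\<^sup>s\<^sub>d\<^sub>e\<close> is antisymmetric in \<open>d, e\<close>, \<open>y\<^sub>rQ\<^sup>r = 0\<close>, and three
  differentiations express \<open>y\<^sub>r\<partial>\<^sub>a\<partial>\<^sub>b\<partial>\<^sub>cQ\<^sup>r\<close> by lower derivatives of \<open>Q\<close>. Taking the trace and
  eliminating the derivatives of \<open>Q\<close> by those of \<open>2 g\<^sub>d\<^sub>r Q\<^sup>r = c\<^sup>s\<^sub>d\<^sub>e y\<^sup>e y\<^sub>s\<close>, which is a polynomial
  in \<open>y\<close> and \<open>y\<^sub>s\<close>, leaves the first formula. The second follows from
  \<open>2 k\<^sub>m\<^sub>n\<^sub>e y\<^sup>e = g\<^sub>m\<^sub>d c\<^sup>d\<^sub>n\<^sub>e y\<^sup>e - g\<^sub>n\<^sub>d c\<^sup>d\<^sub>m\<^sub>e y\<^sup>e - y\<^sub>d c\<^sup>d\<^sub>m\<^sub>n\<close>, and the third from the antisymmetry of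
  \<open>k\<^sub>m\<^sub>n\<^sub>e\<close> in \<open>m, n\<close> and Euler's relation for \<open>I\<close>.\<close>

section \<open>Functions of class \<open>C^k\<close>\<close>

text \<open>What makes the elimination close is the trace. The fourth derivatives of the
  pseudo-Minkowski function contracted with \<open>Q\<close> cannot be lowered one by one, but their
  trace is, up to a term quadratic in the third derivatives, the derivative of the mean Cartan form
  contracted with \<open>Q\<close>; eliminating the first derivatives of \<open>Q\<close> produces
  exactly that quadratic term. Regularity shapes the rest. Differentiating y_r Q^r = 0 twice
  rewrites y_r times the second derivatives of \<open>Q\<close> as a C^1 function, and only that
  contraction is differentiated once more. The index algebra can therefore be carried out on plain
  numbers, the values of finitely many derivatives at one point. The split of the spray has its
  origin in the coframe, through which alone the function depends on x: the antisymmetric part of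
  the coframe's first derivatives yields the commutation coefficients, and their contraction with
  two velocities yields the quadratic form.\<close>

lemma Ck_on_cong:
  assumes "open S" "\<And>x. x \<in> S \<Longrightarrow> f x = g x"
  shows "Ck_on k f S \<longleftrightarrow> Ck_on k g S"
  using assms(2)
proof (induction k arbitrary: f g)
  case 0
  then show ?case by (simp cong: continuous_on_cong)
next
  case (Suc k)
  have *: "(f has_derivative f') (at x) \<longleftrightarrow> (g has_derivative f') (at x)" if "x \<in> S" for x f'
    using has_derivative_transform_within_open[OF _ assms(1) that, of f f' UNIV g]
      has_derivative_transform_within_open[OF _ assms(1) that, of g f' UNIV f] Suc.prems by auto
  then have "frechet_derivative f (at x) = frechet_derivative g (at x)" if "x \<in> S" for x
    using that by (simp add: frechet_derivative_def)
  then have "Ck_on k (\<lambda>x. frechet_derivative f (at x) v) S \<longleftrightarrow> Ck_on k (\<lambda>x. frechet_derivative g (at x) v) S" for v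
    by (intro Suc.IH) simp
  with * show ?case by (auto simp: differentiable_def)
qed

lemma Ck_on_transform:
  "Ck_on k f S \<Longrightarrow> open S \<Longrightarrow> (\<And>x. x \<in> S \<Longrightarrow> f x = g x) \<Longrightarrow> Ck_on k g S"
  using Ck_on_cong[of S f g k] by blast

lemma Ck_on_imp_continuous_on: "Ck_on k f S \<Longrightarrow> continuous_on S f"
  by (cases k)
    (auto intro!: differentiable_imp_continuous_on[OF differentiable_at_imp_differentiable_on])

lemma Ck_on_SucD: "Ck_on (Suc k) f S \<Longrightarrow> Ck_on k f S"
proof (induction k arbitrary: f)
  case 0
  then show ?case using Ck_on_imp_continuous_on[of "Suc 0" f S] by simp
next
  case (Suc k)
  then show ?case by (metis Ck_on.simps(2))
qed

lemma Ck_on_le: "Ck_on m f S \<Longrightarrow> k \<le> m \<Longrightarrow> Ck_on k f S"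
  using Ck_on_SucD by (induction m) (auto simp: le_Suc_eq simp del: Ck_on.simps(2))

lemma Ck_on_differentiable: "Ck_on k f S \<Longrightarrow> 0 < k \<Longrightarrow> x \<in> S \<Longrightarrow> f differentiable (at x)"
  by (cases k) auto

lemma Ck_on_const [simp]: "Ck_on k (\<lambda>x. c) S"
  by (induction k arbitrary: c) auto

text \<open>\<open>frechet_derivative\<close> is given by choice; uniqueness of derivatives lets an
  explicitly known derivative take its place in the recursive clause of
  \<open>Ck_on\<close>.\<close>

lemma Ck_on_SucI:
  assumes "open S" "\<And>x. x \<in> S \<Longrightarrow> (f has_derivative f' x) (at x)"
    "\<And>v. Ck_on k (\<lambda>x. f' x v) S"
  shows "Ck_on (Suc k) f S"
proof -
  have "frechet_derivative f (at x) = f' x" if "x \<in> S" for x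
    using assms(2)[OF that] frechet_derivative_at by metis
  then have "Ck_on k (\<lambda>x. frechet_derivative f (at x) v) S" for v
    using assms(3)[of v] Ck_on_cong[OF assms(1), of "\<lambda>x. frechet_derivative f (at x) v" "\<lambda>x. f' x v"]
    by simp
  then show ?thesis using assms(2) by (auto simp: differentiable_def)
qed

lemma Ck_on_Suc_has_derivative:
  "Ck_on (Suc k) f S \<Longrightarrow> x \<in> S \<Longrightarrow> (f has_derivative frechet_derivative f (at x)) (at x)"
  using frechet_derivative_works by auto

lemma Ck_on_Suc_frechet: "Ck_on (Suc k) f S \<Longrightarrow> Ck_on k (\<lambda>x. frechet_derivative f (at x) v) S"
  by simp

lemmas Ck_on_SucDs = Ck_on_Suc_has_derivative Ck_on_Suc_frechet

declare Ck_on.simps(2) [simp del]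

lemma Ck_on_add:
  assumes "open S" "Ck_on k f S" "Ck_on k g S"
  shows "Ck_on k (\<lambda>x. f x + g x) S"
  using assms(2,3)
proof (induction k arbitrary: f g)
  case 0
  then show ?case by (auto intro: continuous_intros)
next
  case (Suc k)
  show ?case
    by (rule Ck_on_SucI[OF assms(1), where f' = "\<lambda>x h. frechet_derivative f (at x) h + frechet_derivative g (at x) h"])
      (auto intro!: has_derivative_add Suc.IH Ck_on_SucDs Suc.prems)
qed

lemma Ck_on_sum:
  assumes "open S" "\<And>i. i \<in> I \<Longrightarrow> Ck_on k (f i) S"
  shows "Ck_on k (\<lambda>x. \<Sum>i\<in>I. f i x) S"
  using assms(2) by (induction I rule: infinite_finite_induct) (auto intro: Ck_on_add[OF assms(1)])

lemma Ck_on_mult: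
  fixes f g :: "'a::euclidean_space \<Rightarrow> real"
  assumes "open S" "Ck_on k f S" "Ck_on k g S"
  shows "Ck_on k (\<lambda>x. f x * g x) S"
  using assms(2,3)
proof (induction k arbitrary: f g)
  case 0
  then show ?case by (auto intro: continuous_intros)
next
  case (Suc k)
  have k: "Ck_on k f S" "Ck_on k g S" using Suc.prems Ck_on_SucD by blast+
  show ?case
  proof (rule Ck_on_SucI[OF assms(1), where f' = "\<lambda>x h. f x * frechet_derivative g (at x) h + frechet_derivative f (at x) h * g x"])
    show "((\<lambda>x. f x * g x) has_derivative (\<lambda>h. f x * frechet_derivative g (at x) h
        + frechet_derivative f (at x) h * g x)) (at x)" if "x \<in> S" for x
      using that Suc.prems by (intro has_derivative_mult Ck_on_SucDs)
    show "Ck_on k (\<lambda>x. f x * frechet_derivative g (at x) v + frechet_derivative f (at x) v * g x) S" for v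
      by (intro Ck_on_add[OF assms(1)] Suc.IH k Ck_on_SucDs Suc.prems)
  qed
qed

lemma Ck_on_prod:
  fixes f :: "'i \<Rightarrow> 'a::euclidean_space \<Rightarrow> real"
  assumes "open S" "\<And>i. i \<in> I \<Longrightarrow> Ck_on k (f i) S"
  shows "Ck_on k (\<lambda>x. \<Prod>i\<in>I. f i x) S"
  using assms(2) by (induction I rule: infinite_finite_induct) (auto intro: Ck_on_mult[OF assms(1)])

text \<open>The derivative of 1/f is -(1/f) f' (1/f), and its factors 1/f only have to be smooth to
  one order less, which the induction hypothesis provides.\<close>

lemma Ck_on_inverse:
  fixes f :: "'a::euclidean_space \<Rightarrow> real"
  assumes "open S" "Ck_on k f S" "\<And>x. x \<in> S \<Longrightarrow> f x \<noteq> 0"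
  shows "Ck_on k (\<lambda>x. inverse (f x)) S"
  using assms(2)
proof (induction k)
  case 0
  then show ?case using assms(3) by (auto intro: continuous_intros)
next
  case (Suc k)
  have k: "Ck_on k (\<lambda>x. inverse (f x)) S" using Suc Ck_on_SucD by blast
  show ?case
  proof (rule Ck_on_SucI[OF assms(1), where f' = "\<lambda>x h. - (inverse (f x) * frechet_derivative f (at x) h * inverse (f x))"])
    show "((\<lambda>x. inverse (f x)) has_derivative (\<lambda>h. - (inverse (f x) * frechet_derivative f (at x) h
        * inverse (f x)))) (at x)" if "x \<in> S" for x
      by (rule Deriv.has_derivative_inverse[OF assms(3)[OF that] Ck_on_Suc_has_derivative[OF Suc.prems that]])
    have "Ck_on k (\<lambda>x. (-1) * (inverse (f x) * frechet_derivative f (at x) v * inverse (f x))) S" for v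
      by (intro Ck_on_mult[OF assms(1)] k Ck_on_SucDs Suc.prems Ck_on_const)
    then show "Ck_on k (\<lambda>x. - (inverse (f x) * frechet_derivative f (at x) v * inverse (f x))) S" for v
      by simp
  qed
qed

lemma Ck_on_bounded_linear:
  assumes "bounded_linear T" "open S" "Ck_on k f S"
  shows "Ck_on k (\<lambda>x. T (f x)) S"
  using assms(3)
proof (induction k arbitrary: f)
  case 0
  then show ?case using assms(1) by (auto intro: bounded_linear.continuous_on)
next
  case (Suc k)
  show ?case
    by (rule Ck_on_SucI[OF assms(2), where f' = "\<lambda>x h. T (frechet_derivative f (at x) h)"])
      (auto intro!: bounded_linear.has_derivative[OF assms(1)] Suc.IH Ck_on_SucDs Suc.prems)
qed

lemma has_derivative_compose_linear:
  assumes "bounded_linear T" "(f has_derivative f') (at (T x))"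
  shows "((\<lambda>x. f (T x)) has_derivative (\<lambda>h. f' (T h))) (at x)"
  using diff_chain_at[OF bounded_linear_imp_has_derivative[OF assms(1)] assms(2)]
  by (simp add: o_def)

lemma frechet_derivative_compose_linear:
  assumes "bounded_linear T" "f differentiable (at (T x))"
  shows "frechet_derivative (\<lambda>x. f (T x)) (at x) = (\<lambda>h. frechet_derivative f (at (T x)) (T h))"
  using has_derivative_compose_linear[OF assms(1)] assms(2) frechet_derivative_works
    frechet_derivative_at by metis

lemma Ck_on_compose_linear:
  assumes "bounded_linear T" "open S" "Ck_on k f S"
  shows "Ck_on k (\<lambda>x. f (T x)) (T -` S)"
  using assms(3)
proof (induction k arbitrary: f)
  case 0
  then show ?case using continuous_on_compose2[of S f "T -` S" T] linear_continuous_on[OF assms(1)]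
    by auto
next
  case (Suc k)
  have "open (T -` S)"
    using assms by (intro open_vimage) (auto intro: linear_continuous_on)
  then show ?case
    by (rule Ck_on_SucI[where f' = "\<lambda>x h. frechet_derivative f (at (T x)) (T h)"])
      (use Suc.prems in \<open>auto intro!: has_derivative_compose_linear assms(1) Suc.IH Ck_on_SucDs\<close>)
qed

section \<open>Smoothness of the matrix inverse\<close>

lemma matrix_inv_mult:
  assumes "invertible A"
  shows "A ** matrix_inv A = mat 1" "matrix_inv A ** A = mat 1"
  using assms unfolding invertible_def matrix_inv_def by (metis (mono_tags, lifting) someI_ex)+

lemma matrix_inv_unique:
  fixes A :: "'a::comm_semiring_1^'n^'n"
  assumes "A ** B = mat 1" "B ** A = mat 1"
  shows "matrix_inv A = B"
  using assms matrix_inv_mult[of A] unfolding invertible_def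
  by (metis matrix_mul_assoc matrix_mul_lid matrix_mul_rid)

text \<open>Cramer's rule: column j of the inverse solves the system with the j-th unit vector on
  the right, so each entry is a quotient of two determinants, which are polynomials in the entries
  of the matrices.\<close>

lemma Ck_on_matrix_inv:
  fixes M :: "'a::euclidean_space \<Rightarrow> real^'n^'n"
  assumes "open S" "\<And>i j. Ck_on k (\<lambda>x. M x $ i $ j) S" "\<And>x. x \<in> S \<Longrightarrow> invertible (M x)"
  shows "Ck_on k (\<lambda>x. matrix_inv (M x) $ i $ j) S"
proof -
  have det: "Ck_on k (\<lambda>x. det (N x)) S" if "\<And>i j. Ck_on k (\<lambda>x. N x $ i $ j) S"
    for N :: "'a \<Rightarrow> real^'n^'n"
    unfolding det_def by (intro Ck_on_sum Ck_on_mult Ck_on_prod assms(1) Ck_on_const that)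
  let ?N = "\<lambda>x. (\<chi> r c. if c = i then axis j 1 $ r else M x $ r $ c) :: real^'n^'n"
  have "matrix_inv (M x) $ i $ j = det (?N x) * inverse (det (M x))" if "x \<in> S" for x
  proof -
    have "M x ** matrix_inv (M x) = mat 1"
      by (rule matrix_inv_mult[OF assms(3)[OF that]])
    then have "M x *v (matrix_inv (M x) *v axis j 1) = axis j 1"
      by (simp add: matrix_vector_mul_assoc)
    then have "matrix_inv (M x) *v axis j 1 = (\<chi> k. det(\<chi> r c. if c=k then axis j 1 $ r else M x$r$c) / det (M x))"
      using cramer[of "M x"] assms(3)[OF that] invertible_det_nz by blast
    then have "(matrix_inv (M x) *v axis j 1) $ i = det (?N x) / det (M x)"
      by simp
    then show ?thesis by (simp add: matrix_vector_mul_component inner_axis divide_inverse)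
  qed
  moreover have "Ck_on k (\<lambda>x. det (?N x) * inverse (det (M x))) S"
  proof (intro Ck_on_mult Ck_on_inverse assms(1) det)
    show "Ck_on k (\<lambda>x. ?N x $ r $ c) S" for r c
      by (cases "c = i") (auto simp: assms(2))
  qed (use assms invertible_det_nz in auto)
  ultimately show ?thesis
    using Ck_on_cong[OF assms(1), of "\<lambda>x. matrix_inv (M x) $ i $ j"
      "\<lambda>x. det (?N x) * inverse (det (M x))"] by simp
qed

section \<open>Finite sums\<close>

lemma sum_kdelta [simp]:
  fixes h :: "'n::finite \<Rightarrow> real"
  shows "(\<Sum>j\<in>UNIV. kdelta i j * h j) = h i" "(\<Sum>j\<in>UNIV. kdelta j i * h j) = h i"
    "(\<Sum>j\<in>UNIV. h j * kdelta i j) = h i" "(\<Sum>j\<in>UNIV. h j * kdelta j i) = h i"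
  unfolding kdelta_def by (auto simp: if_distrib if_distribR cong: if_cong)

lemma sum_sym_antisym:
  fixes S K :: "'n::finite \<Rightarrow> 'n \<Rightarrow> real"
  assumes "\<And>a b. S a b = S b a" "\<And>a b. K a b = - K b a"
  shows "(\<Sum>a\<in>UNIV. \<Sum>b\<in>UNIV. S a b * K a b) = 0"
proof -
  have "(\<Sum>a\<in>UNIV. \<Sum>b\<in>UNIV. S a b * K a b) = (\<Sum>b\<in>UNIV. \<Sum>a\<in>UNIV. S a b * K a b)"
    by (rule sum.swap)
  also have "\<dots> = (\<Sum>b\<in>UNIV. \<Sum>a\<in>UNIV. - (S b a * K b a))"
    by (intro sum.cong refl) (metis assms mult_minus_right)
  also have "\<dots> = - (\<Sum>b\<in>UNIV. \<Sum>a\<in>UNIV. S b a * K b a)"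
    by (simp add: sum_negf)
  finally show ?thesis by simp
qed

lemma matrix_mult_kdelta:
  fixes A B :: "real^'n::finite^'n"
  assumes "A ** B = mat 1"
  shows "(\<Sum>k\<in>UNIV. A $ i $ k * B $ k $ j) = kdelta i j"
proof -
  have "(A ** B) $ i $ j = mat 1 $ i $ j" using assms by simp
  then show ?thesis by (simp add: matrix_matrix_mult_def mat_def kdelta_def)
qed

lemma sum_transform_inverse:
  fixes A B :: "real^'n::finite^'n"
  assumes "A ** B = mat 1"
  shows "(\<Sum>k\<in>UNIV. (\<Sum>i\<in>UNIV. x i * A $ i $ k) * B $ k $ j) = x j"
proof -
  have "(\<Sum>k\<in>UNIV. (\<Sum>i\<in>UNIV. x i * A $ i $ k) * B $ k $ j)
      = (\<Sum>i\<in>UNIV. x i * (\<Sum>k\<in>UNIV. A $ i $ k * B $ k $ j))"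
    unfolding sum_distrib_left sum_distrib_right
    by (rule trans[OF sum.swap]) (simp add: mult_ac)
  then show ?thesis by (simp add: matrix_mult_kdelta[OF assms])
qed

lemma sum_contract_inverse:
  fixes D E :: "real^'n::finite^'n"
  assumes "D ** E = mat 1"
  shows "(\<Sum>\<alpha>\<in>UNIV. (\<Sum>a\<in>UNIV. D $ a $ \<alpha> * X a) * E $ \<alpha> $ e) = X e"
  using sum_transform_inverse[OF assms, of X e] by (simp add: mult.commute)

section \<open>Partial derivatives\<close>

lemma has_derivative_imp_DERIV_line:
  fixes f :: "'a::real_normed_vector \<Rightarrow> real"
  assumes "(f has_derivative f') (at (x + s *\<^sub>R v))"
  shows "((\<lambda>t. f (x + t *\<^sub>R v)) has_real_derivative f' v) (at s)"
proof -
  have "((\<lambda>t. x + t *\<^sub>R v) has_derivative (\<lambda>t. t *\<^sub>R v)) (at s)"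
    by (auto intro!: derivative_eq_intros)
  then have "((\<lambda>t. f (x + t *\<^sub>R v)) has_derivative (\<lambda>t. f' (t *\<^sub>R v))) (at s)"
    using diff_chain_at[where g = f and f = "\<lambda>t. x + t *\<^sub>R v" and x = s] assms by (simp add: o_def)
  moreover have "(\<lambda>t. f' (t *\<^sub>R v)) = (*) (f' v)"
    using linear_cmul[OF has_derivative_linear[OF assms]] by auto
  ultimately show ?thesis by (simp add: has_field_derivative_def)
qed

text \<open>\<open>pd\<close> is total, so an equation about it says nothing on existence; this
  relation carries existence and value together. It is the notion in \<open>berwald_exists\<close>:
  a derivative along one coordinate line, weaker than differentiability.\<close>

definition has_pd :: "'n::finite \<Rightarrow> (real^'n \<Rightarrow> real) \<Rightarrow> real \<Rightarrow> real^'n \<Rightarrow> bool" where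
  "has_pd i f d x \<longleftrightarrow> ((\<lambda>t. f (x + t *\<^sub>R axis i 1)) has_real_derivative d) (at 0)"

lemma has_pd_imp_pd: "has_pd i f d x \<Longrightarrow> pd i f x = d"
  by (simp add: has_pd_def pd_def DERIV_imp_deriv)

lemma pderiv_exists_has_pd: "pderiv_exists i f x \<longleftrightarrow> has_pd i f (pd i f x) x"
  unfolding pderiv_exists_def has_pd_def pd_def
  by (metis DERIV_imp_deriv differentiable_def has_field_derivative_imp_has_derivative real_differentiableE)

lemma has_derivative_has_pd:
  "(f has_derivative f') (at x) \<Longrightarrow> has_pd i f (f' (axis i 1)) x"
  using has_derivative_imp_DERIV_line[of f f' x 0] by (simp add: has_pd_def)

lemma differentiable_has_pd: "f differentiable (at x) \<Longrightarrow> has_pd i f (pd i f x) x"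
  unfolding differentiable_def using has_derivative_has_pd has_pd_imp_pd by metis

lemma pd_eq_frechet: "f differentiable (at x) \<Longrightarrow> pd i f x = frechet_derivative f (at x) (axis i 1)"
  using has_derivative_has_pd has_pd_imp_pd frechet_derivative_works by blast

lemma frechet_eq_sum_pd:
  assumes "f differentiable (at x)"
  shows "frechet_derivative f (at x) v = (\<Sum>i\<in>UNIV. v $ i * pd i f x)"
proof -
  interpret linear "frechet_derivative f (at x)" using assms by (rule linear_frechet_derivative)
  have "frechet_derivative f (at x) v = frechet_derivative f (at x) (\<Sum>i\<in>UNIV. v $ i *\<^sub>R axis i 1)"
    by (simp add: basis_expansion flip: scalar_mult_eq_scaleR)
  then show ?thesis using assms by (simp add: sum scaleR pd_eq_frechet)
qed

lemma has_pd_cong: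
  assumes "open S" "x \<in> S" "\<And>z. z \<in> S \<Longrightarrow> f z = g z"
  shows "has_pd i f d x \<longleftrightarrow> has_pd i g d x"
proof -
  let ?T = "(\<lambda>t. x + t *\<^sub>R axis i 1) -` S :: real set"
  have "open ?T"
    by (intro open_vimage assms(1) continuous_intros)
  then have "\<forall>\<^sub>F t in nhds 0. x + t *\<^sub>R axis i 1 \<in> S"
    using assms(2) unfolding eventually_nhds by (intro exI[of _ ?T]) auto
  then have "\<forall>\<^sub>F t in nhds 0. f (x + t *\<^sub>R axis i 1) = g (x + t *\<^sub>R axis i 1)"
    by eventually_elim (simp add: assms(3))
  then show ?thesis unfolding has_pd_def by (rule DERIV_cong_ev[OF refl _ refl])
qed

text \<open>No differentiability is involved: \<open>has_pd\<close> agrees for f and g at every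
  candidate value, so the choice inside \<open>deriv\<close> is the same for both.\<close>

lemma pd_cong:
  assumes "open S" "x \<in> S" "\<And>z. z \<in> S \<Longrightarrow> f z = g z"
  shows "pd i f x = pd i g x"
  using has_pd_cong[of S x f g i, OF assms] by (simp add: pd_def deriv_def has_pd_def)

lemma has_pd_const: "has_pd i (\<lambda>x. c) 0 x"
  by (simp add: has_pd_def)

lemma has_pd_add: "has_pd i f d x \<Longrightarrow> has_pd i g e x \<Longrightarrow> has_pd i (\<lambda>x. f x + g x) (d + e) x"
  unfolding has_pd_def by (rule DERIV_add)

lemma has_pd_diff: "has_pd i f d x \<Longrightarrow> has_pd i g e x \<Longrightarrow> has_pd i (\<lambda>x. f x - g x) (d - e) x"
  unfolding has_pd_def by (rule DERIV_diff)

lemma has_pd_mult: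
  assumes "has_pd i f d x" "has_pd i g e x"
  shows "has_pd i (\<lambda>x. f x * g x) (d * g x + f x * e) x"
  using DERIV_mult[OF assms[unfolded has_pd_def]]
  by (simp add: has_pd_def algebra_simps)

lemma has_pd_sum:
  "(\<And>j. j \<in> J \<Longrightarrow> has_pd i (f j) (d j) x) \<Longrightarrow> has_pd i (\<lambda>x. \<Sum>j\<in>J. f j x) (\<Sum>j\<in>J. d j) x"
  unfolding has_pd_def by (rule DERIV_sum)

lemma has_pd_unique: "has_pd i f d x \<Longrightarrow> has_pd i f e x \<Longrightarrow> d = e"
  using has_pd_imp_pd by blast

lemma has_pd_cmult: "has_pd i f d x \<Longrightarrow> has_pd i (\<lambda>x. k * f x) (k * d) x"
  unfolding has_pd_def by (rule DERIV_cmult)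

lemma has_pd_coordinate: "has_pd i (\<lambda>x. x $ j) (kdelta i j) x"
proof -
  have "((\<lambda>t. (x + t *\<^sub>R axis i 1) $ j) has_real_derivative axis i 1 $ j) (at 0)"
    by (auto intro!: derivative_eq_intros)
  then show ?thesis by (simp add: has_pd_def kdelta_def axis_def eq_commute[of i])
qed

lemmas has_pd_intros = has_pd_const has_pd_coordinate has_pd_cmult has_pd_add has_pd_diff has_pd_mult has_pd_sum

lemma has_pd_transform:
  "has_pd i f d x \<Longrightarrow> open S \<Longrightarrow> x \<in> S \<Longrightarrow> (\<And>z. z \<in> S \<Longrightarrow> f z = g z) \<Longrightarrow> has_pd i g d x"
  using has_pd_cong[of S x f g i d] by blast

lemma Ck_on_pd:
  assumes "open S" "Ck_on (Suc k) f S"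
  shows "Ck_on k (pd i f) S"
proof -
  have "pd i f x = frechet_derivative f (at x) (axis i 1)" if "x \<in> S" for x
    using Ck_on_differentiable[OF assms(2) _ that] by (simp add: pd_eq_frechet)
  then show ?thesis
    using Ck_on_Suc_frechet[OF assms(2), of "axis i 1"]
      Ck_on_cong[OF assms(1), of "pd i f" "\<lambda>x. frechet_derivative f (at x) (axis i 1)" k]
    by blast
qed

lemma Ck_on_has_pd: "Ck_on k f S \<Longrightarrow> 0 < k \<Longrightarrow> x \<in> S \<Longrightarrow> has_pd i f (pd i f x) x"
  by (rule differentiable_has_pd[OF Ck_on_differentiable])

text \<open>Differentiability of w in the full sense matters here: the matrix sends a coordinate
  line to a line in an arbitrary direction.\<close>

lemma has_pd_compose_matrix:
  fixes D :: "real^'n^'m"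
  assumes "w differentiable (at (D *v x))"
  shows "has_pd i (\<lambda>x. w (D *v x)) (\<Sum>a\<in>UNIV. D $ a $ i * pd a w (D *v x)) x"
proof -
  have "((\<lambda>x. w (D *v x)) has_derivative (\<lambda>h. frechet_derivative w (at (D *v x)) (D *v h))) (at x)"
    by (rule has_derivative_compose_linear[OF matrix_vector_mul_bounded_linear
          assms[unfolded frechet_derivative_works]])
  from has_derivative_has_pd[OF this, of i] show ?thesis
    by (simp add: frechet_eq_sum_pd[OF assms] matrix_vector_mul_component inner_axis)
qed

text \<open>Serves the derivatives in x at a fixed tangent vector z, where \<open>u x\<close> is the
  coframe at x applied to z.\<close>

lemma has_pd_compose_curve:
  fixes u :: "real^'n \<Rightarrow> real^'m"
  assumes "w differentiable (at (u x))" "\<And>a. (\<lambda>x. u x $ a) differentiable (at x)"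
  shows "has_pd i (\<lambda>x. w (u x)) (\<Sum>a\<in>UNIV. pd i (\<lambda>x. u x $ a) x * pd a w (u x)) x"
proof -
  define u' where "u' h = (\<chi> a. frechet_derivative (\<lambda>x. u x $ a) (at x) h)" for h
  have "(u has_derivative u') (at x)"
    unfolding has_derivative_componentwise_within[of u] Basis_vec_def
    using assms(2)[unfolded frechet_derivative_works] by (auto simp: u'_def inner_axis)
  then have "((\<lambda>x. w (u x)) has_derivative (\<lambda>h. frechet_derivative w (at (u x)) (u' h))) (at x)"
    using diff_chain_at[where f = u and g = w, OF _ assms(1)[unfolded frechet_derivative_works]] by (simp add: o_def)
  from has_derivative_has_pd[OF this, of i] show ?thesis
    by (simp add: frechet_eq_sum_pd[OF assms(1)] u'_def pd_eq_frechet assms(2))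
qed

section \<open>Symmetry of second partial derivatives\<close>

lemma has_pd_line:
  assumes "\<And>z. z \<in> S \<Longrightarrow> f differentiable (at z)" "x + s *\<^sub>R axis i 1 \<in> S"
  shows "((\<lambda>t. f (x + t *\<^sub>R axis i 1)) has_real_derivative pd i f (x + s *\<^sub>R axis i 1)) (at s)"
  using has_derivative_imp_DERIV_line[of f _ x s] assms frechet_derivative_works pd_eq_frechet
  by metis

text \<open>The mean value theorem is applied twice: along u to the increment of f by h v, then
  along v to \<open>pd i f\<close>.\<close>

lemma second_difference_MVT:
  fixes f :: "real^'n::finite \<Rightarrow> real" and i j :: 'n
  assumes "ball x r \<subseteq> S" "open S" "Ck_on 2 f S" "0 < h" "2 * h < r"
  defines "u \<equiv> axis i 1" and "v \<equiv> axis j 1"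
  shows "\<exists>z\<in>ball x (2 * h).
    f (x + h *\<^sub>R u + h *\<^sub>R v) - f (x + h *\<^sub>R u) - f (x + h *\<^sub>R v) + f x = h * (h * pd j (pd i f) z)"
proof -
  have [simp]: "norm u = 1" "norm v = 1" by (simp_all add: u_def v_def)
  have near: "dist x (x + s *\<^sub>R u + t *\<^sub>R v) \<le> s + t" if "0 \<le> s" "0 \<le> t" for s t
    using norm_triangle_ineq[of "s *\<^sub>R u" "t *\<^sub>R v"] that
    by (simp add: dist_norm norm_minus_commute algebra_simps)
  have mem: "x + s *\<^sub>R u + t *\<^sub>R v \<in> S" if "0 \<le> s" "s \<le> h" "0 \<le> t" "t \<le> h" for s t
    using near[of s t] that assms by force
  have f: "f differentiable (at z)" if "z \<in> S" for z
    using Ck_on_differentiable[OF assms(3) _ that] by simp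
  have fi: "pd i f differentiable (at z)" if "z \<in> S" for z
    using Ck_on_differentiable[OF Ck_on_pd[OF assms(2), of 1] _ that] assms(3)
    by (simp add: numeral_2_eq_2)
  have "\<exists>s. 0 < s \<and> s < h \<and>
      (f (x + h *\<^sub>R u + h *\<^sub>R v) - f (x + h *\<^sub>R u)) - (f (x + 0 *\<^sub>R u + h *\<^sub>R v) - f (x + 0 *\<^sub>R u))
      = (h - 0) * (pd i f (x + s *\<^sub>R u + h *\<^sub>R v) - pd i f (x + s *\<^sub>R u))"
  proof (rule MVT2)
    fix s assume s: "0 \<le> s" "s \<le> h"
    have "((\<lambda>t. f ((x + h *\<^sub>R v) + t *\<^sub>R u)) has_real_derivative pd i f ((x + h *\<^sub>R v) + s *\<^sub>R u)) (at s)"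
      unfolding u_def using mem[OF s, of h] assms(4)
      by (intro has_pd_line[OF f]) (auto simp: u_def algebra_simps)
    moreover have "((\<lambda>t. f (x + t *\<^sub>R u)) has_real_derivative pd i f (x + s *\<^sub>R u)) (at s)"
      unfolding u_def using mem[OF s, of 0] assms(4) by (intro has_pd_line[OF f]) (auto simp: u_def)
    ultimately show "((\<lambda>s. f (x + s *\<^sub>R u + h *\<^sub>R v) - f (x + s *\<^sub>R u)) has_real_derivative
        pd i f (x + s *\<^sub>R u + h *\<^sub>R v) - pd i f (x + s *\<^sub>R u)) (at s)"
      using DERIV_diff by (fastforce simp: algebra_simps)
  qed (use assms in auto)
  then obtain s where s: "0 < s" "s < h"
    and fs: "(f (x + h *\<^sub>R u + h *\<^sub>R v) - f (x + h *\<^sub>R u)) - (f (x + h *\<^sub>R v) - f x)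
      = h * (pd i f (x + s *\<^sub>R u + h *\<^sub>R v) - pd i f (x + s *\<^sub>R u))"
    by auto
  have "\<exists>t. 0 < t \<and> t < h \<and> pd i f (x + s *\<^sub>R u + h *\<^sub>R v) - pd i f (x + s *\<^sub>R u + 0 *\<^sub>R v)
      = (h - 0) * pd j (pd i f) (x + s *\<^sub>R u + t *\<^sub>R v)"
    unfolding v_def using mem s assms(4)
    by (intro MVT2 has_pd_line[OF fi]) (auto simp: v_def)
  then obtain t where t: "0 < t" "t < h"
    and ft: "pd i f (x + s *\<^sub>R u + h *\<^sub>R v) - pd i f (x + s *\<^sub>R u) = h * pd j (pd i f) (x + s *\<^sub>R u + t *\<^sub>R v)"
    by auto
  show ?thesis
    using near[of s t] s t fs ft by (intro bexI[of _ "x + s *\<^sub>R u + t *\<^sub>R v"]) auto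
qed

text \<open>The second difference is symmetric in the two directions, so the two mixed derivatives
  take a common value at points arbitrarily close to x. If they differed at x, continuity would keep
  each within half the gap \<open>?d\<close> of its own value.\<close>

lemma pd_commute:
  fixes f :: "real^'n::finite \<Rightarrow> real"
  assumes "open S" "Ck_on 2 f S" "x \<in> S"
  shows "pd i (pd j f) x = pd j (pd i f) x"
proof (rule ccontr)
  let ?d = "\<bar>pd i (pd j f) x - pd j (pd i f) x\<bar> / 2"
  assume "\<not> ?thesis"
  then have pos: "0 < ?d" by simp
  have cont: "isCont (pd k (pd l f)) x" for k l
    using Ck_on_pd[OF assms(1) Ck_on_pd[OF assms(1)], of 0 f k l] assms(2,3)
      continuous_on_eq_continuous_at[OF assms(1), of "pd k (pd l f)"]
    by (simp add: numeral_2_eq_2)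
  have "\<exists>r>0. \<forall>z\<in>ball x r. \<bar>pd k (pd l f) z - pd k (pd l f) x\<bar> < ?d" for k l
    using cont[of k l] pos unfolding continuous_at_ball
    by (metis dist_commute dist_real_def image_subset_iff mem_ball)
  then obtain r r' where r: "0 < r" "\<And>z. z \<in> ball x r \<Longrightarrow> \<bar>pd i (pd j f) z - pd i (pd j f) x\<bar> < ?d"
    and r': "0 < r'" "\<And>z. z \<in> ball x r' \<Longrightarrow> \<bar>pd j (pd i f) z - pd j (pd i f) x\<bar> < ?d"
    by meson
  obtain q where q: "0 < q" "ball x q \<subseteq> S"
    using assms(1,3) openE by blast
  \<comment> \<open>The divisor 3 makes 2h, the radius in \<open>second_difference_MVT\<close>,
    smaller than all three radii.\<close>
  define h where "h = min q (min r r') / 3"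
  have h: "0 < h" "2 * h < q" "2 * h < r" "2 * h < r'" using q r r' by (auto simp: h_def)
  obtain z where z: "z \<in> ball x (2 * h)" "f (x + h *\<^sub>R axis i 1 + h *\<^sub>R axis j 1) - f (x + h *\<^sub>R axis i 1)
      - f (x + h *\<^sub>R axis j 1) + f x = h * (h * pd j (pd i f) z)"
    using second_difference_MVT[OF q(2) assms(1,2) h(1,2)] by blast
  obtain w where w: "w \<in> ball x (2 * h)" "f (x + h *\<^sub>R axis j 1 + h *\<^sub>R axis i 1) - f (x + h *\<^sub>R axis j 1)
      - f (x + h *\<^sub>R axis i 1) + f x = h * (h * pd i (pd j f) w)"
    using second_difference_MVT[OF q(2) assms(1,2) h(1,2)] by blast
  have eq: "x + h *\<^sub>R axis i 1 + h *\<^sub>R axis j 1 = x + h *\<^sub>R axis j 1 + h *\<^sub>R axis i 1"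
    by (simp add: algebra_simps)
  have "h * (h * pd j (pd i f) z) = h * (h * pd i (pd j f) w)"
    using z(2) w(2) unfolding eq by linarith
  then have "pd j (pd i f) z = pd i (pd j f) w" using h(1) by simp
  moreover have "z \<in> ball x r'" "w \<in> ball x r" using z(1) w(1) h by auto
  ultimately show False using r(2)[of w] r'(2)[of z] by (simp add: field_simps abs_if split: if_splits)
qed

lemma has_pd_linear: "has_pd i (\<lambda>y. \<Sum>e\<in>UNIV. k e * y $ e) (k i) x"
proof -
  have "has_pd i (\<lambda>y. \<Sum>e\<in>UNIV. k e * y $ e) (\<Sum>e\<in>UNIV. k e * kdelta i e) x"
    by (intro has_pd_intros)
  then show ?thesis by simp
qed

lemma has_pd_quadratic:
  "has_pd i (\<lambda>z. \<Sum>k\<in>UNIV. \<Sum>l\<in>UNIV. B k l * (z $ k * z $ l)) (\<Sum>l\<in>UNIV. (B i l + B l i) * z $ l) z"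
proof -
  have "has_pd i (\<lambda>z. \<Sum>k\<in>UNIV. \<Sum>l\<in>UNIV. B k l * (z $ k * z $ l))
      (\<Sum>k\<in>UNIV. \<Sum>l\<in>UNIV. B k l * (kdelta i k * z $ l + z $ k * kdelta i l)) z"
    by (intro has_pd_sum has_pd_cmult has_pd_mult has_pd_coordinate)
  moreover have "(\<Sum>k\<in>UNIV. \<Sum>l\<in>UNIV. B k l * (kdelta i k * z $ l + z $ k * kdelta i l))
      = (\<Sum>k\<in>UNIV. kdelta i k * (\<Sum>l\<in>UNIV. B k l * z $ l)) + (\<Sum>k\<in>UNIV. \<Sum>l\<in>UNIV. (B k l * z $ k) * kdelta i l)"
    unfolding sum_distrib_left sum.distrib[symmetric] by (intro sum.cong refl) (simp add: algebra_simps)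
  ultimately show ?thesis by (simp add: sum.distrib distrib_right)
qed

text \<open>Differentiating Euler's relation lowers the degree of homogeneity by one. Starting from
  degree 2, it is iterated up to the fourth derivatives.\<close>

lemma euler_pd:
  assumes "open S" "Ck_on 2 w S" "x \<in> S"
    and euler: "\<And>z. z \<in> S \<Longrightarrow> (\<Sum>a\<in>UNIV. z $ a * pd a w z) = k * w z"
  shows "(\<Sum>a\<in>UNIV. x $ a * pd a (pd b w) x) = (k - 1) * pd b w x"
proof -
  have w: "Ck_on 1 (pd a w) S" for a
    using Ck_on_pd[OF assms(1), of 1] assms(2) by (simp add: numeral_2_eq_2)
  have "has_pd b (\<lambda>z. \<Sum>a\<in>UNIV. z $ a * pd a w z)
      (\<Sum>a\<in>UNIV. kdelta b a * pd a w x + x $ a * pd b (pd a w) x) x"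
    by (intro has_pd_intros Ck_on_has_pd[OF w] assms(3)) simp
  then have "has_pd b (\<lambda>z. k * w z)
      (\<Sum>a\<in>UNIV. kdelta b a * pd a w x + x $ a * pd b (pd a w) x) x"
    using has_pd_cong[OF assms(1,3) euler] by simp
  moreover have "has_pd b (\<lambda>z. k * w z) (k * pd b w x) x"
    by (intro has_pd_intros Ck_on_has_pd[OF assms(2)] assms(3)) simp
  ultimately have "(\<Sum>a\<in>UNIV. kdelta b a * pd a w x + x $ a * pd b (pd a w) x) = k * pd b w x"
    by (rule has_pd_unique)
  then show ?thesis
    by (simp add: sum.distrib pd_commute[OF assms(1-3), of b] left_diff_distrib)
qed

section \<open>The algebra of a jet\<close>

text \<open>\<open>g\<close>, \<open>T\<close>, \<open>F\<close> stand for the values at a fixed point \<open>y\<close> of the derivatives of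
  orders 2, 3, 4 of the pseudo-Minkowski function, \<open>gi\<close> for the inverse of \<open>g\<close>.\<close>

locale fibre_tensors =
  fixes g gi :: "'n::finite \<Rightarrow> 'n \<Rightarrow> real" and T :: "'n \<Rightarrow> 'n \<Rightarrow> 'n \<Rightarrow> real"
    and F :: "'n \<Rightarrow> 'n \<Rightarrow> 'n \<Rightarrow> 'n \<Rightarrow> real" and y :: "'n \<Rightarrow> real"
  assumes g_sym: "g a b = g b a"
    and gi_sym: "gi a b = gi b a"
    and gi_g: "(\<Sum>b\<in>UNIV. gi a b * g b c) = kdelta a c"
    and T_swap12: "T a b c = T b a c"
    and T_swap23: "T a b c = T a c b"
    and F_swap12: "F a b c d = F b a c d"
    and F_swap23: "F a b c d = F a c b d"
    and F_swap34: "F a b c d = F a b d c"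
begin

lemma T_perm: "T a b c = T c b a"
  by (metis T_swap12 T_swap23)

lemma gi_g': "(\<Sum>b\<in>UNIV. gi b a * g c b) = kdelta a c"
  using gi_g[of a c] by (simp add: g_sym[of c] gi_sym[of _ a])

lemma raise_lower: "(\<Sum>b\<in>UNIV. gi a b * (\<Sum>d\<in>UNIV. g b d * X d)) = X a"
proof -
  have "(\<Sum>b\<in>UNIV. gi a b * (\<Sum>d\<in>UNIV. g b d * X d)) = (\<Sum>d\<in>UNIV. (\<Sum>b\<in>UNIV. gi a b * g b d) * X d)"
    by (simp add: sum_distrib_left sum_distrib_right mult.assoc) (rule sum.swap)
  then show ?thesis by (simp add: gi_g)
qed

text \<open>Inserting the inverse metric times the metric: \<open>Q\<close> and its derivatives are
  only known after lowering, and this brings any contraction with them to that form.\<close>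

lemma pairing: "(\<Sum>r\<in>UNIV. A r * X r) = (\<Sum>d\<in>UNIV. (\<Sum>b\<in>UNIV. gi d b * A b) * (\<Sum>r\<in>UNIV. g d r * X r))"
proof -
  have "(\<Sum>r\<in>UNIV. A r * X r) = (\<Sum>b\<in>UNIV. A b * (\<Sum>d\<in>UNIV. gi b d * (\<Sum>r\<in>UNIV. g d r * X r)))"
    by (simp add: raise_lower)
  also have "\<dots> = (\<Sum>d\<in>UNIV. \<Sum>b\<in>UNIV. A b * (gi b d * (\<Sum>r\<in>UNIV. g d r * X r)))"
    unfolding sum_distrib_left[of "A _"] by (rule sum.swap)
  also have "\<dots> = (\<Sum>d\<in>UNIV. (\<Sum>b\<in>UNIV. gi d b * A b) * (\<Sum>r\<in>UNIV. g d r * X r))"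
    by (simp add: sum_distrib_right gi_sym mult.assoc mult.left_commute)
  finally show ?thesis .
qed

text \<open>Lowering with \<open>g\<close> instead of a first derivative as a further parameter; the
  two agree by Euler's relation.\<close>

definition yl :: "'n \<Rightarrow> real" where "yl a = (\<Sum>b\<in>UNIV. g a b * y b)"
definition Il :: "'n \<Rightarrow> real" where "Il a = (\<Sum>b\<in>UNIV. \<Sum>c\<in>UNIV. gi b c * (1/2 * T a b c))"
definition Iu :: "'n \<Rightarrow> real" where "Iu a = (\<Sum>b\<in>UNIV. gi a b * Il b)"
definition Cu :: "'n \<Rightarrow> 'n \<Rightarrow> 'n \<Rightarrow> real" where "Cu m b c = (\<Sum>a\<in>UNIV. gi m a * (1/2 * T a b c))"
text \<open>Minus the derivative of the inverse metric: \<open>TT c b d\<close> stands for the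
  negative of the derivative of \<open>gi b d\<close> in direction c.\<close>

definition TT :: "'n \<Rightarrow> 'n \<Rightarrow> 'n \<Rightarrow> real" where
  "TT c b d = (\<Sum>a\<in>UNIV. \<Sum>q\<in>UNIV. gi b a * T a q c * gi q d)"

lemma TT_sym: "TT c b d = TT c d b"
proof -
  have "TT c b d = (\<Sum>q\<in>UNIV. \<Sum>a\<in>UNIV. gi b a * T a q c * gi q d)"
    unfolding TT_def by (rule sum.swap)
  also have "\<dots> = TT c d b"
    unfolding TT_def by (intro sum.cong refl) (metis T_swap12 gi_sym mult.commute mult.left_commute)
  finally show ?thesis .
qed

lemma TT_lower: "(\<Sum>b\<in>UNIV. TT c b d * g s b) = (\<Sum>q\<in>UNIV. T s q c * gi q d)"
proof -
  have "TT c b d = (\<Sum>a\<in>UNIV. gi b a * (\<Sum>q\<in>UNIV. T a q c * gi q d))" for b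
    by (simp add: TT_def sum_distrib_left mult.assoc)
  then have "(\<Sum>b\<in>UNIV. TT c b d * g s b) = (\<Sum>b\<in>UNIV. \<Sum>a\<in>UNIV. gi b a * (\<Sum>q\<in>UNIV. T a q c * gi q d) * g s b)"
    by (simp add: sum_distrib_right)
  also have "\<dots> = (\<Sum>a\<in>UNIV. \<Sum>b\<in>UNIV. gi b a * (\<Sum>q\<in>UNIV. T a q c * gi q d) * g s b)"
    by (rule sum.swap)
  also have "\<dots> = (\<Sum>a\<in>UNIV. (\<Sum>b\<in>UNIV. gi b a * g s b) * (\<Sum>q\<in>UNIV. T a q c * gi q d))"
    unfolding sum_distrib_right by (intro sum.cong refl) (simp add: sum_distrib_left mult_ac)
  finally show ?thesis by (simp add: gi_g')
qed

lemma trace_T: "(\<Sum>a\<in>UNIV. \<Sum>b\<in>UNIV. gi a b * T r b a) = 2 * Il r"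
  by (simp add: Il_def sum_distrib_left T_swap23[of r])

end

text \<open>\<open>Q r\<close>, \<open>Q1 r k\<close>, \<open>Q2 r b k\<close> stand for \<open>Q\<^sup>r\<close>, \<open>\<partial>\<^sub>kQ\<^sup>r\<close>, \<open>\<partial>\<^sub>b\<partial>\<^sub>kQ\<^sup>r\<close> at \<open>y\<close>, where
  \<open>2 Q\<^sub>d = W\<^sub>d = c\<^sup>s\<^sub>d\<^sub>e y\<^sup>e y\<^sub>s\<close>; likewise \<open>W1 d k\<close> for \<open>\<partial>\<^sub>kW\<^sub>d\<close> and \<open>W2 d b k\<close> for \<open>\<partial>\<^sub>b\<partial>\<^sub>kW\<^sub>d\<close>. \<open>Lsum a b e\<close> is
  \<open>2 L\<^sub>a\<^sub>b\<^sub>e\<close> with the third derivatives of \<open>Q\<close> eliminated by \<open>y\<^sub>rQ\<^sup>r = 0\<close>.\<close>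

locale deviation = fibre_tensors g gi T F y
  for g gi :: "'n::finite \<Rightarrow> 'n \<Rightarrow> real" and T F y +
  fixes c :: "'n \<Rightarrow> 'n \<Rightarrow> 'n \<Rightarrow> real" and Q :: "'n \<Rightarrow> real"
    and Q1 :: "'n \<Rightarrow> 'n \<Rightarrow> real" and Q2 :: "'n \<Rightarrow> 'n \<Rightarrow> 'n \<Rightarrow> real"
  assumes c_antisym: "c s d e = - c s e d"
begin

definition K :: "'n \<Rightarrow> 'n \<Rightarrow> real" where "K s d = (\<Sum>e\<in>UNIV. c s d e * y e)"
definition W :: "'n \<Rightarrow> real" where "W d = (\<Sum>s\<in>UNIV. K s d * yl s)"
definition W1 :: "'n \<Rightarrow> 'n \<Rightarrow> real" where
  "W1 d k = (\<Sum>s\<in>UNIV. c s d k * yl s + K s d * g s k)"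
definition W2 :: "'n \<Rightarrow> 'n \<Rightarrow> 'n \<Rightarrow> real" where
  "W2 d b k = (\<Sum>s\<in>UNIV. c s d k * g s b + c s d b * g s k + K s d * T s b k)"

definition Lsum :: "'n \<Rightarrow> 'n \<Rightarrow> 'n \<Rightarrow> real" where
  "Lsum a b e = (\<Sum>r\<in>UNIV. g r a * Q2 r b e + g r b * Q2 r a e + g r e * Q2 r a b
     + T r a b * Q1 r e + T r a e * Q1 r b + T r b e * Q1 r a + F r a b e * Q r)"

text \<open>In the first summand \<open>gi\<close> cancels \<open>g\<close> and leaves the trace of
  c; in the second the symmetric \<open>gi\<close> meets the antisymmetric lower indices of c and
  gives 0.\<close>

lemma trace_sym_K:
  "(\<Sum>a\<in>UNIV. \<Sum>b\<in>UNIV. gi a b * (\<Sum>s\<in>UNIV. c s b e * g s a + c s b a * g s e + K s b * T s a e))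
    = (\<Sum>s\<in>UNIV. c s s e) + (\<Sum>a\<in>UNIV. \<Sum>b\<in>UNIV. gi a b * (\<Sum>s\<in>UNIV. K s b * T s a e))"
proof -
  have 1: "(\<Sum>a\<in>UNIV. \<Sum>b\<in>UNIV. gi a b * (\<Sum>s\<in>UNIV. c s b e * g s a)) = (\<Sum>s\<in>UNIV. c s s e)"
  proof -
    have "(\<Sum>a\<in>UNIV. \<Sum>b\<in>UNIV. gi a b * (\<Sum>s\<in>UNIV. c s b e * g s a))
        = (\<Sum>b\<in>UNIV. \<Sum>a\<in>UNIV. gi b a * (\<Sum>s\<in>UNIV. g a s * c s b e))"
      by (subst sum.swap) (simp add: gi_sym g_sym mult.commute)
    then show ?thesis by (simp add: raise_lower)
  qed
  have 2: "(\<Sum>a\<in>UNIV. \<Sum>b\<in>UNIV. gi a b * (\<Sum>s\<in>UNIV. c s b a * g s e)) = 0"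
  proof (rule sum_sym_antisym[OF gi_sym])
    show "(\<Sum>s\<in>UNIV. c s b a * g s e) = - (\<Sum>s\<in>UNIV. c s a b * g s e)" for a b
      unfolding sum_negf[symmetric] by (intro sum.cong refl) (simp add: c_antisym[of _ b a])
  qed
  show ?thesis
    by (simp add: sum.distrib distrib_left 1 2)
qed

text \<open>The first two summands each contribute the trace of c. The third contributes the same
  trace twice with the opposite sign, by antisymmetry, so all traces of c cancel.\<close>

lemma trace_W2:
  "(\<Sum>a\<in>UNIV. \<Sum>b\<in>UNIV. gi a b * (W2 b a e + W2 a b e + W2 e b a))
    = 2 * (\<Sum>a\<in>UNIV. \<Sum>b\<in>UNIV. gi a b * (\<Sum>s\<in>UNIV. K s b * T s a e)) + 2 * (\<Sum>s\<in>UNIV. K s e * Il s)"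
proof -
  let ?X = "\<Sum>a\<in>UNIV. \<Sum>b\<in>UNIV. gi a b * (\<Sum>s\<in>UNIV. K s b * T s a e)"
  have 1: "(\<Sum>a\<in>UNIV. \<Sum>b\<in>UNIV. gi a b * W2 b a e) = (\<Sum>s\<in>UNIV. c s s e) + ?X"
    unfolding W2_def by (rule trace_sym_K)
  have 2: "(\<Sum>a\<in>UNIV. \<Sum>b\<in>UNIV. gi a b * W2 a b e) = (\<Sum>s\<in>UNIV. c s s e) + ?X"
    unfolding 1[symmetric] by (subst sum.swap) (simp add: gi_sym)
  have c1: "(\<Sum>a\<in>UNIV. \<Sum>b\<in>UNIV. gi a b * (\<Sum>s\<in>UNIV. c s e a * g s b)) = (\<Sum>a\<in>UNIV. c a e a)"
  proof -
    have "(\<Sum>b\<in>UNIV. gi a b * (\<Sum>s\<in>UNIV. c s e a * g s b)) = c a e a" for a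
      using raise_lower[of a "\<lambda>s. c s e a"] by (simp add: g_sym mult.commute)
    then show ?thesis by simp
  qed
  have c2: "(\<Sum>a\<in>UNIV. \<Sum>b\<in>UNIV. gi a b * (\<Sum>s\<in>UNIV. c s e b * g s a)) = (\<Sum>a\<in>UNIV. c a e a)"
    unfolding c1[symmetric] by (subst sum.swap) (simp add: gi_sym)
  have c3: "(\<Sum>a\<in>UNIV. \<Sum>b\<in>UNIV. gi a b * (\<Sum>s\<in>UNIV. K s e * T s b a)) = 2 * (\<Sum>s\<in>UNIV. K s e * Il s)"
  proof -
    have "(\<Sum>a\<in>UNIV. \<Sum>b\<in>UNIV. gi a b * (\<Sum>s\<in>UNIV. K s e * T s b a))
        = (\<Sum>a\<in>UNIV. \<Sum>s\<in>UNIV. \<Sum>b\<in>UNIV. K s e * (gi a b * T s b a))"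
      unfolding sum_distrib_left by (intro sum.cong[OF refl] trans[OF sum.swap]) (simp add: mult_ac)
    also have "\<dots> = (\<Sum>s\<in>UNIV. \<Sum>a\<in>UNIV. \<Sum>b\<in>UNIV. K s e * (gi a b * T s b a))"
      by (rule sum.swap)
    also have "\<dots> = (\<Sum>s\<in>UNIV. K s e * (2 * Il s))"
      by (simp add: trace_T flip: sum_distrib_left)
    finally show ?thesis by (simp add: sum_distrib_left mult_ac)
  qed
  have "(\<Sum>a\<in>UNIV. c a e a) = - (\<Sum>s\<in>UNIV. c s s e)"
    unfolding sum_negf[symmetric] by (intro sum.cong refl) (rule c_antisym)
  then have 3: "(\<Sum>a\<in>UNIV. \<Sum>b\<in>UNIV. gi a b * W2 e b a) = - 2 * (\<Sum>s\<in>UNIV. c s s e) + 2 * (\<Sum>s\<in>UNIV. K s e * Il s)"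
    unfolding W2_def by (simp add: sum.distrib distrib_left c1 c2 c3)
  show ?thesis by (simp add: sum.distrib distrib_left 1 2 3)
qed

text \<open>The part of \<open>W1\<close> with undifferentiated \<open>yl\<close> is antisymmetric
  in the two indices and vanishes against the symmetric \<open>TT\<close>; in the other part
  \<open>g\<close> undoes one of the two raisings in \<open>TT\<close>.\<close>

lemma TT_W1: "(\<Sum>b\<in>UNIV. \<Sum>d\<in>UNIV. TT e b d * W1 d b) = (\<Sum>a\<in>UNIV. \<Sum>b\<in>UNIV. gi a b * (\<Sum>s\<in>UNIV. K s b * T s a e))"
proof -
  have 1: "(\<Sum>b\<in>UNIV. \<Sum>d\<in>UNIV. TT e b d * (\<Sum>s\<in>UNIV. c s d b * yl s)) = 0"
  proof (rule sum_sym_antisym[OF TT_sym])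
    show "(\<Sum>s\<in>UNIV. c s b a * yl s) = - (\<Sum>s\<in>UNIV. c s a b * yl s)" for a b
      unfolding sum_negf[symmetric] by (intro sum.cong refl) (simp add: c_antisym[of _ b a])
  qed
  have "(\<Sum>b\<in>UNIV. \<Sum>d\<in>UNIV. TT e b d * (\<Sum>s\<in>UNIV. K s d * g s b))
      = (\<Sum>d\<in>UNIV. \<Sum>b\<in>UNIV. \<Sum>s\<in>UNIV. K s d * (TT e b d * g s b))"
    by (subst sum.swap) (simp add: sum_distrib_left mult_ac)
  also have "\<dots> = (\<Sum>d\<in>UNIV. \<Sum>s\<in>UNIV. K s d * (\<Sum>q\<in>UNIV. T s q e * gi q d))"
    unfolding TT_lower[symmetric] sum_distrib_left by (intro sum.cong refl sum.swap)
  also have "\<dots> = (\<Sum>d\<in>UNIV. \<Sum>q\<in>UNIV. gi q d * (\<Sum>s\<in>UNIV. K s d * T s q e))"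
    unfolding sum_distrib_left by (intro sum.cong[OF refl] trans[OF sum.swap]) (simp add: mult_ac)
  also have "\<dots> = (\<Sum>a\<in>UNIV. \<Sum>b\<in>UNIV. gi a b * (\<Sum>s\<in>UNIV. K s b * T s a e))"
    by (rule sum.swap)
  finally show ?thesis
    by (simp add: W1_def sum.distrib distrib_left 1)
qed

end

text \<open>\<open>Q0\<close>, \<open>Q1\<close>, \<open>Q2\<close> are the equation of the lowered
  \<open>Q\<close> differentiated zero, one and two times. \<open>dIl k r\<close> and
  \<open>dIu k m\<close> stand for the derivatives in direction k of the mean Cartan form and
  vector; \<open>dIu\<close> is the derivative of the lowering relation between them.
  \<open>y_T\<close> and \<open>y_F\<close> are Euler's relation in degrees 0 and -1.\<close>

locale deviation_jet = deviation g gi T F y c Q Q1 Q2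
  for g gi :: "'n::finite \<Rightarrow> 'n \<Rightarrow> real" and T F y c Q Q1 Q2 +
  fixes dIl dIu :: "'n \<Rightarrow> 'n \<Rightarrow> real"
  assumes Q0: "(\<Sum>r\<in>UNIV. g d r * Q r) = W d / 2"
    and Q1: "(\<Sum>r\<in>UNIV. T d r k * Q r + g d r * Q1 r k) = W1 d k / 2"
    and Q2: "(\<Sum>r\<in>UNIV. F d r b k * Q r + T d r b * Q1 r k + T d r k * Q1 r b + g d r * Q2 r b k)
      = W2 d b k / 2"
    and dIl: "dIl k r = 1/2 * (\<Sum>a\<in>UNIV. \<Sum>b\<in>UNIV. gi a b * F r a b k - TT k a b * T r a b)"
    and dIu: "(\<Sum>m\<in>UNIV. T r m k * Iu m + g r m * dIu k m) = dIl k r"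
    and y_T: "(\<Sum>a\<in>UNIV. y a * T a b k) = 0"
    and y_F: "(\<Sum>a\<in>UNIV. y a * F a b k l) = - T b k l"
begin

text \<open>Sum of \<open>Q2\<close> with each of a, b, e as the lowered index. It holds every
  product \<open>T\<close> \<open>Q1\<close> twice and \<open>F\<close> \<open>Q\<close> three
  times, while \<open>Lsum\<close> holds each once; hence the coefficients -1 and -2.\<close>

lemma Lsum_eq:
  "Lsum a b e = 1/2 * (W2 a b e + W2 b a e + W2 e a b)
    - (\<Sum>r\<in>UNIV. T r a b * Q1 r e + T r a e * Q1 r b + T r b e * Q1 r a)
    - 2 * (\<Sum>r\<in>UNIV. F r a b e * Q r)"
proof -
  have F: "F a r b e = F r a b e" "F b r a e = F r a b e" "F e r a b = F r a b e" for r
    by (metis F_swap12 F_swap23 F_swap34)+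
  have T: "T a r b = T r a b" "T a r e = T r a e" "T b r a = T r a b" "T b r e = T r b e"
    "T e r a = T r a e" "T e r b = T r b e" for r
    by (metis T_swap12 T_swap23)+
  show ?thesis
    using Q2[of a b e] Q2[of b a e] Q2[of e a b]
    by (simp add: Lsum_def F T g_sym[of _ a] g_sym[of _ b] g_sym[of _ e] sum.distrib)
qed

definition J :: "'n \<Rightarrow> real" where
  "J e = (\<Sum>a\<in>UNIV. \<Sum>b\<in>UNIV. gi a b * (1/2 * Lsum b a e))"

text \<open>The vertical Cartan derivative in direction k of component m of the mean Cartan
  vector.\<close>

definition dI :: "'n \<Rightarrow> 'n \<Rightarrow> real" where
  "dI k m = dIu k m + (\<Sum>s\<in>UNIV. Cu m s k * Iu s)"

lemma g_Q1: "(\<Sum>r\<in>UNIV. g d r * Q1 r k) = W1 d k / 2 - (\<Sum>r\<in>UNIV. T d r k * Q r)"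
  using Q1[of d k] by (simp add: sum.distrib)

lemma Il_Q1: "(\<Sum>r\<in>UNIV. Il r * Q1 r e)
    = (\<Sum>d\<in>UNIV. Iu d * W1 d e) / 2 - (\<Sum>r\<in>UNIV. (\<Sum>d\<in>UNIV. T r d e * Iu d) * Q r)"
proof -
  have "(\<Sum>r\<in>UNIV. Il r * Q1 r e) = (\<Sum>d\<in>UNIV. Iu d * (W1 d e / 2 - (\<Sum>r\<in>UNIV. T d r e * Q r)))"
    unfolding pairing[of Il] g_Q1 Iu_def ..
  moreover have "(\<Sum>d\<in>UNIV. Iu d * (\<Sum>r\<in>UNIV. T d r e * Q r)) = (\<Sum>r\<in>UNIV. (\<Sum>d\<in>UNIV. T r d e * Iu d) * Q r)"
    unfolding sum_distrib_left sum_distrib_right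
    by (rule trans[OF sum.swap]) (simp add: T_swap12 mult_ac)
  ultimately show ?thesis
    by (simp add: right_diff_distrib sum_subtractf sum_divide_distrib)
qed

text \<open>Here \<open>Q1\<close> is paired with a third derivative having one raised index;
  \<open>pairing\<close> raises a second one, which is how \<open>TT\<close> appears.\<close>

lemma gi_T_Q1: "(\<Sum>a\<in>UNIV. \<Sum>b\<in>UNIV. gi a b * (\<Sum>r\<in>UNIV. T r b e * Q1 r a))
    = (\<Sum>a\<in>UNIV. \<Sum>b\<in>UNIV. gi a b * (\<Sum>s\<in>UNIV. K s b * T s a e)) / 2
      - (\<Sum>r\<in>UNIV. (\<Sum>a\<in>UNIV. \<Sum>b\<in>UNIV. TT e a b * T r a b) * Q r)"
proof -
  have "(\<Sum>b\<in>UNIV. gi a b * (\<Sum>r\<in>UNIV. T r b e * Q1 r a))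
      = (\<Sum>r\<in>UNIV. (\<Sum>b\<in>UNIV. gi a b * T r b e) * Q1 r a)" for a
    unfolding sum_distrib_left sum_distrib_right mult.assoc by (rule sum.swap)
  also have "(\<Sum>r\<in>UNIV. (\<Sum>b\<in>UNIV. gi a b * T r b e) * Q1 r a)
      = (\<Sum>d\<in>UNIV. TT e a d * (W1 d a / 2 - (\<Sum>r\<in>UNIV. T d r a * Q r)))" for a
  proof -
    have "(\<Sum>r\<in>UNIV. gi d r * (\<Sum>b\<in>UNIV. gi a b * T r b e)) = TT e d a" for d
      by (simp add: TT_def sum_distrib_left mult_ac gi_sym[of _ a])
    then show ?thesis
      unfolding pairing[of "\<lambda>r. \<Sum>b\<in>UNIV. gi a b * T r b e"] g_Q1 by (simp add: TT_sym)
  qed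
  finally have "(\<Sum>a\<in>UNIV. \<Sum>b\<in>UNIV. gi a b * (\<Sum>r\<in>UNIV. T r b e * Q1 r a))
      = (\<Sum>a\<in>UNIV. \<Sum>d\<in>UNIV. TT e a d * W1 d a) / 2
        - (\<Sum>a\<in>UNIV. \<Sum>d\<in>UNIV. TT e a d * (\<Sum>r\<in>UNIV. T d r a * Q r))"
    by (simp add: right_diff_distrib sum_subtractf sum_divide_distrib)
  moreover have "(\<Sum>a\<in>UNIV. \<Sum>d\<in>UNIV. TT e a d * (\<Sum>r\<in>UNIV. T d r a * Q r))
      = (\<Sum>r\<in>UNIV. (\<Sum>a\<in>UNIV. \<Sum>b\<in>UNIV. TT e a b * T r a b) * Q r)"
  proof -
    have "T d r a = T r a d" for d r a by (metis T_swap12 T_swap23)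
    then have "(\<Sum>a\<in>UNIV. \<Sum>d\<in>UNIV. TT e a d * (\<Sum>r\<in>UNIV. T d r a * Q r))
      = (\<Sum>a\<in>UNIV. \<Sum>r\<in>UNIV. \<Sum>d\<in>UNIV. TT e a d * T r a d * Q r)"
      unfolding sum_distrib_left
      by (intro sum.cong[OF refl] trans[OF sum.swap]) (simp add: mult.assoc)
    also have "\<dots> = (\<Sum>r\<in>UNIV. \<Sum>a\<in>UNIV. \<Sum>d\<in>UNIV. TT e a d * T r a d * Q r)"
      by (rule sum.swap)
    finally show ?thesis by (simp add: sum_distrib_right)
  qed
  ultimately show ?thesis by (simp add: TT_W1)
qed

lemma gi_F_Q: "(\<Sum>a\<in>UNIV. \<Sum>b\<in>UNIV. gi a b * (\<Sum>r\<in>UNIV. F r b a e * Q r))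
    = (\<Sum>r\<in>UNIV. (\<Sum>a\<in>UNIV. \<Sum>b\<in>UNIV. gi a b * F r a b e) * Q r)"
proof -
  have "(\<Sum>a\<in>UNIV. \<Sum>b\<in>UNIV. gi a b * (\<Sum>r\<in>UNIV. F r b a e * Q r))
      = (\<Sum>a\<in>UNIV. \<Sum>r\<in>UNIV. \<Sum>b\<in>UNIV. gi a b * F r a b e * Q r)"
    unfolding sum_distrib_left
    by (intro sum.cong[OF refl] trans[OF sum.swap]) (simp add: mult.assoc F_swap23)
  also have "\<dots> = (\<Sum>r\<in>UNIV. \<Sum>a\<in>UNIV. \<Sum>b\<in>UNIV. gi a b * F r a b e * Q r)"
    by (rule sum.swap)
  finally show ?thesis by (simp add: sum_distrib_right)
qed

text \<open>\<open>dIu\<close> replaces the derivative of the form by that of the vector. Its metric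
  term lowers \<open>Q\<close> to \<open>W\<close>; its \<open>T\<close> term stays and is treated
  in \<open>T_Iu_Q\<close>.\<close>

lemma dIl_Q: "(\<Sum>r\<in>UNIV. 2 * dIl e r * Q r)
    = 2 * (\<Sum>r\<in>UNIV. (\<Sum>d\<in>UNIV. T r d e * Iu d) * Q r) + (\<Sum>m\<in>UNIV. dIu e m * W m)"
proof -
  have "(\<Sum>r\<in>UNIV. (\<Sum>m\<in>UNIV. g r m * dIu e m) * Q r) = (\<Sum>m\<in>UNIV. dIu e m * (\<Sum>r\<in>UNIV. g m r * Q r))"
    unfolding sum_distrib_left sum_distrib_right
    by (rule trans[OF sum.swap]) (simp add: g_sym mult_ac)
  then show ?thesis
    by (simp add: Q0 dIu[symmetric] sum.distrib distrib_right distrib_left mult.assoc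
        flip: sum_distrib_left) (simp add: sum_divide_distrib[symmetric])
qed

lemma T_Iu_Q: "(\<Sum>r\<in>UNIV. (\<Sum>d\<in>UNIV. T r d e * Iu d) * Q r) = (\<Sum>m\<in>UNIV. (\<Sum>s\<in>UNIV. Cu m s e * Iu s) * W m)"
proof -
  have "(\<Sum>b\<in>UNIV. gi m b * (\<Sum>d\<in>UNIV. T b d e * Iu d)) = 2 * (\<Sum>s\<in>UNIV. Cu m s e * Iu s)" for m
    unfolding Cu_def sum_distrib_left sum_distrib_right
    by (rule trans[OF sum.swap]) (simp add: mult_ac)
  then show ?thesis
    by (simp add: pairing[of "\<lambda>r. \<Sum>d\<in>UNIV. T r d e * Iu d"] Q0)
qed

text \<open>The terms \<open>T\<close> \<open>Iu\<close> \<open>Q\<close> enter twice: +2 from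
  \<open>Il_Q1\<close> and -4 from \<open>dIl_Q\<close>. By \<open>T_Iu_Q\<close> the remaining -2
  is the connection term that completes the derivative of \<open>Iu\<close> to
  \<open>dI\<close>.\<close>

lemma J_eq: "J e = 1/2 * (\<Sum>s\<in>UNIV. K s e * Il s) - 1/2 * (\<Sum>d\<in>UNIV. Iu d * W1 d e) - (\<Sum>m\<in>UNIV. dI e m * W m)"
proof -
  have T1: "(\<Sum>a\<in>UNIV. \<Sum>b\<in>UNIV. gi a b * (\<Sum>r\<in>UNIV. T r b a * Q1 r e)) = 2 * (\<Sum>r\<in>UNIV. Il r * Q1 r e)"
  proof -
    have "(\<Sum>a\<in>UNIV. \<Sum>b\<in>UNIV. gi a b * (\<Sum>r\<in>UNIV. T r b a * Q1 r e))
        = (\<Sum>a\<in>UNIV. \<Sum>r\<in>UNIV. \<Sum>b\<in>UNIV. gi a b * T r b a * Q1 r e)"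
      unfolding sum_distrib_left by (intro sum.cong[OF refl] trans[OF sum.swap]) (simp add: mult.assoc)
    also have "\<dots> = (\<Sum>r\<in>UNIV. (\<Sum>a\<in>UNIV. \<Sum>b\<in>UNIV. gi a b * T r b a) * Q1 r e)"
      unfolding sum_distrib_right by (rule sum.swap)
    finally show ?thesis by (simp add: trace_T sum_distrib_left mult.assoc)
  qed
  have T2: "(\<Sum>a\<in>UNIV. \<Sum>b\<in>UNIV. gi a b * (\<Sum>r\<in>UNIV. T r a e * Q1 r b))
      = (\<Sum>a\<in>UNIV. \<Sum>b\<in>UNIV. gi a b * (\<Sum>r\<in>UNIV. T r b e * Q1 r a))"
    by (subst sum.swap) (simp add: gi_sym)
  have "2 * J e = 1/2 * (\<Sum>a\<in>UNIV. \<Sum>b\<in>UNIV. gi a b * (W2 b a e + W2 a b e + W2 e b a))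
      - (\<Sum>a\<in>UNIV. \<Sum>b\<in>UNIV. gi a b * (\<Sum>r\<in>UNIV. T r b a * Q1 r e))
      - (\<Sum>a\<in>UNIV. \<Sum>b\<in>UNIV. gi a b * (\<Sum>r\<in>UNIV. T r b e * Q1 r a))
      - (\<Sum>a\<in>UNIV. \<Sum>b\<in>UNIV. gi a b * (\<Sum>r\<in>UNIV. T r a e * Q1 r b))
      - 2 * (\<Sum>a\<in>UNIV. \<Sum>b\<in>UNIV. gi a b * (\<Sum>r\<in>UNIV. F r b a e * Q r))"
  proof -
    have "2 * J e = (\<Sum>a\<in>UNIV. \<Sum>b\<in>UNIV. 1/2 * (gi a b * (W2 b a e + W2 a b e + W2 e b a))
        - gi a b * (\<Sum>r\<in>UNIV. T r b a * Q1 r e) - gi a b * (\<Sum>r\<in>UNIV. T r b e * Q1 r a)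
        - gi a b * (\<Sum>r\<in>UNIV. T r a e * Q1 r b) - 2 * (gi a b * (\<Sum>r\<in>UNIV. F r b a e * Q r)))"
      unfolding J_def sum_distrib_left[of 2]
      by (intro sum.cong refl) (simp add: Lsum_eq sum.distrib algebra_simps)
    then show ?thesis
      by (simp only: sum_subtractf sum_distrib_left[symmetric])
  qed
  \<comment> \<open>The trace of \<open>K\<close> times \<open>T\<close> from
    \<open>trace_W2\<close> cancels against the two halves from the two uses of
    \<open>gi_T_Q1\<close>.\<close>
  also have "\<dots> = (\<Sum>s\<in>UNIV. K s e * Il s) - 2 * (\<Sum>r\<in>UNIV. Il r * Q1 r e)
      - 2 * ((\<Sum>r\<in>UNIV. (\<Sum>a\<in>UNIV. \<Sum>b\<in>UNIV. gi a b * F r a b e) * Q r)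
        - (\<Sum>r\<in>UNIV. (\<Sum>a\<in>UNIV. \<Sum>b\<in>UNIV. TT e a b * T r a b) * Q r))"
    unfolding T1 T2 gi_T_Q1 gi_F_Q trace_W2 by (simp add: algebra_simps)
  \<comment> \<open>The product rule for the mean Cartan form, read backwards: \<open>F\<close> is
    the derivative of \<open>T\<close>, and -\<open>TT\<close> that of \<open>gi\<close>.\<close>
  also have "(\<Sum>r\<in>UNIV. (\<Sum>a\<in>UNIV. \<Sum>b\<in>UNIV. gi a b * F r a b e) * Q r)
        - (\<Sum>r\<in>UNIV. (\<Sum>a\<in>UNIV. \<Sum>b\<in>UNIV. TT e a b * T r a b) * Q r) = (\<Sum>r\<in>UNIV. 2 * dIl e r * Q r)"
    unfolding sum_subtractf[symmetric] by (intro sum.cong refl) (simp add: dIl sum_subtractf left_diff_distrib)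
  finally show ?thesis
    unfolding dIl_Q Il_Q1 T_Iu_Q by (simp add: dI_def distrib_right sum.distrib)
qed

lemma lower_raise: "(\<Sum>b\<in>UNIV. g a b * Iu b) = Il a"
proof -
  have "(\<Sum>b\<in>UNIV. g a b * Iu b) = (\<Sum>d\<in>UNIV. (\<Sum>b\<in>UNIV. gi d b * g b a) * Il d)"
    unfolding Iu_def sum_distrib_left sum_distrib_right
    by (rule trans[OF sum.swap]) (simp add: g_sym gi_sym mult_ac)
  then show ?thesis by (simp add: gi_g)
qed

text \<open>Only a rewriting of \<open>J_eq\<close> with c displayed. Contracting the first lower
  index of c with y gives -\<open>K\<close>, which accounts for the overall sign -1/2.\<close>

lemma J_eq_comm:
  "J k = - 1/2 * (\<Sum>e\<in>UNIV. \<Sum>m\<in>UNIV. \<Sum>n\<in>UNIV. c e m n *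
    (y m * Il e * kdelta n k + Iu m * g e k * y n + Iu m * yl e * kdelta n k + 2 * dI k m * yl e * y n))"
proof -
  have K: "(\<Sum>m\<in>UNIV. c e m k * y m) = - K e k" for e
    unfolding K_def sum_negf[symmetric] by (intro sum.cong refl) (simp add: c_antisym[of e _ k])
  have inner: "(\<Sum>n\<in>UNIV. c e m n *
      (y m * Il e * kdelta n k + Iu m * g e k * y n + Iu m * yl e * kdelta n k + 2 * dI k m * yl e * y n))
    = (c e m k * y m) * Il e + Iu m * (c e m k * yl e + K e m * g e k) + 2 * (dI k m * (K e m * yl e))" for e m
  proof -
    have "(\<Sum>n\<in>UNIV. c e m n *
        (y m * Il e * kdelta n k + Iu m * g e k * y n + Iu m * yl e * kdelta n k + 2 * dI k m * yl e * y n))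
      = (\<Sum>n\<in>UNIV. c e m n * (y m * Il e + Iu m * yl e) * kdelta n k
        + (Iu m * g e k + 2 * dI k m * yl e) * (c e m n * y n))"
      by (intro sum.cong refl) (simp add: algebra_simps)
    also have "\<dots> = c e m k * (y m * Il e + Iu m * yl e) + (Iu m * g e k + 2 * dI k m * yl e) * K e m"
      by (simp only: sum.distrib sum_kdelta sum_distrib_left[symmetric] K_def)
    finally show ?thesis by (simp add: algebra_simps)
  qed
  have A: "(\<Sum>e\<in>UNIV. \<Sum>m\<in>UNIV. (c e m k * y m) * Il e) = - (\<Sum>e\<in>UNIV. K e k * Il e)"
    by (simp add: K sum_negf flip: sum_distrib_right)
  have B: "(\<Sum>e\<in>UNIV. \<Sum>m\<in>UNIV. Iu m * (c e m k * yl e + K e m * g e k)) = (\<Sum>m\<in>UNIV. Iu m * W1 m k)"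
    unfolding W1_def sum_distrib_left by (rule sum.swap)
  have C: "(\<Sum>e\<in>UNIV. \<Sum>m\<in>UNIV. dI k m * (K e m * yl e)) = (\<Sum>m\<in>UNIV. dI k m * W m)"
    unfolding W_def sum_distrib_left by (rule sum.swap)
  show ?thesis
    unfolding J_eq inner sum.distrib sum_distrib_left[symmetric] A B C by (simp add: field_simps)
qed

section \<open>The formula in terms of the coefficients k_{mne}\<close>

definition cl :: "'n \<Rightarrow> 'n \<Rightarrow> 'n \<Rightarrow> real" where "cl a b e = (\<Sum>d\<in>UNIV. g a d * c d b e)"
definition kc :: "'n \<Rightarrow> 'n \<Rightarrow> 'n \<Rightarrow> real" where
  "kc m n e = 1/2 * (cl m n e + cl n e m - cl e m n)"
definition M :: "'n \<Rightarrow> 'n \<Rightarrow> real" where "M m n = (\<Sum>e\<in>UNIV. kc m n e * y e)"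

lemma cl_antisym: "cl a b e = - cl a e b"
  unfolding cl_def sum_negf[symmetric] by (intro sum.cong refl) (simp add: c_antisym[of _ b e])

lemma M_antisym: "M m n = - M n m"
  unfolding M_def sum_negf[symmetric] kc_def
  by (intro sum.cong refl) (simp add: cl_antisym[of m n] cl_antisym[of n _ m] cl_antisym[of _ m n] field_simps)

lemma M_eq: "M m n = 1/2 * ((\<Sum>d\<in>UNIV. g m d * K d n) - (\<Sum>d\<in>UNIV. g n d * K d m) - (\<Sum>d\<in>UNIV. yl d * c d m n))"
proof -
  have 1: "(\<Sum>e\<in>UNIV. cl m n e * y e) = (\<Sum>d\<in>UNIV. g m d * K d n)" for m n
    unfolding cl_def K_def sum_distrib_left sum_distrib_right
    by (rule trans[OF sum.swap]) (simp add: mult_ac)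
  have 2: "(\<Sum>e\<in>UNIV. cl n e m * y e) = - (\<Sum>d\<in>UNIV. g n d * K d m)"
    unfolding 1[symmetric] sum_negf[symmetric] by (intro sum.cong refl) (simp add: cl_antisym[of n m])
  have 3: "(\<Sum>e\<in>UNIV. cl e m n * y e) = (\<Sum>d\<in>UNIV. yl d * c d m n)"
    unfolding cl_def yl_def sum_distrib_left sum_distrib_right
    by (rule trans[OF sum.swap]) (simp add: mult_ac g_sym)
  have "M m n = 1/2 * ((\<Sum>e\<in>UNIV. cl m n e * y e) + (\<Sum>e\<in>UNIV. cl n e m * y e) - (\<Sum>e\<in>UNIV. cl e m n * y e))"
    by (simp add: M_def kc_def algebra_simps sum.distrib sum_subtractf sum_divide_distrib add_divide_distrib diff_divide_distrib)
  then show ?thesis by (simp add: 1 2 3)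
qed

text \<open>Of the three terms in \<open>M_eq\<close>, the first vanishes because y is contracted
  with both lower indices of c; the other two each give \<open>W\<close> with the factor
  -1/2.\<close>

lemma M_y: "(\<Sum>n\<in>UNIV. M m n * y n) = - W m"
proof -
  have "(\<Sum>n\<in>UNIV. K d n * y n) = 0" for d
  proof -
    have "(\<Sum>n\<in>UNIV. K d n * y n) = (\<Sum>n\<in>UNIV. \<Sum>e\<in>UNIV. (y n * y e) * c d n e)"
      by (simp add: K_def sum_distrib_left mult_ac)
    also have "\<dots> = 0"
      by (rule sum_sym_antisym[OF mult.commute c_antisym])
    finally show ?thesis .
  qed
  then have 1: "(\<Sum>n\<in>UNIV. (\<Sum>d\<in>UNIV. g m d * K d n) * y n) = 0"
    unfolding sum_distrib_right
    by (subst sum.swap) (simp add: mult.assoc flip: sum_distrib_left)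
  have 2: "(\<Sum>n\<in>UNIV. (\<Sum>d\<in>UNIV. g n d * K d m) * y n) = W m"
    unfolding W_def yl_def sum_distrib_left sum_distrib_right
    by (rule trans[OF sum.swap]) (simp add: mult_ac g_sym)
  have 3: "(\<Sum>n\<in>UNIV. (\<Sum>d\<in>UNIV. yl d * c d m n) * y n) = W m"
    unfolding W_def K_def sum_distrib_left sum_distrib_right
    by (rule trans[OF sum.swap]) (simp add: mult_ac)
  have "(\<Sum>n\<in>UNIV. M m n * y n) = 1/2 * ((\<Sum>n\<in>UNIV. (\<Sum>d\<in>UNIV. g m d * K d n) * y n)
      - (\<Sum>n\<in>UNIV. (\<Sum>d\<in>UNIV. g n d * K d m) * y n) - (\<Sum>n\<in>UNIV. (\<Sum>d\<in>UNIV. yl d * c d m n) * y n))"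
    unfolding sum_subtractf[symmetric] sum_distrib_left[of "1/2"]
    by (intro sum.cong refl) (simp add: M_eq algebra_simps)
  then show ?thesis by (simp add: 1 2 3)
qed

text \<open>In \<open>M\<close> \<open>Iu\<close> the first term of \<open>M_eq\<close> lowers
  \<open>Iu\<close> and gives \<open>K\<close> \<open>Il\<close>, and the other two combine to
  \<open>W1\<close>; by \<open>M_y\<close> the second summand gives the \<open>W\<close> term of
  \<open>J_eq\<close>.\<close>

lemma J_eq_M: "J k = (\<Sum>m\<in>UNIV. \<Sum>n\<in>UNIV. M m n * (Iu m * kdelta n k + y n * dI k m))"
proof -
  have "(\<Sum>m\<in>UNIV. Iu m * (\<Sum>d\<in>UNIV. g m d * K d k)) = (\<Sum>d\<in>UNIV. (\<Sum>m\<in>UNIV. g d m * Iu m) * K d k)"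
    unfolding sum_distrib_left sum_distrib_right
    by (rule trans[OF sum.swap]) (simp add: mult_ac g_sym)
  then have 1: "(\<Sum>m\<in>UNIV. Iu m * (\<Sum>d\<in>UNIV. g m d * K d k)) = (\<Sum>d\<in>UNIV. K d k * Il d)"
    by (simp add: lower_raise mult.commute)
  have M: "M m k = 1/2 * ((\<Sum>d\<in>UNIV. g m d * K d k) - W1 m k)" for m
    by (simp add: M_eq W1_def sum.distrib g_sym mult_ac)
  have "(\<Sum>m\<in>UNIV. M m k * Iu m) = 1/2 * ((\<Sum>d\<in>UNIV. K d k * Il d) - (\<Sum>m\<in>UNIV. Iu m * W1 m k))"
    unfolding 1[symmetric] sum_subtractf[symmetric] sum_distrib_left[of "1/2"]
    by (intro sum.cong refl) (simp add: M algebra_simps)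
  moreover have "(\<Sum>n\<in>UNIV. M m n * (Iu m * kdelta n k + y n * dI k m)) = M m k * Iu m - dI k m * W m" for m
  proof -
    have "(\<Sum>n\<in>UNIV. M m n * (Iu m * kdelta n k + y n * dI k m))
        = (\<Sum>n\<in>UNIV. (M m n * Iu m) * kdelta n k + dI k m * (M m n * y n))"
      by (intro sum.cong refl) (simp add: algebra_simps)
    also have "\<dots> = M m k * Iu m + dI k m * - W m"
      by (simp only: sum.distrib sum_kdelta sum_distrib_left[symmetric] M_y)
    finally show ?thesis by simp
  qed
  ultimately show ?thesis by (simp add: J_eq sum_subtractf)
qed

lemma J_eq_kc:
  "J k = (\<Sum>m\<in>UNIV. \<Sum>n\<in>UNIV. \<Sum>e\<in>UNIV. kc m n e * y e * (Iu m * kdelta n k + y n * dI k m))"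
  by (simp only: J_eq_M M_def sum_distrib_right)

section \<open>Homogeneity of the mean Cartan tensor and the projected formula\<close>

lemma y_T': "(\<Sum>a\<in>UNIV. y a * T b k a) = 0" "(\<Sum>a\<in>UNIV. y a * T b a k) = 0"
proof -
  have "T b k a = T a b k" for a
    using T_perm[of b k a] T_swap23[of a k b] by simp
  then show "(\<Sum>a\<in>UNIV. y a * T b k a) = 0" "(\<Sum>a\<in>UNIV. y a * T b a k) = 0"
    using y_T[of b k] by (simp_all add: T_swap12[of b])
qed

lemma y_TT: "(\<Sum>k\<in>UNIV. y k * TT k a b) = 0"
proof -
  have "(\<Sum>k\<in>UNIV. y k * TT k a b) = (\<Sum>p\<in>UNIV. \<Sum>q\<in>UNIV. \<Sum>k\<in>UNIV. gi a p * gi q b * (y k * T p q k))"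
    unfolding TT_def sum_distrib_left
    apply (rule trans[OF sum.swap])
    apply (rule sum.cong[OF refl])
    apply (rule trans[OF sum.swap])
    apply (simp add: mult_ac)
    done
  then show ?thesis by (simp add: y_T' flip: sum_distrib_left)
qed

text \<open>Euler's relation in degree -1: the inverse metric has degree 0, so only the third
  derivatives, of degree -1, contribute.\<close>

lemma y_dIl: "(\<Sum>k\<in>UNIV. y k * dIl k r) = - Il r"
proof -
  have F: "(\<Sum>k\<in>UNIV. y k * F r a b k) = - T r a b" for a b
  proof -
    have "F r a b k = F k r a b" for k
      using F_swap34[of r a b k] F_swap23[of r a k b] F_swap12[of r k a b] by simp
    then show ?thesis using y_F[of r a b] by simp
  qed
  have "(\<Sum>k\<in>UNIV. y k * dIl k r) = (\<Sum>k\<in>UNIV. \<Sum>a\<in>UNIV. \<Sum>b\<in>UNIV.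
      1/2 * (gi a b * (y k * F r a b k) - T r a b * (y k * TT k a b)))"
    unfolding dIl sum_distrib_left by (intro sum.cong refl) (simp add: algebra_simps)
  also have "\<dots> = (\<Sum>a\<in>UNIV. \<Sum>b\<in>UNIV. \<Sum>k\<in>UNIV. 
      1/2 * (gi a b * (y k * F r a b k) - T r a b * (y k * TT k a b)))"
    by (rule trans[OF sum.swap]) (intro sum.cong refl sum.swap)
  also have "\<dots> = (\<Sum>a\<in>UNIV. \<Sum>b\<in>UNIV. 1/2 * (gi a b * - T r a b))"
    by (simp only: F y_TT sum_subtractf mult_zero_right diff_zero sum_distrib_left[symmetric])
  finally show ?thesis by (simp add: Il_def sum_negf)
qed

lemma y_dIu: "(\<Sum>k\<in>UNIV. y k * dIu k m) = - Iu m"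
proof -
  have "(\<Sum>m\<in>UNIV. g r m * (\<Sum>k\<in>UNIV. y k * dIu k m)) = - Il r" for r
  proof -
    have "(\<Sum>m\<in>UNIV. g r m * (\<Sum>k\<in>UNIV. y k * dIu k m))
        = (\<Sum>m\<in>UNIV. (\<Sum>k\<in>UNIV. y k * T r m k) * Iu m + (\<Sum>k\<in>UNIV. y k * (g r m * dIu k m)))"
      by (simp add: y_T' sum_distrib_left mult_ac)
    also have "\<dots> = (\<Sum>k\<in>UNIV. y k * (\<Sum>m\<in>UNIV. T r m k * Iu m + g r m * dIu k m))"
      unfolding sum_distrib_left sum_distrib_right sum.distrib[symmetric]
      by (rule trans[OF sum.swap]) (simp add: algebra_simps)
    finally show ?thesis by (simp only: dIu y_dIl)
  qed
  then show ?thesis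
    using raise_lower[of m "\<lambda>m. \<Sum>k\<in>UNIV. y k * dIu k m"] by (simp add: Iu_def sum_negf)
qed

lemma y_dI: "(\<Sum>k\<in>UNIV. y k * dI k m) = - Iu m"
proof -
  have Cu: "(\<Sum>k\<in>UNIV. y k * Cu m s k) = 0" for s
  proof -
    have "(\<Sum>k\<in>UNIV. y k * Cu m s k) = (\<Sum>a\<in>UNIV. 1/2 * gi m a * (\<Sum>k\<in>UNIV. y k * T a s k))"
      unfolding Cu_def sum_distrib_left by (rule trans[OF sum.swap]) (simp add: mult_ac)
    then show ?thesis by (simp add: y_T')
  qed
  have "(\<Sum>k\<in>UNIV. y k * (\<Sum>s\<in>UNIV. Cu m s k * Iu s)) = (\<Sum>s\<in>UNIV. (\<Sum>k\<in>UNIV. y k * Cu m s k) * Iu s)"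
    unfolding sum_distrib_left sum_distrib_right by (rule trans[OF sum.swap]) (simp add: mult_ac)
  then show ?thesis by (simp add: Cu dI_def distrib_left sum.distrib y_dIu)
qed

lemma M_antisym2:
  "(\<Sum>m\<in>UNIV. \<Sum>n\<in>UNIV. M m n * antisym2 X n m) = (\<Sum>m\<in>UNIV. \<Sum>n\<in>UNIV. M m n * X n m)"
proof -
  have "(\<Sum>m\<in>UNIV. \<Sum>n\<in>UNIV. M m n * X m n) = (\<Sum>n\<in>UNIV. \<Sum>m\<in>UNIV. M m n * X m n)"
    by (rule sum.swap)
  also have "\<dots> = - (\<Sum>n\<in>UNIV. \<Sum>m\<in>UNIV. M n m * X m n)"
  proof -
    have "M m n * X m n = - (M n m * X m n)" for m n
      using M_antisym[of m n] by simp
    then show ?thesis unfolding sum_negf[symmetric] by (intro sum.cong refl)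
  qed
  finally have *: "(\<Sum>m\<in>UNIV. \<Sum>n\<in>UNIV. M m n * X m n) = - (\<Sum>n\<in>UNIV. \<Sum>m\<in>UNIV. M n m * X m n)" .
  have "(\<Sum>m\<in>UNIV. \<Sum>n\<in>UNIV. M m n * antisym2 X n m) = (\<Sum>m\<in>UNIV. \<Sum>n\<in>UNIV.
      1/2 * (M m n * X n m) - 1/2 * (M m n * X m n))"
    by (intro sum.cong refl) (simp add: antisym2_def algebra_simps)
  also have "\<dots> = 1/2 * (\<Sum>m\<in>UNIV. \<Sum>n\<in>UNIV. M m n * X n m) - 1/2 * (\<Sum>m\<in>UNIV. \<Sum>n\<in>UNIV. M m n * X m n)"
    by (simp only: sum_subtractf sum_distrib_left)
  finally show ?thesis unfolding * by simp
qed

text \<open>Compared with \<open>J_eq_M\<close>, projecting changes three things: a term y^n y_k I^m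
  / G in the first summand, its opposite in the second because I has degree -1, and a multiple of
  y^n y^m. The first two cancel, and the last vanishes against the antisymmetric
  \<open>M\<close>.\<close>

lemma J_eq_proj:
  assumes h: "\<And>a b. h a b = kdelta a b - 1 / G * y a * yl b"
  shows "J k = (\<Sum>m\<in>UNIV. \<Sum>n\<in>UNIV. \<Sum>e\<in>UNIV. kc m n e * y e *
      (antisym2 (\<lambda>n m. h n k * Iu m) n m
       + antisym2 (\<lambda>n m. y n * (\<Sum>a\<in>UNIV. \<Sum>d\<in>UNIV. h a k * h m d * dI a d)) n m))"
proof -
  have 1: "(\<Sum>a\<in>UNIV. h a k * dI a d) = dI k d + yl k / G * Iu d" for d
  proof -
    have "(\<Sum>a\<in>UNIV. h a k * dI a d) = dI k d - yl k / G * (\<Sum>a\<in>UNIV. y a * dI a d)"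
    proof -
      have "(\<Sum>a\<in>UNIV. h a k * dI a d) = (\<Sum>a\<in>UNIV. kdelta a k * dI a d - yl k / G * (y a * dI a d))"
        by (intro sum.cong refl) (simp add: h algebra_simps)
      then show ?thesis by (simp only: sum_subtractf sum_kdelta sum_distrib_left[symmetric])
    qed
    then show ?thesis by (simp add: y_dI)
  qed
  have 2: "(\<Sum>a\<in>UNIV. \<Sum>d\<in>UNIV. h a k * h m d * dI a d) = (\<Sum>d\<in>UNIV. h m d * (\<Sum>a\<in>UNIV. h a k * dI a d))" for m
    unfolding sum_distrib_left by (rule trans[OF sum.swap]) (simp add: mult_ac)
  have 3: "(\<Sum>d\<in>UNIV. h m d * Z d) = Z m - y m * ((\<Sum>d\<in>UNIV. yl d * Z d) / G)" for m Z
  proof -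
    have "(\<Sum>d\<in>UNIV. h m d * Z d) = (\<Sum>d\<in>UNIV. kdelta m d * Z d - y m / G * (yl d * Z d))"
      by (intro sum.cong refl) (simp add: h algebra_simps)
    also have "\<dots> = Z m - y m / G * (\<Sum>d\<in>UNIV. yl d * Z d)"
      by (simp only: sum_subtractf sum_kdelta sum_distrib_left[symmetric])
    finally show ?thesis by simp
  qed
  \<comment> \<open>What projecting the index m subtracts, as a multiple of \<open>y m\<close>. Its
    value is irrelevant; it only has to be independent of m and n.\<close>
  define S where "S = (\<Sum>d\<in>UNIV. yl d * (dI k d + yl k / G * Iu d)) / G"
  have S: "(\<Sum>a\<in>UNIV. \<Sum>d\<in>UNIV. h a k * h m d * dI a d) = dI k m + yl k / G * Iu m - y m * S" for m
    unfolding 2 1 3 S_def ..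
  have "(\<Sum>m\<in>UNIV. \<Sum>n\<in>UNIV. \<Sum>e\<in>UNIV. kc m n e * y e *
      (antisym2 (\<lambda>n m. h n k * Iu m) n m
       + antisym2 (\<lambda>n m. y n * (\<Sum>a\<in>UNIV. \<Sum>d\<in>UNIV. h a k * h m d * dI a d)) n m))
    = (\<Sum>m\<in>UNIV. \<Sum>n\<in>UNIV. M m n * antisym2 (\<lambda>n m. h n k * Iu m
        + y n * (\<Sum>a\<in>UNIV. \<Sum>d\<in>UNIV. h a k * h m d * dI a d)) n m)"
    unfolding M_def sum_distrib_right by (intro sum.cong refl) (simp add: antisym2_def algebra_simps)
  also have "\<dots> = (\<Sum>m\<in>UNIV. \<Sum>n\<in>UNIV. M m n * (Iu m * kdelta n k + y n * dI k m) - S * ((y m * y n) * M m n))"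
    unfolding M_antisym2 S by (intro sum.cong refl) (simp add: h algebra_simps)
  also have "\<dots> = J k - S * (\<Sum>m\<in>UNIV. \<Sum>n\<in>UNIV. (y m * y n) * M m n)"
    by (simp only: sum_subtractf sum_distrib_left J_eq_M)
  also have "(\<Sum>m\<in>UNIV. \<Sum>n\<in>UNIV. (y m * y n) * M m n) = 0"
    by (rule sum_sym_antisym[OF mult.commute M_antisym])
  finally show ?thesis by simp
qed

end

section \<open>Derivatives of a pseudo-Minkowski function\<close>

text \<open>Homogeneity enters only through Euler's relation, and nondegeneracy as invertibility of
  a matrix; both are extracted from \<open>pseudo_minkowski\<close> in
  \<open>minkowski_function_frame\<close>.\<close>

locale minkowski_function =
  fixes f :: "real^'n::finite \<Rightarrow> real" and U :: "(real^'n) set"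
  assumes open_U: "open U"
    and f_C4: "Ck_on 4 f U"
    and euler: "y \<in> U \<Longrightarrow> (\<Sum>a\<in>UNIV. y $ a * pd a f y) = 2 * f y"
    and nondegenerate: "y \<in> U \<Longrightarrow> invertible (metric_tensor f y)"
begin

lemma pd_C3: "Ck_on 3 (pd a f) U"
  using Ck_on_pd[OF open_U, of 3 f] f_C4 by simp

lemma pd2_C2: "Ck_on 2 (pd a (pd b f)) U"
  using Ck_on_pd[OF open_U, of 2 "pd b f"] pd_C3 by simp

lemma pd3_C1: "Ck_on 1 (pd a (pd b (pd c f))) U"
  using Ck_on_pd[OF open_U, of 1 "pd b (pd c f)"] pd2_C2 by (simp add: numeral_2_eq_2)

lemma has_pd_pd: "y \<in> U \<Longrightarrow> has_pd i (pd a f) (pd i (pd a f) y) y"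
  by (rule Ck_on_has_pd[OF pd_C3]) simp_all

lemma has_pd_pd2: "y \<in> U \<Longrightarrow> has_pd i (pd a (pd b f)) (pd i (pd a (pd b f)) y) y"
  by (rule Ck_on_has_pd[OF pd2_C2]) simp_all

lemma has_pd_pd3: "y \<in> U \<Longrightarrow> has_pd i (pd a (pd b (pd c f))) (pd i (pd a (pd b (pd c f))) y) y"
  by (rule Ck_on_has_pd[OF pd3_C1]) simp_all

lemma pd2_sym: "y \<in> U \<Longrightarrow> pd a (pd b f) y = pd b (pd a f) y"
  by (rule pd_commute[OF open_U Ck_on_le[OF f_C4]]) simp_all

lemma pd3_swap12: "y \<in> U \<Longrightarrow> pd a (pd b (pd c f)) y = pd b (pd a (pd c f)) y"
  by (rule pd_commute[OF open_U Ck_on_le[OF pd_C3]]) simp_all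

lemma pd3_swap23: "y \<in> U \<Longrightarrow> pd a (pd b (pd c f)) y = pd a (pd c (pd b f)) y"
  by (rule pd_cong[OF open_U _ pd2_sym])

lemma pd4_swap12: "y \<in> U \<Longrightarrow> pd a (pd b (pd c (pd d f))) y = pd b (pd a (pd c (pd d f))) y"
  by (rule pd_commute[OF open_U pd2_C2])

lemma pd4_swap23: "y \<in> U \<Longrightarrow> pd a (pd b (pd c (pd d f))) y = pd a (pd c (pd b (pd d f))) y"
  by (rule pd_cong[OF open_U _ pd3_swap12])

lemma pd4_swap34: "y \<in> U \<Longrightarrow> pd a (pd b (pd c (pd d f))) y = pd a (pd b (pd d (pd c f))) y"
  by (rule pd_cong[OF open_U _ pd3_swap23])

lemma euler1: "y \<in> U \<Longrightarrow> (\<Sum>a\<in>UNIV. y $ a * pd a (pd b f) y) = pd b f y"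
  using euler_pd[OF open_U Ck_on_le[OF f_C4] _ euler] by simp

lemma euler2: "y \<in> U \<Longrightarrow> (\<Sum>a\<in>UNIV. y $ a * pd a (pd b (pd c f)) y) = 0"
  using euler_pd[OF open_U Ck_on_le[OF pd_C3], where k = 1 and b = b] euler1 by simp

lemma euler3: "y \<in> U \<Longrightarrow> (\<Sum>a\<in>UNIV. y $ a * pd a (pd b (pd c (pd d f))) y) = - pd b (pd c (pd d f)) y"
  using euler_pd[OF open_U pd2_C2, where k = 0 and b = b] euler2 by simp

lemma metric_tensor_component: "metric_tensor f y $ a $ b = pd a (pd b f) y"
  by (simp add: metric_tensor_def)

lemma inv_metric_C2: "Ck_on 2 (\<lambda>y. inv_metric f y $ a $ b) U"
  unfolding inv_metric_def
  by (rule Ck_on_matrix_inv[OF open_U]) (simp_all add: metric_tensor_component pd2_C2 nondegenerate)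

lemma has_pd_inv_metric:
  "y \<in> U \<Longrightarrow> has_pd i (\<lambda>y. inv_metric f y $ a $ b) (pd i (\<lambda>y. inv_metric f y $ a $ b) y) y"
  by (rule Ck_on_has_pd[OF inv_metric_C2]) simp_all

lemma inv_metric_mult:
  assumes "y \<in> U"
  shows "(\<Sum>b\<in>UNIV. inv_metric f y $ a $ b * pd b (pd c f) y) = kdelta a c"
    "(\<Sum>b\<in>UNIV. pd a (pd b f) y * inv_metric f y $ b $ c) = kdelta a c"
proof -
  have "inv_metric f y ** metric_tensor f y = mat 1" "metric_tensor f y ** inv_metric f y = mat 1"
    unfolding inv_metric_def using matrix_inv_mult[OF nondegenerate[OF assms]] by auto
  then have "(inv_metric f y ** metric_tensor f y) $ a $ c = mat 1 $ a $ c"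
    "(metric_tensor f y ** inv_metric f y) $ a $ c = mat 1 $ a $ c" by simp_all
  then show "(\<Sum>b\<in>UNIV. inv_metric f y $ a $ b * pd b (pd c f) y) = kdelta a c"
    "(\<Sum>b\<in>UNIV. pd a (pd b f) y * inv_metric f y $ b $ c) = kdelta a c"
    by (simp_all add: matrix_matrix_mult_def mat_def kdelta_def metric_tensor_def)
qed

lemma inv_metric_sym:
  assumes "y \<in> U"
  shows "inv_metric f y $ a $ b = inv_metric f y $ b $ a"
proof -
  have tr: "transpose (metric_tensor f y) = metric_tensor f y"
    using pd2_sym[OF assms] by (simp add: transpose_def metric_tensor_def vec_eq_iff)
  have inv: "metric_tensor f y ** inv_metric f y = mat 1" "inv_metric f y ** metric_tensor f y = mat 1"
    unfolding inv_metric_def by (rule matrix_inv_mult[OF nondegenerate[OF assms]])+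
  have "metric_tensor f y ** transpose (inv_metric f y) = transpose (inv_metric f y ** metric_tensor f y)"
    "transpose (inv_metric f y) ** metric_tensor f y = transpose (metric_tensor f y ** inv_metric f y)"
    by (simp_all add: matrix_transpose_mul tr)
  then have "matrix_inv (metric_tensor f y) = transpose (inv_metric f y)"
    by (intro matrix_inv_unique) (simp_all only: inv transpose_mat)
  then have "inv_metric f y = transpose (inv_metric f y)"
    by (simp only: inv_metric_def)
  then show ?thesis by (metis transpose_def vec_lambda_beta)
qed

lemma fibre_tensors:
  assumes "y \<in> U"
  shows "fibre_tensors (\<lambda>a b. pd a (pd b f) y) (\<lambda>a b. inv_metric f y $ a $ b)
    (\<lambda>a b c. pd a (pd b (pd c f)) y) (\<lambda>a b c d. pd a (pd b (pd c (pd d f))) y)"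
  by (unfold_locales; rule pd2_sym pd3_swap12 pd3_swap23 pd4_swap12 pd4_swap23 pd4_swap34
      inv_metric_sym inv_metric_mult(1)) (rule assms)+

text \<open>Differentiate metric times inverse metric = identity, then raise the free index.\<close>

lemma pd_inv_metric:
  assumes "y \<in> U"
  shows "pd i (\<lambda>y. inv_metric f y $ a $ b) y = - (\<Sum>p\<in>UNIV. \<Sum>q\<in>UNIV.
    inv_metric f y $ a $ p * pd p (pd q (pd i f)) y * inv_metric f y $ q $ b)"
proof -
  interpret fibre_tensors "\<lambda>a b. pd a (pd b f) y" "\<lambda>a b. inv_metric f y $ a $ b"
    "\<lambda>a b c. pd a (pd b (pd c f)) y" "\<lambda>a b c d. pd a (pd b (pd c (pd d f))) y" "($) y"
    by (rule fibre_tensors[OF assms])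
  have *: "(\<Sum>q\<in>UNIV. pd p (pd q f) y * pd i (\<lambda>y. inv_metric f y $ q $ b) y)
      = - (\<Sum>q\<in>UNIV. pd p (pd q (pd i f)) y * inv_metric f y $ q $ b)" for p
  proof -
    have "has_pd i (\<lambda>z. \<Sum>q\<in>UNIV. pd p (pd q f) z * inv_metric f z $ q $ b)
        (\<Sum>q\<in>UNIV. pd i (pd p (pd q f)) y * inv_metric f y $ q $ b
          + pd p (pd q f) y * pd i (\<lambda>y. inv_metric f y $ q $ b) y) y"
      by (intro has_pd_intros has_pd_pd2 has_pd_inv_metric assms)
    then have "has_pd i (\<lambda>z. kdelta p b)
        (\<Sum>q\<in>UNIV. pd i (pd p (pd q f)) y * inv_metric f y $ q $ b
          + pd p (pd q f) y * pd i (\<lambda>y. inv_metric f y $ q $ b) y) y"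
      using has_pd_cong[OF open_U assms inv_metric_mult(2)] by simp
    then have "(\<Sum>q\<in>UNIV. pd i (pd p (pd q f)) y * inv_metric f y $ q $ b
          + pd p (pd q f) y * pd i (\<lambda>y. inv_metric f y $ q $ b) y) = 0"
      using has_pd_unique has_pd_const by blast
    moreover have "pd i (pd p (pd q f)) y = pd p (pd q (pd i f)) y" for q
      using pd3_swap12[OF assms, of i p q] pd3_swap23[OF assms, of p i q] by simp
    ultimately show ?thesis by (simp add: sum.distrib eq_neg_iff_add_eq_0 add.commute)
  qed
  show ?thesis
    using raise_lower[of a "\<lambda>q. pd i (\<lambda>y. inv_metric f y $ q $ b) y"]
    by (simp add: * sum_negf sum_distrib_left mult.assoc)
qed

lemma mean_cartan_C1: "Ck_on 1 (\<lambda>y. mean_cartan f y a) U"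
  unfolding mean_cartan_def cartan_def
  by (intro Ck_on_sum Ck_on_mult open_U Ck_on_const pd3_C1 Ck_on_le[OF inv_metric_C2]) simp_all

lemma mean_cartan_up_C1: "Ck_on 1 (\<lambda>y. mean_cartan_up f y a) U"
  unfolding mean_cartan_up_def
  by (intro Ck_on_sum Ck_on_mult open_U mean_cartan_C1 Ck_on_le[OF inv_metric_C2]) simp_all

lemma lower_mean_cartan_up:
  assumes "y \<in> U"
  shows "(\<Sum>m\<in>UNIV. pd r (pd m f) y * mean_cartan_up f y m) = mean_cartan f y r"
proof -
  have "(\<Sum>m\<in>UNIV. pd r (pd m f) y * mean_cartan_up f y m)
      = (\<Sum>b\<in>UNIV. (\<Sum>m\<in>UNIV. pd r (pd m f) y * inv_metric f y $ m $ b) * mean_cartan f y b)"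
    unfolding mean_cartan_up_def sum_distrib_left sum_distrib_right
    by (rule trans[OF sum.swap]) (simp add: mult.assoc)
  then show ?thesis by (simp add: inv_metric_mult(2)[OF assms])
qed

lemma fibre_tensors_defs:
  assumes "y \<in> U"
  shows "fibre_tensors.yl (\<lambda>a b. pd a (pd b f) y) (($) y) = y_low f y"
    "fibre_tensors.Il (\<lambda>a b. inv_metric f y $ a $ b) (\<lambda>a b c. pd a (pd b (pd c f)) y) = mean_cartan f y"
    "fibre_tensors.Iu (\<lambda>a b. inv_metric f y $ a $ b) (\<lambda>a b c. pd a (pd b (pd c f)) y) = mean_cartan_up f y"
    "fibre_tensors.Cu (\<lambda>a b. inv_metric f y $ a $ b) (\<lambda>a b c. pd a (pd b (pd c f)) y) = cartan_up f y"
proof -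
  interpret fibre_tensors "\<lambda>a b. pd a (pd b f) y" "\<lambda>a b. inv_metric f y $ a $ b"
    "\<lambda>a b c. pd a (pd b (pd c f)) y" "\<lambda>a b c d. pd a (pd b (pd c (pd d f))) y" "($) y"
    by (rule fibre_tensors[OF assms])
  show "yl = y_low f y"
    using euler1[OF assms] by (simp add: yl_def y_low_def fun_eq_iff g_sym mult.commute)
  show "Il = mean_cartan f y"
    by (simp add: Il_def mean_cartan_def cartan_def fun_eq_iff)
  then show "Iu = mean_cartan_up f y"
    by (simp add: Iu_def mean_cartan_up_def fun_eq_iff)
  show "Cu = cartan_up f y"
    by (simp add: Cu_def cartan_up_def cartan_def fun_eq_iff)
qed

text \<open>With \<open>c\<close> the commutation coefficients, \<open>dev c\<close> is the non-quadratic part of the spray in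
  frame components.\<close>

definition wdev :: "('n \<Rightarrow> 'n \<Rightarrow> 'n \<Rightarrow> real) \<Rightarrow> 'n \<Rightarrow> real^'n \<Rightarrow> real" where
  "wdev c d y = (\<Sum>s\<in>UNIV. (\<Sum>e\<in>UNIV. c s d e * y $ e) * pd s f y)"

definition dev :: "('n \<Rightarrow> 'n \<Rightarrow> 'n \<Rightarrow> real) \<Rightarrow> 'n \<Rightarrow> real^'n \<Rightarrow> real" where
  "dev c r y = 1/2 * (\<Sum>d\<in>UNIV. inv_metric f y $ r $ d * wdev c d y)"

lemma Ck_on_component: "Ck_on k (\<lambda>y. y $ e) U"
proof (induction k)
  case (Suc k)
  show ?case
    by (rule Ck_on_SucI[OF open_U, where f' = "\<lambda>x h. h $ e"])
      (auto intro!: bounded_linear_imp_has_derivative bounded_linear_vec_nth)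
qed (auto intro: continuous_intros)

text \<open>The inverse metric already contains two of the four available derivatives, so two are
  left for \<open>dev\<close>.\<close>

lemma dev_C2: "Ck_on 2 (dev c r) U"
  unfolding dev_def wdev_def
  by (intro Ck_on_mult Ck_on_sum Ck_on_const Ck_on_component open_U inv_metric_C2 Ck_on_le[OF pd_C3]) simp

lemma pd_dev_C1: "Ck_on 1 (pd a (dev c r)) U"
  using Ck_on_pd[OF open_U, of 1 "dev c r"] dev_C2 by (simp add: numeral_2_eq_2)

lemma has_pd_dev: "y \<in> U \<Longrightarrow> has_pd i (dev c r) (pd i (dev c r) y) y"
  by (rule Ck_on_has_pd[OF dev_C2]) simp_all

lemma has_pd_pd_dev: "y \<in> U \<Longrightarrow> has_pd i (pd j (dev c r)) (pd i (pd j (dev c r)) y) y"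
  by (rule Ck_on_has_pd[OF pd_dev_C1]) simp_all

lemma lower_dev:
  assumes "y \<in> U"
  shows "(\<Sum>r\<in>UNIV. pd d (pd r f) y * dev c r y) = wdev c d y / 2"
proof -
  have "(\<Sum>r\<in>UNIV. pd d (pd r f) y * dev c r y)
      = (\<Sum>b\<in>UNIV. (\<Sum>r\<in>UNIV. pd d (pd r f) y * inv_metric f y $ r $ b) * (wdev c b y / 2))"
    unfolding dev_def sum_distrib_left sum_distrib_right
    by (rule trans[OF sum.swap]) (simp add: mult_ac)
  then show ?thesis by (simp only: inv_metric_mult(2)[OF assms] sum_kdelta)
qed

definition wdev1 :: "('n \<Rightarrow> 'n \<Rightarrow> 'n \<Rightarrow> real) \<Rightarrow> 'n \<Rightarrow> 'n \<Rightarrow> real^'n \<Rightarrow> real" where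
  "wdev1 c d k y = (\<Sum>s\<in>UNIV. c s d k * pd s f y + (\<Sum>e\<in>UNIV. c s d e * y $ e) * pd s (pd k f) y)"

lemma has_pd_wdev:
  assumes "y \<in> U"
  shows "has_pd k (wdev c d) (wdev1 c d k y) y"
proof -
  have "has_pd k (wdev c d)
      (\<Sum>s\<in>UNIV. c s d k * pd s f y + (\<Sum>e\<in>UNIV. c s d e * y $ e) * pd k (pd s f) y) y"
    unfolding wdev_def by (intro has_pd_sum has_pd_mult has_pd_linear has_pd_pd assms)
  then show ?thesis by (simp add: wdev1_def pd2_sym[OF assms, of k])
qed

lemma has_pd_wdev1:
  assumes "y \<in> U"
  shows "has_pd b (wdev1 c d k) (\<Sum>s\<in>UNIV. c s d k * pd s (pd b f) y + c s d b * pd s (pd k f) y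
    + (\<Sum>e\<in>UNIV. c s d e * y $ e) * pd s (pd b (pd k f)) y) y"
proof -
  have "has_pd b (wdev1 c d k) (\<Sum>s\<in>UNIV. c s d k * pd b (pd s f) y + (c s d b * pd s (pd k f) y
    + (\<Sum>e\<in>UNIV. c s d e * y $ e) * pd b (pd s (pd k f)) y)) y"
    unfolding wdev1_def
    by (intro has_pd_sum has_pd_add has_pd_cmult has_pd_mult has_pd_linear has_pd_pd has_pd_pd2 assms)
  then show ?thesis by (simp add: pd2_sym[OF assms, of b] pd3_swap12[OF assms, of b] add.assoc)
qed

text \<open>Differentiating the lowered equation instead of \<open>dev\<close> itself keeps
  derivatives of the inverse metric out of the computation.\<close>

lemma lower_dev1:
  assumes "y \<in> U"
  shows "(\<Sum>r\<in>UNIV. pd d (pd r (pd k f)) y * dev c r y + pd d (pd r f) y * pd k (dev c r) y) = wdev1 c d k y / 2"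
proof -
  have "has_pd k (\<lambda>z. \<Sum>r\<in>UNIV. pd d (pd r f) z * dev c r z)
      (\<Sum>r\<in>UNIV. pd k (pd d (pd r f)) y * dev c r y + pd d (pd r f) y * pd k (dev c r) y) y"
    by (intro has_pd_intros has_pd_pd2 has_pd_dev assms)
  then have "has_pd k (\<lambda>z. 1/2 * wdev c d z)
      (\<Sum>r\<in>UNIV. pd k (pd d (pd r f)) y * dev c r y + pd d (pd r f) y * pd k (dev c r) y) y"
    using has_pd_cong[OF open_U assms lower_dev] by simp
  moreover have "has_pd k (\<lambda>z. 1/2 * wdev c d z) (1/2 * wdev1 c d k y) y"
    by (intro has_pd_cmult has_pd_wdev assms)
  moreover have "pd k (pd d (pd r f)) y = pd d (pd r (pd k f)) y" for r
    using pd3_swap12[OF assms, of k d r] pd3_swap23[OF assms, of d k r] by simp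
  ultimately show ?thesis using has_pd_unique by fastforce
qed

lemma lower_dev2:
  assumes "y \<in> U"
  shows "(\<Sum>r\<in>UNIV. pd d (pd r (pd b (pd k f))) y * dev c r y + pd d (pd r (pd b f)) y * pd k (dev c r) y
      + pd d (pd r (pd k f)) y * pd b (dev c r) y + pd d (pd r f) y * pd b (pd k (dev c r)) y)
    = (\<Sum>s\<in>UNIV. c s d k * pd s (pd b f) y + c s d b * pd s (pd k f) y
      + (\<Sum>e\<in>UNIV. c s d e * y $ e) * pd s (pd b (pd k f)) y) / 2"
    (is "_ = ?R / 2")
proof -
  let ?L = "\<Sum>r\<in>UNIV. (pd b (pd d (pd r (pd k f))) y * dev c r y + pd d (pd r (pd k f)) y * pd b (dev c r) y)
      + (pd b (pd d (pd r f)) y * pd k (dev c r) y + pd d (pd r f) y * pd b (pd k (dev c r)) y)"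
  have "has_pd b (\<lambda>z. \<Sum>r\<in>UNIV. pd d (pd r (pd k f)) z * dev c r z + pd d (pd r f) z * pd k (dev c r) z) ?L y"
    by (intro has_pd_intros has_pd_pd2 has_pd_pd3 has_pd_dev has_pd_pd_dev assms)
  then have "has_pd b (\<lambda>z. 1/2 * wdev1 c d k z) ?L y"
    using has_pd_cong[OF open_U assms lower_dev1] by simp
  moreover have "has_pd b (\<lambda>z. 1/2 * wdev1 c d k z) (1/2 * ?R) y"
    by (intro has_pd_cmult has_pd_wdev1 assms)
  ultimately have "?L = 1/2 * ?R" by (rule has_pd_unique)
  moreover have "pd b (pd d (pd r f)) y = pd d (pd r (pd b f)) y"
    "pd b (pd d (pd r (pd k f))) y = pd d (pd r (pd b (pd k f))) y" for r
    using pd3_swap12[OF assms, of b d r] pd3_swap23[OF assms, of d b r]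
      pd4_swap12[OF assms, of b d r k] pd4_swap23[OF assms, of d b r k] by simp_all
  ultimately show ?thesis by (simp add: algebra_simps)
qed

lemma pd_mean_cartan:
  assumes "y \<in> U"
  shows "pd k (\<lambda>z. mean_cartan f z r) y = 1/2 * (\<Sum>a\<in>UNIV. \<Sum>b\<in>UNIV.
    inv_metric f y $ a $ b * pd r (pd a (pd b (pd k f))) y
    - (\<Sum>p\<in>UNIV. \<Sum>q\<in>UNIV. inv_metric f y $ a $ p * pd p (pd q (pd k f)) y * inv_metric f y $ q $ b)
      * pd r (pd a (pd b f)) y)"
proof -
  have "has_pd k (\<lambda>z. mean_cartan f z r) (\<Sum>a\<in>UNIV. \<Sum>b\<in>UNIV.
      pd k (\<lambda>z. inv_metric f z $ a $ b) y * (1/2 * pd r (pd a (pd b f)) y)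
      + inv_metric f y $ a $ b * (1/2 * pd k (pd r (pd a (pd b f))) y)) y"
    unfolding mean_cartan_def cartan_def
    by (intro has_pd_sum has_pd_mult has_pd_cmult has_pd_inv_metric has_pd_pd3 assms)
  moreover have "pd k (pd r (pd a (pd b f))) y = pd r (pd a (pd b (pd k f))) y" for a b
    using pd4_swap12[OF assms, of k r a b] pd4_swap23[OF assms, of r k a b] pd4_swap34[OF assms, of r a k b]
    by simp
  ultimately have "pd k (\<lambda>z. mean_cartan f z r) y = (\<Sum>a\<in>UNIV. \<Sum>b\<in>UNIV.
      pd k (\<lambda>z. inv_metric f z $ a $ b) y * (1/2 * pd r (pd a (pd b f)) y)
      + inv_metric f y $ a $ b * (1/2 * pd r (pd a (pd b (pd k f))) y))"
    by (simp add: has_pd_imp_pd)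
  then show ?thesis
    unfolding sum_distrib_left[of "1/2"] pd_inv_metric[OF assms]
    by (simp add: algebra_simps)
qed

lemma lower_pd_mean_cartan_up:
  assumes "y \<in> U"
  shows "(\<Sum>m\<in>UNIV. pd r (pd m (pd k f)) y * mean_cartan_up f y m
    + pd r (pd m f) y * pd k (\<lambda>z. mean_cartan_up f z m) y) = pd k (\<lambda>z. mean_cartan f z r) y"
proof -
  have "has_pd k (\<lambda>z. \<Sum>m\<in>UNIV. pd r (pd m f) z * mean_cartan_up f z m)
      (\<Sum>m\<in>UNIV. pd k (pd r (pd m f)) y * mean_cartan_up f y m
        + pd r (pd m f) y * pd k (\<lambda>z. mean_cartan_up f z m) y) y"
    by (intro has_pd_intros has_pd_pd2 Ck_on_has_pd[OF mean_cartan_up_C1] assms) simp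
  then have "has_pd k (\<lambda>z. mean_cartan f z r)
      (\<Sum>m\<in>UNIV. pd k (pd r (pd m f)) y * mean_cartan_up f y m
        + pd r (pd m f) y * pd k (\<lambda>z. mean_cartan_up f z m) y) y"
    using has_pd_cong[OF open_U assms lower_mean_cartan_up] by simp
  moreover have "pd k (pd r (pd m f)) y = pd r (pd m (pd k f)) y" for m
    using pd3_swap12[OF assms, of k r m] pd3_swap23[OF assms, of r k m] by simp
  ultimately show ?thesis using has_pd_imp_pd by fastforce
qed

lemma deviation_jet:
  assumes "y \<in> U" and "\<And>s d e. c s d e = - c s e d"
  shows "deviation_jet (\<lambda>a b. pd a (pd b f) y) (\<lambda>a b. inv_metric f y $ a $ b)
    (\<lambda>a b c. pd a (pd b (pd c f)) y) (\<lambda>a b c d. pd a (pd b (pd c (pd d f))) y) (($) y) c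
    (\<lambda>r. dev c r y) (\<lambda>r k. pd k (dev c r) y) (\<lambda>r b k. pd b (pd k (dev c r)) y)
    (\<lambda>k r. pd k (\<lambda>z. mean_cartan f z r) y) (\<lambda>k m. pd k (\<lambda>z. mean_cartan_up f z m) y)"
proof -
  interpret fibre_tensors "\<lambda>a b. pd a (pd b f) y" "\<lambda>a b. inv_metric f y $ a $ b"
    "\<lambda>a b c. pd a (pd b (pd c f)) y" "\<lambda>a b c d. pd a (pd b (pd c (pd d f))) y" "($) y"
    by (rule fibre_tensors[OF assms(1)])
  interpret deviation "\<lambda>a b. pd a (pd b f) y" "\<lambda>a b. inv_metric f y $ a $ b"
    "\<lambda>a b c. pd a (pd b (pd c f)) y" "\<lambda>a b c d. pd a (pd b (pd c (pd d f))) y" "($) y" c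
    "\<lambda>r. dev c r y" "\<lambda>r k. pd k (dev c r) y" "\<lambda>r b k. pd b (pd k (dev c r)) y"
    by unfold_locales (rule assms(2))
  note defs = fibre_tensors_defs[OF assms(1)]
  show ?thesis
  proof unfold_locales
    show "(\<Sum>r\<in>UNIV. pd d (pd r f) y * dev c r y) = W d / 2" for d
      unfolding lower_dev[OF assms(1)] W_def K_def defs by (simp add: wdev_def y_low_def)
    show "(\<Sum>r\<in>UNIV. pd d (pd r (pd k f)) y * dev c r y + pd d (pd r f) y * pd k (dev c r) y) = W1 d k / 2" for d k
      unfolding lower_dev1[OF assms(1)] W1_def K_def defs by (simp add: wdev1_def y_low_def)
    show "(\<Sum>r\<in>UNIV. pd d (pd r (pd b (pd k f))) y * dev c r y + pd d (pd r (pd b f)) y * pd k (dev c r) y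
      + pd d (pd r (pd k f)) y * pd b (dev c r) y + pd d (pd r f) y * pd b (pd k (dev c r)) y) = W2 d b k / 2" for d b k
      unfolding lower_dev2[OF assms(1)] W2_def K_def ..
    show "pd k (\<lambda>z. mean_cartan f z r) y = 1/2 * (\<Sum>a\<in>UNIV. \<Sum>b\<in>UNIV.
        inv_metric f y $ a $ b * pd r (pd a (pd b (pd k f))) y - TT k a b * pd r (pd a (pd b f)) y)" for k r
      unfolding pd_mean_cartan[OF assms(1)] TT_def ..
    show "(\<Sum>m\<in>UNIV. pd r (pd m (pd k f)) y * Iu m + pd r (pd m f) y * pd k (\<lambda>z. mean_cartan_up f z m) y)
        = pd k (\<lambda>z. mean_cartan f z r) y" for r k
      unfolding defs by (rule lower_pd_mean_cartan_up[OF assms(1)])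
    show "(\<Sum>a\<in>UNIV. y $ a * pd a (pd b (pd k f)) y) = 0" for b k
      by (rule euler2[OF assms(1)])
    show "(\<Sum>a\<in>UNIV. y $ a * pd a (pd b (pd k (pd l f))) y) = - pd b (pd k (pd l f)) y" for b k l
      by (rule euler3[OF assms(1)])
  qed
qed

section \<open>The relation y_r Q^r = 0 and its derivatives\<close>

lemma wdev_along:
  assumes "\<And>s d e. c s d e = - c s e d"
  shows "(\<Sum>d\<in>UNIV. y $ d * wdev c d y) = 0"
proof -
  have "(\<Sum>d\<in>UNIV. y $ d * (\<Sum>e\<in>UNIV. c s d e * y $ e)) = 0" for s
  proof -
    have "(\<Sum>d\<in>UNIV. y $ d * (\<Sum>e\<in>UNIV. c s d e * y $ e)) = (\<Sum>d\<in>UNIV. \<Sum>e\<in>UNIV. (y $ d * y $ e) * c s d e)"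
      by (simp add: sum_distrib_left mult_ac)
    also have "\<dots> = 0"
      by (rule sum_sym_antisym[OF mult.commute assms])
    finally show ?thesis .
  qed
  moreover have "(\<Sum>d\<in>UNIV. y $ d * wdev c d y)
      = (\<Sum>s\<in>UNIV. (\<Sum>d\<in>UNIV. y $ d * (\<Sum>e\<in>UNIV. c s d e * y $ e)) * pd s f y)"
    unfolding wdev_def sum_distrib_left[of "y $ _"] sum_distrib_right[of _ _ "pd _ f y"]
    by (rule trans[OF sum.swap]) (simp add: sum_distrib_left mult_ac)
  ultimately show ?thesis by simp
qed

text \<open>By Euler's relation the lowered y is the metric applied to y, so the contraction is half
  of y^a W_a, where c meets y in both lower indices.\<close>

lemma y_low_dev:
  assumes "\<And>s d e. c s d e = - c s e d" and "y \<in> U"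
  shows "(\<Sum>r\<in>UNIV. pd r f y * dev c r y) = 0"
proof -
  have "(\<Sum>r\<in>UNIV. pd r f y * dev c r y) = (\<Sum>a\<in>UNIV. y $ a * (\<Sum>r\<in>UNIV. pd a (pd r f) y * dev c r y))"
    unfolding euler1[OF assms(2), symmetric] sum_distrib_left sum_distrib_right
    by (rule trans[OF sum.swap]) (simp add: mult_ac)
  also have "\<dots> = (\<Sum>a\<in>UNIV. y $ a * wdev c a y) / 2"
    by (simp add: lower_dev[OF assms(2)] sum_divide_distrib)
  finally show ?thesis by (simp add: wdev_along[OF assms(1)])
qed

lemma y_low_dev1:
  assumes "\<And>s d e. c s d e = - c s e d" and "y \<in> U"
  shows "(\<Sum>r\<in>UNIV. pd k (pd r f) y * dev c r y + pd r f y * pd k (dev c r) y) = 0"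
proof -
  have "has_pd k (\<lambda>z. \<Sum>r\<in>UNIV. pd r f z * dev c r z)
      (\<Sum>r\<in>UNIV. pd k (pd r f) y * dev c r y + pd r f y * pd k (dev c r) y) y"
    by (intro has_pd_sum has_pd_mult has_pd_pd has_pd_dev assms(2))
  then have "has_pd k (\<lambda>z. 0)
      (\<Sum>r\<in>UNIV. pd k (pd r f) y * dev c r y + pd r f y * pd k (dev c r) y) y"
    using has_pd_cong[OF open_U assms(2) y_low_dev[OF assms(1)]] by simp
  then show ?thesis using has_pd_unique has_pd_const by blast
qed

text \<open>The right-hand side contains only first derivatives of \<open>dev\<close> and third
  derivatives of f, so it is of class C^1 although the second derivatives on the left are merely
  continuous.\<close>

lemma y_low_dev2:
  assumes "\<And>s d e. c s d e = - c s e d" and "y \<in> U"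
  shows "(\<Sum>r\<in>UNIV. pd r f y * pd j (pd k (dev c r)) y)
    = - (\<Sum>r\<in>UNIV. pd j (pd k (pd r f)) y * dev c r y + pd k (pd r f) y * pd j (dev c r) y
        + pd j (pd r f) y * pd k (dev c r) y)"
proof -
  let ?L = "\<Sum>r\<in>UNIV. (pd j (pd k (pd r f)) y * dev c r y + pd k (pd r f) y * pd j (dev c r) y)
    + (pd j (pd r f) y * pd k (dev c r) y + pd r f y * pd j (pd k (dev c r)) y)"
  have "has_pd j (\<lambda>z. \<Sum>r\<in>UNIV. pd k (pd r f) z * dev c r z + pd r f z * pd k (dev c r) z) ?L y"
    by (intro has_pd_sum has_pd_add has_pd_mult has_pd_pd has_pd_pd2 has_pd_dev has_pd_pd_dev assms(2))
  then have "has_pd j (\<lambda>z. 0) ?L y"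
    using has_pd_cong[OF open_U assms(2) y_low_dev1[OF assms(1)]] by simp
  then have "?L = 0" using has_pd_unique has_pd_const by blast
  then show ?thesis by (simp add: sum.distrib)
qed

lemma has_pd_y_low_dev2:
  assumes "\<And>s d e. c s d e = - c s e d" and "y \<in> U"
  shows "has_pd a (\<lambda>z. \<Sum>r\<in>UNIV. pd r f z * pd j (pd k (dev c r)) z)
    (- 1 * (\<Sum>r\<in>UNIV. ((pd a (pd j (pd k (pd r f))) y * dev c r y + pd j (pd k (pd r f)) y * pd a (dev c r) y)
      + (pd a (pd k (pd r f)) y * pd j (dev c r) y + pd k (pd r f) y * pd a (pd j (dev c r)) y))
      + (pd a (pd j (pd r f)) y * pd k (dev c r) y + pd j (pd r f) y * pd a (pd k (dev c r)) y))) y"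
proof -
  have "has_pd a (\<lambda>z. - 1 * (\<Sum>r\<in>UNIV. pd j (pd k (pd r f)) z * dev c r z + pd k (pd r f) z * pd j (dev c r) z
        + pd j (pd r f) z * pd k (dev c r) z))
    (- 1 * (\<Sum>r\<in>UNIV. ((pd a (pd j (pd k (pd r f))) y * dev c r y + pd j (pd k (pd r f)) y * pd a (dev c r) y)
      + (pd a (pd k (pd r f)) y * pd j (dev c r) y + pd k (pd r f) y * pd a (pd j (dev c r)) y))
      + (pd a (pd j (pd r f)) y * pd k (dev c r) y + pd j (pd r f) y * pd a (pd k (dev c r)) y))) y"
    by (intro has_pd_cmult has_pd_sum has_pd_add has_pd_mult has_pd_pd2 has_pd_pd3 has_pd_dev
        has_pd_pd_dev assms(2))
  then show ?thesis
    using has_pd_cong[OF open_U assms(2) y_low_dev2[OF assms(1)]] by simp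
qed

text \<open>The counterpart of \<open>Lsum\<close> for functions: where third derivatives of
  \<open>dev\<close> exist, it is minus their contraction with the lowered y.\<close>

definition lsum :: "('n \<Rightarrow> 'n \<Rightarrow> 'n \<Rightarrow> real) \<Rightarrow> 'n \<Rightarrow> 'n \<Rightarrow> 'n \<Rightarrow> real^'n \<Rightarrow> real" where
  "lsum c a b e y = (\<Sum>r\<in>UNIV. pd r (pd a f) y * pd b (pd e (dev c r)) y
     + pd r (pd b f) y * pd a (pd e (dev c r)) y + pd r (pd e f) y * pd a (pd b (dev c r)) y
     + pd r (pd a (pd b f)) y * pd e (dev c r) y + pd r (pd a (pd e f)) y * pd b (dev c r) y
     + pd r (pd b (pd e f)) y * pd a (dev c r) y + pd r (pd a (pd b (pd e f))) y * dev c r y)"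

text \<open>Formally the product rule, with -\<open>lsum\<close> in place of the lowered y
  contracted with third derivatives of \<open>dev\<close>; the proof never forms such
  derivatives.\<close>

lemma pd_y_low_dev2:
  assumes "\<And>s d e. c s d e = - c s e d" and "y \<in> U"
  shows "pd a (\<lambda>z. \<Sum>r\<in>UNIV. pd r f z * pd j (pd k (dev c r)) z) y
    = (\<Sum>r\<in>UNIV. pd a (pd r f) y * pd j (pd k (dev c r)) y) - lsum c a j k y"
proof -
  have g: "pd a (pd r f) y = pd r (pd a f) y" for a r
    using pd2_sym[OF assms(2)] .
  have T: "pd a (pd j (pd r f)) y = pd r (pd a (pd j f)) y" for a j r
    using pd3_swap12[OF assms(2), of r a j] pd3_swap23[OF assms(2), of a j r] by simp
  have F: "pd a (pd j (pd k (pd r f))) y = pd r (pd a (pd j (pd k f))) y" for r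
    using pd4_swap12[OF assms(2), of r a j k] pd4_swap23[OF assms(2), of a j r k]
      pd4_swap34[OF assms(2), of a j k r] by simp
  have L: "(\<Sum>r\<in>UNIV. pd a (pd r f) y * pd j (pd k (dev c r)) y) - lsum c a j k y
    = - 1 * (\<Sum>r\<in>UNIV. ((pd a (pd j (pd k (pd r f))) y * dev c r y + pd j (pd k (pd r f)) y * pd a (dev c r) y)
      + (pd a (pd k (pd r f)) y * pd j (dev c r) y + pd k (pd r f) y * pd a (pd j (dev c r)) y))
      + (pd a (pd j (pd r f)) y * pd k (dev c r) y + pd j (pd r f) y * pd a (pd k (dev c r)) y))"
    unfolding lsum_def sum_subtractf[symmetric] sum_distrib_left
    by (intro sum.cong refl) (simp add: F T g[of _ r for r] algebra_simps)
  show ?thesis unfolding L by (rule has_pd_imp_pd[OF has_pd_y_low_dev2[OF assms]])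
qed

subsection \<open>Change of coordinates\<close>

lemma has_pd_compose:
  assumes "Ck_on 1 w U" "D *v z \<in> U"
  shows "has_pd i (\<lambda>z. w (D *v z)) (\<Sum>a\<in>UNIV. D $ a $ i * pd a w (D *v z)) z"
  by (rule has_pd_compose_matrix[OF Ck_on_differentiable[OF assms(1) _ assms(2)]]) simp

lemma open_vimage_U: "open {z. D *v z \<in> U}"
  using open_vimage[OF open_U, of "\<lambda>z. D *v z"]
  by (simp add: vimage_def linear_continuous_on matrix_vector_mul_bounded_linear)

text \<open>The third derivatives of the spray are only assumed to exist in the coordinate directions, so
  they cannot be transformed to the frame one by one. Their contraction with \<open>y_low\<close> differs from a
  derivative of the \<open>C^1\<close> functions \<open>\<Sum>r. pd r f * pd j (pd k (dev c r))\<close> by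
  derivatives of lower order, and those transform.\<close>

lemma berwald_lowered:
  fixes D E :: "real^'n^'n"
  assumes DE: "D ** E = mat 1"
    and c: "\<And>s d e. c s d e = - c s e d"
    and \<eta>: "D *v \<eta> \<in> U"
    and spray: "\<And>z \<mu>. D *v z \<in> U \<Longrightarrow> spray \<L> \<xi> z \<mu>
      = (\<Sum>k\<in>UNIV. \<Sum>l\<in>UNIV. B \<mu> k l * (z $ k * z $ l)) + (\<Sum>r\<in>UNIV. E $ \<mu> $ r * dev c r (D *v z))"
    and exists: "berwald_exists \<L> \<xi> \<eta>"
  shows "(\<Sum>\<mu>\<in>UNIV. (\<Sum>s\<in>UNIV. pd s f (D *v \<eta>) * D $ s $ \<mu>) * berwald \<L> \<xi> \<eta> \<mu> \<alpha> \<beta> \<gamma>)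
    = - (\<Sum>k\<in>UNIV. D $ k $ \<gamma> * (\<Sum>j\<in>UNIV. D $ j $ \<beta> * (\<Sum>a\<in>UNIV. D $ a $ \<alpha> * lsum c a j k (D *v \<eta>))))"
proof -
  let ?V = "{z. D *v z \<in> U}"
  define H where "H \<mu> z = (\<Sum>s\<in>UNIV. pd s f (D *v z) * D $ s $ \<mu>)" for \<mu> z
  define H' where "H' \<mu> = (\<Sum>s\<in>UNIV. (\<Sum>a\<in>UNIV. D $ a $ \<alpha> * pd a (pd s f) (D *v \<eta>)) * D $ s $ \<mu>)" for \<mu>
  define X where "X r z = (\<Sum>k\<in>UNIV. D $ k $ \<gamma> * (\<Sum>j\<in>UNIV. D $ j $ \<beta> * pd j (pd k (dev c r)) (D *v z)))" for r z
  define S2 where "S2 \<mu> = pd \<beta> (pd \<gamma> (\<lambda>z. spray \<L> \<xi> z \<mu>))" for \<mu>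
  \<comment> \<open>Second derivative of the quadratic part, a constant that the third
    differentiation removes.\<close>
  define q where "q \<mu> = B \<mu> \<gamma> \<beta> + B \<mu> \<beta> \<gamma>" for \<mu>
  have spray1: "pd \<gamma> (\<lambda>z. spray \<L> \<xi> z \<mu>) z = (\<Sum>l\<in>UNIV. (B \<mu> \<gamma> l + B \<mu> l \<gamma>) * z $ l)
      + (\<Sum>r\<in>UNIV. E $ \<mu> $ r * (\<Sum>k\<in>UNIV. D $ k $ \<gamma> * pd k (dev c r) (D *v z)))" if "z \<in> ?V" for z \<mu>
  proof (rule has_pd_imp_pd)
    have "has_pd \<gamma> (\<lambda>z. (\<Sum>k\<in>UNIV. \<Sum>l\<in>UNIV. B \<mu> k l * (z $ k * z $ l)) + (\<Sum>r\<in>UNIV. E $ \<mu> $ r * dev c r (D *v z)))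
      ((\<Sum>l\<in>UNIV. (B \<mu> \<gamma> l + B \<mu> l \<gamma>) * z $ l)
      + (\<Sum>r\<in>UNIV. E $ \<mu> $ r * (\<Sum>k\<in>UNIV. D $ k $ \<gamma> * pd k (dev c r) (D *v z)))) z"
      using that by (intro has_pd_add has_pd_quadratic has_pd_sum has_pd_cmult has_pd_compose
          Ck_on_le[OF dev_C2]) simp_all
    then show "has_pd \<gamma> (\<lambda>z. spray \<L> \<xi> z \<mu>) ((\<Sum>l\<in>UNIV. (B \<mu> \<gamma> l + B \<mu> l \<gamma>) * z $ l)
      + (\<Sum>r\<in>UNIV. E $ \<mu> $ r * (\<Sum>k\<in>UNIV. D $ k $ \<gamma> * pd k (dev c r) (D *v z)))) z"
      using has_pd_cong[OF open_vimage_U that, of "\<lambda>z. spray \<L> \<xi> z \<mu>"] spray by simp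
  qed
  have spray2: "S2 \<mu> z = q \<mu> + (\<Sum>r\<in>UNIV. E $ \<mu> $ r * X r z)" if "z \<in> ?V" for z \<mu>
    unfolding S2_def
  proof (rule has_pd_imp_pd)
    have "has_pd \<beta> (\<lambda>z. (\<Sum>l\<in>UNIV. (B \<mu> \<gamma> l + B \<mu> l \<gamma>) * z $ l)
        + (\<Sum>r\<in>UNIV. E $ \<mu> $ r * (\<Sum>k\<in>UNIV. D $ k $ \<gamma> * pd k (dev c r) (D *v z))))
      (q \<mu> + (\<Sum>r\<in>UNIV. E $ \<mu> $ r * X r z)) z"
      unfolding q_def X_def using that
      by (intro has_pd_add has_pd_linear has_pd_sum has_pd_cmult has_pd_compose pd_dev_C1) simp_all
    then show "has_pd \<beta> (pd \<gamma> (\<lambda>z. spray \<L> \<xi> z \<mu>)) (q \<mu> + (\<Sum>r\<in>UNIV. E $ \<mu> $ r * X r z)) z"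
      using has_pd_cong[OF open_vimage_U that spray1] by simp
  qed
  have lowered: "(\<Sum>\<mu>\<in>UNIV. G \<mu> * (\<Sum>r\<in>UNIV. E $ \<mu> $ r * x r)) = (\<Sum>r\<in>UNIV. F r * x r)"
    if "\<And>\<mu>. G \<mu> = (\<Sum>s\<in>UNIV. F s * D $ s $ \<mu>)" for G F x
  proof -
    have "(\<Sum>\<mu>\<in>UNIV. G \<mu> * (\<Sum>r\<in>UNIV. E $ \<mu> $ r * x r)) = (\<Sum>r\<in>UNIV. (\<Sum>\<mu>\<in>UNIV. G \<mu> * E $ \<mu> $ r) * x r)"
      unfolding sum_distrib_left sum_distrib_right by (rule trans[OF sum.swap]) (simp add: mult_ac)
    then show ?thesis by (simp only: that sum_transform_inverse[OF DE])
  qed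
  have pull: "(\<Sum>r\<in>UNIV. F r * (\<Sum>k\<in>UNIV. D $ k $ \<gamma> * (\<Sum>j\<in>UNIV. D $ j $ \<beta> * Z r j k)))
      = (\<Sum>k\<in>UNIV. D $ k $ \<gamma> * (\<Sum>j\<in>UNIV. D $ j $ \<beta> * (\<Sum>r\<in>UNIV. F r * Z r j k)))" for F Z
  proof -
    have "(\<Sum>r\<in>UNIV. F r * (\<Sum>k\<in>UNIV. D $ k $ \<gamma> * (\<Sum>j\<in>UNIV. D $ j $ \<beta> * Z r j k)))
        = (\<Sum>k\<in>UNIV. D $ k $ \<gamma> * (\<Sum>r\<in>UNIV. F r * (\<Sum>j\<in>UNIV. D $ j $ \<beta> * Z r j k)))"
      unfolding sum_distrib_left[of "F _"] sum_distrib_left[of "D $ _ $ \<gamma>"]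
      by (rule trans[OF sum.swap]) (simp add: sum_distrib_left mult_ac)
    moreover have "(\<Sum>r\<in>UNIV. F r * (\<Sum>j\<in>UNIV. D $ j $ \<beta> * Z r j k))
        = (\<Sum>j\<in>UNIV. D $ j $ \<beta> * (\<Sum>r\<in>UNIV. F r * Z r j k))" for k
      unfolding sum_distrib_left by (rule trans[OF sum.swap]) (simp add: mult_ac)
    ultimately show ?thesis by simp
  qed
  let ?u = "\<lambda>j k w. \<Sum>r\<in>UNIV. pd r f w * pd j (pd k (dev c r)) w"
  have eq: "(\<Sum>\<mu>\<in>UNIV. H \<mu> z * (S2 \<mu> z - q \<mu>))
      = (\<Sum>k\<in>UNIV. D $ k $ \<gamma> * (\<Sum>j\<in>UNIV. D $ j $ \<beta> * ?u j k (D *v z)))" if "z \<in> ?V" for z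
    unfolding spray2[OF that] pull[symmetric] using lowered[OF H_def] by (simp add: X_def)
  \<comment> \<open>The function in \<open>eq\<close> is now differentiated in two ways. On this
    side the product rule applies, since the hypothesis \<open>exists\<close> supplies the
    derivative of \<open>S2\<close> in the direction needed.\<close>
  have "has_pd \<alpha> (\<lambda>z. \<Sum>\<mu>\<in>UNIV. H \<mu> z * (S2 \<mu> z - q \<mu>))
      (\<Sum>\<mu>\<in>UNIV. H' \<mu> * (S2 \<mu> \<eta> - q \<mu>) + H \<mu> \<eta> * (berwald \<L> \<xi> \<eta> \<mu> \<alpha> \<beta> \<gamma> - 0)) \<eta>"
  proof (intro has_pd_sum has_pd_mult has_pd_diff has_pd_const)
    have "has_pd \<alpha> (\<lambda>z. \<Sum>s\<in>UNIV. D $ s $ \<mu> * pd s f (D *v z))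
        (\<Sum>s\<in>UNIV. D $ s $ \<mu> * (\<Sum>a\<in>UNIV. D $ a $ \<alpha> * pd a (pd s f) (D *v \<eta>))) \<eta>" for \<mu>
      by (intro has_pd_sum has_pd_cmult has_pd_compose Ck_on_le[OF pd_C3] \<eta>) simp
    then show "has_pd \<alpha> (H \<mu>) (H' \<mu>) \<eta>" for \<mu>
      by (simp add: H_def[abs_def] H'_def mult.commute)
    show "has_pd \<alpha> (S2 \<mu>) (berwald \<L> \<xi> \<eta> \<mu> \<alpha> \<beta> \<gamma>) \<eta>" for \<mu>
      using exists by (simp add: berwald_exists_def pderiv_exists_has_pd berwald_def S2_def)
  qed
  then have "has_pd \<alpha> (\<lambda>z. \<Sum>k\<in>UNIV. D $ k $ \<gamma> * (\<Sum>j\<in>UNIV. D $ j $ \<beta> * ?u j k (D *v z)))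
      (\<Sum>\<mu>\<in>UNIV. H' \<mu> * (S2 \<mu> \<eta> - q \<mu>) + H \<mu> \<eta> * (berwald \<L> \<xi> \<eta> \<mu> \<alpha> \<beta> \<gamma> - 0)) \<eta>"
    by (rule has_pd_transform[where S = ?V]) (simp_all only: open_vimage_U \<eta> eq mem_Collect_eq)
  moreover have "has_pd \<alpha> (\<lambda>z. \<Sum>k\<in>UNIV. D $ k $ \<gamma> * (\<Sum>j\<in>UNIV. D $ j $ \<beta> * ?u j k (D *v z)))
      (\<Sum>k\<in>UNIV. D $ k $ \<gamma> * (\<Sum>j\<in>UNIV. D $ j $ \<beta> * (\<Sum>a\<in>UNIV. D $ a $ \<alpha> * pd a (?u j k) (D *v \<eta>)))) \<eta>"
  proof -
    \<comment> \<open>On the other side the chain rule through D demands differentiability, which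
      the form given by \<open>y_low_dev2\<close> has.\<close>
    have "Ck_on 1 (\<lambda>w. - 1 * (\<Sum>r\<in>UNIV. pd j (pd k (pd r f)) w * dev c r w + pd k (pd r f) w * pd j (dev c r) w
        + pd j (pd r f) w * pd k (dev c r) w)) U" for j k
      by (intro Ck_on_mult Ck_on_const Ck_on_sum Ck_on_add open_U pd3_C1 pd_dev_C1
          Ck_on_le[OF dev_C2] Ck_on_le[OF pd2_C2]) simp_all
    then have "Ck_on 1 (?u j k) U" for j k
      by (rule Ck_on_transform[OF _ open_U]) (simp only: y_low_dev2[OF c] mult_minus1)
    then show ?thesis
      by (intro has_pd_sum has_pd_cmult has_pd_compose[of "?u _ _"] \<eta>)
  qed
  ultimately have "(\<Sum>\<mu>\<in>UNIV. H' \<mu> * (S2 \<mu> \<eta> - q \<mu>) + H \<mu> \<eta> * (berwald \<L> \<xi> \<eta> \<mu> \<alpha> \<beta> \<gamma> - 0))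
      = (\<Sum>k\<in>UNIV. D $ k $ \<gamma> * (\<Sum>j\<in>UNIV. D $ j $ \<beta> * (\<Sum>a\<in>UNIV. D $ a $ \<alpha> * pd a (?u j k) (D *v \<eta>))))"
    by (rule has_pd_unique)
  then have "(\<Sum>\<mu>\<in>UNIV. H \<mu> \<eta> * berwald \<L> \<xi> \<eta> \<mu> \<alpha> \<beta> \<gamma>)
      = (\<Sum>k\<in>UNIV. D $ k $ \<gamma> * (\<Sum>j\<in>UNIV. D $ j $ \<beta> * (\<Sum>a\<in>UNIV. D $ a $ \<alpha> * pd a (?u j k) (D *v \<eta>))))
        - (\<Sum>\<mu>\<in>UNIV. H' \<mu> * (S2 \<mu> \<eta> - q \<mu>))"
    by (simp add: sum.distrib)
  \<comment> \<open>This product matches the metric term in \<open>pd_y_low_dev2\<close>;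
    subtracting it leaves -\<open>lsum\<close>.\<close>
  also have "(\<Sum>\<mu>\<in>UNIV. H' \<mu> * (S2 \<mu> \<eta> - q \<mu>)) = (\<Sum>k\<in>UNIV. D $ k $ \<gamma> * (\<Sum>j\<in>UNIV. D $ j $ \<beta> *
      (\<Sum>a\<in>UNIV. D $ a $ \<alpha> * (\<Sum>r\<in>UNIV. pd a (pd r f) (D *v \<eta>) * pd j (pd k (dev c r)) (D *v \<eta>)))))"
  proof -
    have swap: "(\<Sum>r\<in>UNIV. (\<Sum>a\<in>UNIV. D $ a $ \<alpha> * pd a (pd r f) (D *v \<eta>)) * pd j (pd k (dev c r)) (D *v \<eta>))
      = (\<Sum>a\<in>UNIV. D $ a $ \<alpha> * (\<Sum>r\<in>UNIV. pd a (pd r f) (D *v \<eta>) * pd j (pd k (dev c r)) (D *v \<eta>)))" for j k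
      unfolding sum_distrib_left sum_distrib_right by (rule trans[OF sum.swap]) (simp add: mult_ac)
    have "(\<Sum>\<mu>\<in>UNIV. H' \<mu> * (S2 \<mu> \<eta> - q \<mu>))
        = (\<Sum>r\<in>UNIV. (\<Sum>a\<in>UNIV. D $ a $ \<alpha> * pd a (pd r f) (D *v \<eta>)) * X r \<eta>)"
      using spray2 \<eta> lowered[OF H'_def] by simp
    also have "\<dots> = (\<Sum>k\<in>UNIV. D $ k $ \<gamma> * (\<Sum>j\<in>UNIV. D $ j $ \<beta> *
      (\<Sum>r\<in>UNIV. (\<Sum>a\<in>UNIV. D $ a $ \<alpha> * pd a (pd r f) (D *v \<eta>)) * pd j (pd k (dev c r)) (D *v \<eta>))))"
      unfolding X_def pull ..
    finally show ?thesis unfolding swap .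
  qed
  finally show ?thesis
    unfolding H_def pd_y_low_dev2[OF c \<eta>]
    by (simp add: right_diff_distrib sum_subtractf)
qed

text \<open>The three factors D from \<open>berwald_lowered\<close> cancel against the three factors
  E of \<open>berwald_frame\<close>; the rest is reordering of sums.\<close>

lemma landsberg_eq:
  fixes D E :: "real^'n^'n"
  assumes DE: "D ** E = mat 1"
    and c: "\<And>s d e. c s d e = - c s e d"
    and \<eta>: "D *v \<eta> \<in> U"
    and spray: "\<And>z \<mu>. D *v z \<in> U \<Longrightarrow> spray \<L> \<xi> z \<mu>
      = (\<Sum>k\<in>UNIV. \<Sum>l\<in>UNIV. B \<mu> k l * (z $ k * z $ l)) + (\<Sum>r\<in>UNIV. E $ \<mu> $ r * dev c r (D *v z))"
    and exists: "berwald_exists \<L> \<xi> \<eta>"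
  shows "landsberg f \<L> E D \<xi> \<eta> a b e = 1/2 * lsum c a b e (D *v \<eta>)"
proof -
  let ?y = "D *v \<eta>"
  let ?P = "\<lambda>\<rho> \<alpha> \<beta> \<gamma>. berwald \<L> \<xi> \<eta> \<rho> \<alpha> \<beta> \<gamma>"
  have "(\<Sum>r\<in>UNIV. y_low f ?y r * berwald_frame \<L> E D \<xi> \<eta> r a b e)
      = (\<Sum>r\<in>UNIV. \<Sum>\<rho>\<in>UNIV. \<Sum>\<alpha>\<in>UNIV. \<Sum>\<beta>\<in>UNIV. \<Sum>\<gamma>\<in>UNIV.
        pd r f ?y * D $ r $ \<rho> * ?P \<rho> \<alpha> \<beta> \<gamma> * E $ \<gamma> $ e * E $ \<beta> $ b * E $ \<alpha> $ a)"
    by (simp add: berwald_frame_def y_low_def sum_distrib_left mult_ac)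
  also have "\<dots> = (\<Sum>\<rho>\<in>UNIV. \<Sum>\<alpha>\<in>UNIV. \<Sum>\<beta>\<in>UNIV. \<Sum>\<gamma>\<in>UNIV.
        ((\<Sum>r\<in>UNIV. pd r f ?y * D $ r $ \<rho>) * ?P \<rho> \<alpha> \<beta> \<gamma>) * E $ \<gamma> $ e * E $ \<beta> $ b * E $ \<alpha> $ a)"
    unfolding sum_distrib_right
    apply (rule trans[OF sum.swap], rule sum.cong[OF refl])
    apply (rule trans[OF sum.swap], rule sum.cong[OF refl])
    apply (rule trans[OF sum.swap], rule sum.cong[OF refl])
    by (rule sum.swap)
  also have "\<dots> = (\<Sum>\<alpha>\<in>UNIV. \<Sum>\<beta>\<in>UNIV. \<Sum>\<gamma>\<in>UNIV.
        (\<Sum>\<rho>\<in>UNIV. (\<Sum>r\<in>UNIV. pd r f ?y * D $ r $ \<rho>) * ?P \<rho> \<alpha> \<beta> \<gamma>) * E $ \<gamma> $ e * E $ \<beta> $ b * E $ \<alpha> $ a)"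
    apply (rule trans[OF sum.swap], rule sum.cong[OF refl])
    apply (rule trans[OF sum.swap], rule sum.cong[OF refl])
    by (rule trans[OF sum.swap]) (simp only: sum_distrib_right)
  also have "\<dots> = (\<Sum>\<alpha>\<in>UNIV. (\<Sum>\<beta>\<in>UNIV. (\<Sum>\<gamma>\<in>UNIV.
        (\<Sum>k\<in>UNIV. D $ k $ \<gamma> * (\<Sum>j\<in>UNIV. D $ j $ \<beta> * (\<Sum>i\<in>UNIV. D $ i $ \<alpha> * - lsum c i j k ?y)))
          * E $ \<gamma> $ e) * E $ \<beta> $ b) * E $ \<alpha> $ a)"
    by (simp only: berwald_lowered[OF DE c \<eta> spray exists] mult_minus_right sum_negf)
      (simp only: sum_distrib_right)
  also have "\<dots> = - lsum c a b e ?y"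
    unfolding sum_contract_inverse[OF DE] ..
  finally show ?thesis by (simp add: landsberg_def)
qed

section \<open>The metric and the spray in frame components\<close>

lemma pd_compose_matrix:
  assumes "D *v z \<in> U" and "\<And>x. D *v x \<in> U \<Longrightarrow> w x = f (D *v x)"
  shows "pd i w z = (\<Sum>a\<in>UNIV. D $ a $ i * pd a f (D *v z))"
proof (rule has_pd_imp_pd)
  have "has_pd i (\<lambda>x. f (D *v x)) (\<Sum>a\<in>UNIV. D $ a $ i * pd a f (D *v z)) z"
    by (rule has_pd_compose[OF Ck_on_le[OF f_C4] assms(1)]) simp
  then show "has_pd i w (\<Sum>a\<in>UNIV. D $ a $ i * pd a f (D *v z)) z"
    by (rule has_pd_transform[OF _ open_vimage_U[of D]]) (simp_all add: assms)
qed

lemma metric_tensor_compose: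
  fixes D :: "real^'n^'n"
  assumes "D *v z \<in> U" and "\<And>x. D *v x \<in> U \<Longrightarrow> w x = f (D *v x)"
  shows "metric_tensor w z = transpose D ** metric_tensor f (D *v z) ** D"
proof -
  have "pd i (pd j w) z = (\<Sum>a\<in>UNIV. D $ a $ j * (\<Sum>b\<in>UNIV. D $ b $ i * pd b (pd a f) (D *v z)))" for i j
  proof (rule has_pd_imp_pd)
    have "has_pd i (\<lambda>x. \<Sum>a\<in>UNIV. D $ a $ j * pd a f (D *v x))
        (\<Sum>a\<in>UNIV. D $ a $ j * (\<Sum>b\<in>UNIV. D $ b $ i * pd b (pd a f) (D *v z))) z"
      by (intro has_pd_sum has_pd_cmult has_pd_compose Ck_on_le[OF pd_C3] assms(1)) simp
    then show "has_pd i (pd j w) (\<Sum>a\<in>UNIV. D $ a $ j * (\<Sum>b\<in>UNIV. D $ b $ i * pd b (pd a f) (D *v z))) z"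
      by (rule has_pd_transform[OF _ open_vimage_U[of D]])
        (simp_all add: assms(1) pd_compose_matrix[OF _ assms(2)])
  qed
  then show ?thesis
    by (simp add: vec_eq_iff metric_tensor_def matrix_matrix_mult_def transpose_def
        sum_distrib_left sum_distrib_right mult_ac)
qed

lemma inv_metric_compose:
  fixes D E :: "real^'n^'n"
  assumes "D *v z \<in> U" and "\<And>x. D *v x \<in> U \<Longrightarrow> w x = f (D *v x)"
    and DE: "D ** E = mat 1" "E ** D = mat 1"
  shows "inv_metric w z $ i $ j
    = (\<Sum>a\<in>UNIV. E $ i $ a * (\<Sum>b\<in>UNIV. inv_metric f (D *v z) $ a $ b * E $ j $ b))"
proof -
  let ?g = "metric_tensor f (D *v z)" and ?gi = "inv_metric f (D *v z)"
  have g: "?g ** ?gi = mat 1" "?gi ** ?g = mat 1"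
    unfolding inv_metric_def by (rule matrix_inv_mult[OF nondegenerate[OF assms(1)]])+
  have tr: "transpose D ** transpose E = mat 1" "transpose E ** transpose D = mat 1"
    using DE by (metis matrix_transpose_mul transpose_mat)+
  have "matrix_inv (transpose D ** ?g ** D) = E ** ?gi ** transpose E"
  proof (rule matrix_inv_unique)
    show "transpose D ** ?g ** D ** (E ** ?gi ** transpose E) = mat 1"
      by (metis DE(1) g(1) tr(1) matrix_mul_assoc matrix_mul_rid)
    show "E ** ?gi ** transpose E ** (transpose D ** ?g ** D) = mat 1"
      by (metis DE(2) g(2) tr(2) matrix_mul_assoc matrix_mul_rid)
  qed
  then have "inv_metric w z = E ** ?gi ** transpose E"
    by (simp only: inv_metric_def[of w] metric_tensor_compose[OF assms(1,2)])
  then show ?thesis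
    by (simp add: matrix_matrix_mult_def transpose_def sum_distrib_left sum_distrib_right)
      (rule trans[OF sum.swap], simp add: mult_ac)
qed

text \<open>Differentiating f(D x z) in x only differentiates D. Where the first derivative of f
  remains, the derivatives of D occur antisymmetrized and \<open>comm\<close> applies; where the
  metric appears, it is cancelled by the inverse metric and a form in z with coefficients depending
  on x alone is left.\<close>

lemma spray_eq:
  fixes D :: "real^'n \<Rightarrow> real^'n^'n" and E :: "real^'n^'n"
  assumes N: "open N" "\<xi> \<in> N"
    and D: "\<And>a i. Ck_on 1 (\<lambda>x. D x $ a $ i) N"
    and \<L>: "\<And>x z. x \<in> N \<Longrightarrow> D x *v z \<in> U \<Longrightarrow> \<L> x z = f (D x *v z)"
    and DE: "D \<xi> ** E = mat 1" "E ** D \<xi> = mat 1"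
    and c: "\<And>s d e. c s d e = - c s e d"
    and comm: "\<And>a i j. pd i (\<lambda>x. D x $ a $ j) \<xi> - pd j (\<lambda>x. D x $ a $ i) \<xi>
      = - (\<Sum>e\<in>UNIV. \<Sum>d\<in>UNIV. c a e d * D \<xi> $ e $ i * D \<xi> $ d $ j)"
    and z: "D \<xi> *v z \<in> U"
  shows "spray \<L> \<xi> z \<mu> = (\<Sum>k\<in>UNIV. \<Sum>l\<in>UNIV.
        (1/2 * (\<Sum>b\<in>UNIV. E $ \<mu> $ b * pd k (\<lambda>x. D x $ b $ l) \<xi>)) * (z $ k * z $ l))
      + (\<Sum>r\<in>UNIV. E $ \<mu> $ r * dev c r (D \<xi> *v z))"
proof -
  let ?y = "D \<xi> *v z"
  define dD where "dD i a j = pd i (\<lambda>x. D x $ a $ j) \<xi>" for i a j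
  have curve: "Ck_on 1 (\<lambda>x. (D x *v z) $ a) N" for a
    by (simp only: matrix_vector_mult_def vec_lambda_beta)
      (intro Ck_on_sum Ck_on_mult N Ck_on_const D)
  have dcurve: "has_pd i (\<lambda>x. (D x *v z) $ a) (\<Sum>j\<in>UNIV. dD i a j * z $ j) \<xi>" for i a
  proof -
    have "has_pd i (\<lambda>x. \<Sum>j\<in>UNIV. z $ j * D x $ a $ j) (\<Sum>j\<in>UNIV. z $ j * dD i a j) \<xi>"
      unfolding dD_def by (intro has_pd_sum has_pd_cmult Ck_on_has_pd[OF D] N) simp
    then show ?thesis by (simp add: matrix_vector_mult_def mult.commute)
  qed
  \<comment> \<open>For fixed z, the base points at which z stays inside the cone; the x-derivatives
    of the function only see this neighbourhood.\<close>
  let ?M = "{x \<in> N. D x *v z \<in> U}"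
  have "continuous_on N (\<lambda>x. \<chi> a. (D x *v z) $ a)"
    using Ck_on_imp_continuous_on[OF curve] by (rule continuous_on_vec_lambda)
  then have M: "open ?M" "\<xi> \<in> ?M"
    using continuous_open_preimage[OF _ N(1) open_U, of "\<lambda>x. D x *v z"] N z
    by (simp_all add: vimage_def Int_def)
  have compose: "has_pd i (\<lambda>x. w (D x *v z)) (\<Sum>a\<in>UNIV. (\<Sum>j\<in>UNIV. dD i a j * z $ j) * pd a w ?y) \<xi>"
    if "w differentiable (at ?y)" for w i
    using has_pd_compose_curve[of w "\<lambda>x. D x *v z" \<xi> i] that Ck_on_differentiable[OF curve _ N(2)]
    by (simp add: has_pd_imp_pd[OF dcurve])
  have 1: "pd i (\<lambda>x. \<L> x z) \<xi> = (\<Sum>a\<in>UNIV. (\<Sum>j\<in>UNIV. dD i a j * z $ j) * pd a f ?y)" for i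
  proof (rule has_pd_imp_pd, rule has_pd_transform[OF _ M])
    show "has_pd i (\<lambda>x. f (D x *v z)) (\<Sum>a\<in>UNIV. (\<Sum>j\<in>UNIV. dD i a j * z $ j) * pd a f ?y) \<xi>"
      by (rule compose[OF Ck_on_differentiable[OF f_C4 _ z]]) simp
  qed (simp add: \<L>)
  have 2: "pd k (\<lambda>x. pd i (\<L> x) z) \<xi> = (\<Sum>a\<in>UNIV. dD k a i * pd a f ?y
      + D \<xi> $ a $ i * (\<Sum>b\<in>UNIV. (\<Sum>j\<in>UNIV. dD k b j * z $ j) * pd b (pd a f) ?y))" for i k
  proof (rule has_pd_imp_pd, rule has_pd_transform[OF _ M])
    show "has_pd k (\<lambda>x. \<Sum>a\<in>UNIV. D x $ a $ i * pd a f (D x *v z)) (\<Sum>a\<in>UNIV. dD k a i * pd a f ?y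
      + D \<xi> $ a $ i * (\<Sum>b\<in>UNIV. (\<Sum>j\<in>UNIV. dD k b j * z $ j) * pd b (pd a f) ?y)) \<xi>"
      unfolding dD_def
      by (intro has_pd_sum has_pd_mult Ck_on_has_pd[OF D] N compose[unfolded dD_def]
          Ck_on_differentiable[OF pd_C3 _ z]) simp_all
    show "(\<Sum>a\<in>UNIV. D x $ a $ i * pd a f (D x *v z)) = pd i (\<L> x) z" if "x \<in> ?M" for x
      using that pd_compose_matrix[of "D x" z "\<L> x"] \<L> by simp
  qed
  \<comment> \<open>\<open>Bq\<close> is the source of the quadratic part; \<open>R\<close> is twice
    the spray in frame components, with its index lowered.\<close>
  define Bq where "Bq b = (\<Sum>k\<in>UNIV. \<Sum>j\<in>UNIV. dD k b j * (z $ k * z $ j))" for b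
  define R where "R d = wdev c d ?y + (\<Sum>b\<in>UNIV. pd d (pd b f) ?y * Bq b)" for d
  have comm_z: "(\<Sum>k\<in>UNIV. (dD k a i - dD i a k) * z $ k)
      = (\<Sum>d\<in>UNIV. D \<xi> $ d $ i * (\<Sum>e\<in>UNIV. c a d e * ?y $ e))" for a i
  proof -
    have "(\<Sum>k\<in>UNIV. (dD k a i - dD i a k) * z $ k)
        = (\<Sum>k\<in>UNIV. \<Sum>e\<in>UNIV. \<Sum>d\<in>UNIV. c a d e * D \<xi> $ e $ k * D \<xi> $ d $ i * z $ k)"
      unfolding dD_def comm sum_negf[symmetric] sum_distrib_right
      \<comment> \<open>Swapping the lower indices of c absorbs the minus sign of
        \<open>comm\<close>.\<close>
      by (intro sum.cong refl) (subst c, simp)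
    also have "\<dots> = (\<Sum>e\<in>UNIV. \<Sum>d\<in>UNIV. \<Sum>k\<in>UNIV. c a d e * D \<xi> $ e $ k * D \<xi> $ d $ i * z $ k)"
      by (rule trans[OF sum.swap]) (intro sum.cong refl sum.swap)
    also have "\<dots> = (\<Sum>d\<in>UNIV. \<Sum>e\<in>UNIV. \<Sum>k\<in>UNIV. c a d e * D \<xi> $ e $ k * D \<xi> $ d $ i * z $ k)"
      by (rule sum.swap)
    finally show ?thesis
      by (simp add: matrix_vector_mult_def sum_distrib_left mult_ac)
  qed
  have bracket: "(\<Sum>k\<in>UNIV. pd k (\<lambda>x. pd i (\<L> x) z) \<xi> * z $ k) - pd i (\<lambda>x. \<L> x z) \<xi>
      = (\<Sum>d\<in>UNIV. D \<xi> $ d $ i * R d)" for i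
  proof -
    have A: "(\<Sum>k\<in>UNIV. (\<Sum>a\<in>UNIV. dD k a i * pd a f ?y) * z $ k)
        - (\<Sum>a\<in>UNIV. (\<Sum>j\<in>UNIV. dD i a j * z $ j) * pd a f ?y) = (\<Sum>d\<in>UNIV. D \<xi> $ d $ i * wdev c d ?y)"
    proof -
      have "(\<Sum>k\<in>UNIV. (\<Sum>a\<in>UNIV. dD k a i * pd a f ?y) * z $ k) = (\<Sum>a\<in>UNIV. (\<Sum>k\<in>UNIV. dD k a i * z $ k) * pd a f ?y)"
        unfolding sum_distrib_right by (rule trans[OF sum.swap]) (simp add: mult_ac)
      then have "(\<Sum>k\<in>UNIV. (\<Sum>a\<in>UNIV. dD k a i * pd a f ?y) * z $ k)
          - (\<Sum>a\<in>UNIV. (\<Sum>j\<in>UNIV. dD i a j * z $ j) * pd a f ?y)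
          = (\<Sum>a\<in>UNIV. (\<Sum>k\<in>UNIV. (dD k a i - dD i a k) * z $ k) * pd a f ?y)"
        by (simp add: left_diff_distrib sum_subtractf)
      also have "\<dots> = (\<Sum>d\<in>UNIV. D \<xi> $ d $ i * wdev c d ?y)"
        unfolding comm_z wdev_def sum_distrib_left[of "D _ $ _ $ _"] sum_distrib_right[of _ _ "pd _ f ?y"]
        by (rule trans[OF sum.swap]) (simp add: mult_ac sum_distrib_left)
      finally show ?thesis .
    qed
    have B: "(\<Sum>k\<in>UNIV. (\<Sum>a\<in>UNIV. D \<xi> $ a $ i * (\<Sum>b\<in>UNIV. (\<Sum>j\<in>UNIV. dD k b j * z $ j) * pd b (pd a f) ?y)) * z $ k)
        = (\<Sum>d\<in>UNIV. D \<xi> $ d $ i * (\<Sum>b\<in>UNIV. pd d (pd b f) ?y * Bq b))"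
    proof -
      have "(\<Sum>k\<in>UNIV. (\<Sum>a\<in>UNIV. D \<xi> $ a $ i * (\<Sum>b\<in>UNIV. (\<Sum>j\<in>UNIV. dD k b j * z $ j) * pd b (pd a f) ?y)) * z $ k)
        = (\<Sum>a\<in>UNIV. D \<xi> $ a $ i * (\<Sum>k\<in>UNIV. (\<Sum>b\<in>UNIV. (\<Sum>j\<in>UNIV. dD k b j * z $ j) * pd b (pd a f) ?y) * z $ k))"
        unfolding sum_distrib_left[of "D _ $ _ $ _"] sum_distrib_right[of _ _ "z $ _"]
        by (rule trans[OF sum.swap]) (simp add: mult_ac sum_distrib_left)
      moreover have "(\<Sum>k\<in>UNIV. (\<Sum>b\<in>UNIV. (\<Sum>j\<in>UNIV. dD k b j * z $ j) * pd b (pd a f) ?y) * z $ k)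
          = (\<Sum>b\<in>UNIV. pd a (pd b f) ?y * Bq b)" for a
        unfolding Bq_def sum_distrib_left sum_distrib_right pd2_sym[OF z, of a]
        by (rule trans[OF sum.swap]) (simp add: mult_ac)
      ultimately show ?thesis by simp
    qed
    show ?thesis
      unfolding 1 2 R_def distrib_left sum.distrib A[symmetric] B[symmetric] distrib_right
      by simp
  qed
  have raise: "(\<Sum>b\<in>UNIV. inv_metric f ?y $ a $ b * R b) = 2 * dev c a ?y + Bq a" for a
  proof -
    have "(\<Sum>b\<in>UNIV. inv_metric f ?y $ a $ b * (\<Sum>d\<in>UNIV. pd b (pd d f) ?y * Bq d)) = Bq a"
      by (rule fibre_tensors.raise_lower[OF fibre_tensors[OF z]])
    then show ?thesis by (simp add: R_def distrib_left sum.distrib dev_def)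
  qed
  have "spray \<L> \<xi> z \<mu> = 1/2 * (\<Sum>i\<in>UNIV. inv_metric (\<L> \<xi>) z $ \<mu> $ i * (\<Sum>d\<in>UNIV. D \<xi> $ d $ i * R d))"
    by (simp add: spray_def bracket)
  also have "\<dots> = 1/2 * (\<Sum>a\<in>UNIV. E $ \<mu> $ a * (\<Sum>b\<in>UNIV. inv_metric f ?y $ a $ b * R b))"
  proof -
    have contract: "(\<Sum>i\<in>UNIV. \<Sum>b\<in>UNIV. inv_metric f ?y $ a $ b * ((\<Sum>d\<in>UNIV. D \<xi> $ d $ i * R d) * E $ i $ b))
        = (\<Sum>b\<in>UNIV. inv_metric f ?y $ a $ b * R b)" for a
      by (rule trans[OF sum.swap]) (simp only: sum_distrib_left[symmetric] sum_contract_inverse[OF DE(1)])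
    have "(\<Sum>i\<in>UNIV. inv_metric (\<L> \<xi>) z $ \<mu> $ i * (\<Sum>d\<in>UNIV. D \<xi> $ d $ i * R d))
        = (\<Sum>i\<in>UNIV. \<Sum>a\<in>UNIV. E $ \<mu> $ a * (\<Sum>b\<in>UNIV. inv_metric f ?y $ a $ b * ((\<Sum>d\<in>UNIV. D \<xi> $ d $ i * R d) * E $ i $ b)))"
      using inv_metric_compose[OF z \<L>[OF N(2)] DE]
      by (simp add: sum_distrib_right sum_distrib_left mult_ac)
    also have "\<dots> = (\<Sum>a\<in>UNIV. E $ \<mu> $ a * (\<Sum>i\<in>UNIV. \<Sum>b\<in>UNIV. inv_metric f ?y $ a $ b * ((\<Sum>d\<in>UNIV. D \<xi> $ d $ i * R d) * E $ i $ b)))"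
      by (rule trans[OF sum.swap]) (simp only: sum_distrib_left)
    finally show ?thesis by (simp only: contract)
  qed
  also have "\<dots>
      = (\<Sum>b\<in>UNIV. 1/2 * E $ \<mu> $ b * Bq b) + (\<Sum>r\<in>UNIV. E $ \<mu> $ r * dev c r ?y)"
    unfolding raise sum_distrib_left sum.distrib[symmetric] by (intro sum.cong refl) (simp add: algebra_simps)
  also have "(\<Sum>b\<in>UNIV. 1/2 * E $ \<mu> $ b * Bq b) = (\<Sum>k\<in>UNIV. \<Sum>l\<in>UNIV.
        (1/2 * (\<Sum>b\<in>UNIV. E $ \<mu> $ b * dD k b l)) * (z $ k * z $ l))"
    unfolding Bq_def sum_distrib_left[of "1/2 * _"] sum_distrib_left[of "1/2"] sum_distrib_right
    apply (rule trans[OF sum.swap], rule sum.cong[OF refl])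
    by (rule trans[OF sum.swap]) (simp add: mult_ac)
  finally show ?thesis by (simp only: dD_def)
qed

lemma cartan_up_sym: "y \<in> U \<Longrightarrow> cartan_up f y m a b = cartan_up f y m b a"
  by (simp add: cartan_up_def cartan_def pd3_swap23)

lemma mean_landsberg_formulas:
  fixes D E :: "real^'n^'n" and \<eta> :: "real^'n"
  defines "y \<equiv> D *v \<eta>"
  defines "I \<equiv> mean_cartan_up f y"
  defines "dI \<equiv> \<lambda>c m. pd c (\<lambda>z. mean_cartan_up f z m) y + (\<Sum>s\<in>UNIV. cartan_up f y m s c * I s)"
  assumes y: "y \<in> U"
    and c: "\<And>s d e. c s d e = - c s e d"
    and landsberg: "\<And>a b e. landsberg f \<L> E D \<xi> \<eta> a b e = 1/2 * lsum c a b e y"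
  shows "mean_landsberg f \<L> E D \<xi> \<eta> k = - 1/2 * (\<Sum>e\<in>UNIV. \<Sum>m\<in>UNIV. \<Sum>n\<in>UNIV. c e m n *
      (y $ m * mean_cartan f y e * kdelta n k + I m * metric_tensor f y $ e $ k * y $ n
       + I m * y_low f y e * kdelta n k + 2 * dI k m * y_low f y e * y $ n))" (is ?comm)
    and "mean_landsberg f \<L> E D \<xi> \<eta> k = (\<Sum>m\<in>UNIV. \<Sum>n\<in>UNIV. \<Sum>e\<in>UNIV. kcoef f y c m n e * y $ e *
      (I m * kdelta n k + y $ n * dI k m))" (is ?kcoef)
    and "mean_landsberg f \<L> E D \<xi> \<eta> k = (\<Sum>m\<in>UNIV. \<Sum>n\<in>UNIV. \<Sum>e\<in>UNIV. kcoef f y c m n e * y $ e *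
      (antisym2 (\<lambda>n m. hproj f y n k * I m) n m
       + antisym2 (\<lambda>n m. y $ n *
           (\<Sum>a\<in>UNIV. \<Sum>d\<in>UNIV. hproj f y a k * hproj f y m d * vcartan_I f y a d)) n m))" (is ?proj)
proof -
  interpret deviation_jet "\<lambda>a b. pd a (pd b f) y" "\<lambda>a b. inv_metric f y $ a $ b"
    "\<lambda>a b c. pd a (pd b (pd c f)) y" "\<lambda>a b c d. pd a (pd b (pd c (pd d f))) y" "($) y" c
    "\<lambda>r. dev c r y" "\<lambda>r k. pd k (dev c r) y" "\<lambda>r b k. pd b (pd k (dev c r)) y"
    "\<lambda>k r. pd k (\<lambda>z. mean_cartan f z r) y" "\<lambda>k m. pd k (\<lambda>z. mean_cartan_up f z m) y"
    by (rule deviation_jet[OF y c])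
  note defs = fibre_tensors_defs[OF y]
  have J: "mean_landsberg f \<L> E D \<xi> \<eta> k = J k"
    unfolding mean_landsberg_def J_def landsberg Lsum_def lsum_def by (simp add: y_def)
  have dI: "deviation_jet.dI (\<lambda>a b. inv_metric f y $ a $ b) (\<lambda>a b c. pd a (pd b (pd c f)) y)
      (\<lambda>k m. pd k (\<lambda>z. mean_cartan_up f z m) y) = dI"
    unfolding dI_def defs assms(3) by (simp add: I_def)
  have kc: "kc = kcoef f y c"
    by (simp add: fun_eq_iff kc_def cl_def kcoef_def comm_low_def metric_tensor_component)
  \<comment> \<open>The two expressions differ in the order of the lower indices of the Cartan
    tensor.\<close>
  have v: "vcartan_I f y = dI"
    unfolding assms(3) by (simp add: fun_eq_iff vcartan_I_def I_def cartan_up_sym[OF y])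
  show ?comm
    unfolding J J_eq_comm defs I_def metric_tensor_component dI ..
  show ?kcoef
    unfolding J J_eq_kc defs I_def dI kc ..
  show ?proj
    unfolding J v I_def
    using J_eq_proj[of "hproj f y" "g_yy f y" k] by (simp only: defs dI kc hproj_def)
qed

end

section \<open>Linear frames\<close>

definition frame_lc :: "('n::finite \<Rightarrow> 'v::euclidean_space) \<Rightarrow> real^'n \<Rightarrow> 'v" where
  "frame_lc b y = (\<Sum>a\<in>UNIV. y $ a *\<^sub>R b a)"

lemma linear_frame_lc: "linear (frame_lc b)"
  by (rule linearI) (simp_all add: frame_lc_def scaleR_add_left sum.distrib scaleR_sum_right)

lemma frame_lc_axis: "frame_lc b (axis a 1) = b a"
  unfolding frame_lc_def axis_def by (simp add: if_distrib if_distribR cong: if_cong)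

lemma bij_frame_lc:
  assumes "is_basis b"
  shows "bij (frame_lc b)"
proof -
  have b: "inj b" "independent (range b)" "span (range b) = UNIV"
    using assms by (auto simp: is_basis_def)
  have sum: "(\<Sum>v\<in>range b. u v *\<^sub>R v) = frame_lc b (\<chi> a. u (b a))" for u
    by (simp add: frame_lc_def sum.reindex[OF b(1)])
  have "x = 0" if "frame_lc b x = 0" for x
  proof -
    have "(\<Sum>v\<in>range b. x $ (inv b v) *\<^sub>R v) = 0"
      using that b(1) by (simp add: sum)
    then have "\<forall>v\<in>range b. x $ (inv b v) = 0"
      using b(2)[unfolded independent_explicit, THEN conjunct2, THEN spec, of "\<lambda>v. x $ inv b v"] by simp
    then show ?thesis using b(1) by (simp add: vec_eq_iff)
  qed
  then have "inj (frame_lc b)"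
    using linear_injective_0[OF linear_frame_lc] by blast
  moreover have "w \<in> range (frame_lc b)" for w
  proof -
    have "w \<in> range (\<lambda>u. \<Sum>v\<in>range b. u v *\<^sub>R v)"
      using span_finite[of "range b"] b(3) by simp
    then show ?thesis unfolding sum by auto
  qed
  then have "surj (frame_lc b)" by auto
  ultimately show ?thesis by (rule bijI)
qed

lemma frame_fun_eq: "frame_fun b L y = L (frame_lc b y)"
  by (simp add: frame_fun_def frame_lc_def)

lemma bounded_linear_frame_lc: "bounded_linear (frame_lc b)"
  using linear_frame_lc linear_conv_bounded_linear by blast

section \<open>From a pseudo-Minkowski space to a function of frame components\<close>

lemma homogeneous_euler:
  assumes "open S" "y \<in> S" and cone: "\<And>s. 0 < s \<Longrightarrow> s *\<^sub>R y \<in> S"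
    and "f differentiable (at y)" and hom: "\<And>s. 0 < s \<Longrightarrow> f (s *\<^sub>R y) = s^2 * f y"
  shows "(\<Sum>a\<in>UNIV. y $ a * pd a f y) = 2 * f y"
proof -
  \<comment> \<open>Derivative along the ray through y at t = 1, to be compared with that of t^2
    f(y); the base point 0 of the line is written out to fit
    \<open>has_derivative_imp_DERIV_line\<close>.\<close>
  have deriv: "((\<lambda>t. f (0 + t *\<^sub>R y)) has_real_derivative frechet_derivative f (at y) y) (at 1)"
    using assms(4) unfolding frechet_derivative_works
    by (intro has_derivative_imp_DERIV_line) simp
  have ev: "\<forall>\<^sub>F t in nhds 1. f (0 + t *\<^sub>R y) = t^2 * f y"
    using hom unfolding eventually_nhds by (intro exI[of _ "{0<..}"]) auto
  have "((\<lambda>t. t^2 * f y) has_real_derivative frechet_derivative f (at y) y) (at 1)"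
    using deriv DERIV_cong_ev[OF refl ev refl] by blast
  moreover have "((\<lambda>t. t^2 * f y) has_real_derivative 2 * f y) (at 1)"
    by (auto intro!: derivative_eq_intros)
  ultimately have "frechet_derivative f (at y) y = 2 * f y"
    by (rule DERIV_unique)
  then show ?thesis by (simp add: frechet_eq_sum_pd[OF assms(4)])
qed

text \<open>Connects the Hessian on V, formed with Frechet derivatives, to the partial derivatives
  that make up \<open>metric_tensor\<close>.\<close>

lemma hess_frame:
  assumes "open \<omega>" "Ck_on 2 L \<omega>" "frame_lc b y \<in> \<omega>"
  shows "hess L (frame_lc b y) (frame_lc b u) (frame_lc b w)
    = (\<Sum>i\<in>UNIV. w $ i * (\<Sum>a\<in>UNIV. u $ a * pd i (pd a (frame_fun b L)) y))"
proof -
  let ?l = "frame_lc b" and ?f = "frame_fun b L"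
  let ?W = "?l -` \<omega>"
  note bl = bounded_linear_frame_lc[of b]
  have W: "open ?W" "y \<in> ?W"
    using assms by (auto intro!: open_vimage linear_continuous_on bl)
  have f: "Ck_on 2 ?f ?W"
    using Ck_on_compose_linear[OF bl assms(1,2)] by (simp add: frame_fun_eq[abs_def])
  have f1: "Ck_on 1 (pd a ?f) ?W" for a
    using Ck_on_pd[OF W(1), of 1] f by (simp add: numeral_2_eq_2)
  have g: "(\<lambda>Z. frechet_derivative L (at Z) (?l u)) differentiable (at (?l y))"
    using assms(2) by (intro Ck_on_differentiable[OF _ _ assms(3), of 1]) (auto simp: numeral_2_eq_2 intro: Ck_on_Suc_frechet)
  have eq: "frechet_derivative L (at (?l z)) (?l u) = (\<Sum>a\<in>UNIV. u $ a * pd a ?f z)" if "z \<in> ?W" for z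
  proof -
    have "L differentiable (at (?l z))"
      using Ck_on_differentiable[OF assms(2)] that by simp
    then have "frechet_derivative ?f (at z) u = frechet_derivative L (at (?l z)) (?l u)"
      by (simp add: frame_fun_eq[abs_def] frechet_derivative_compose_linear[OF bl])
    then show ?thesis
      using frechet_eq_sum_pd[OF Ck_on_differentiable[OF f _ that]] by simp
  qed
  have hess: "has_pd i (\<lambda>z. \<Sum>a\<in>UNIV. u $ a * pd a ?f z) (hess L (?l y) (?l u) (?l (axis i 1))) y" for i
  proof (rule has_pd_transform[OF _ W])
    have "((\<lambda>z. frechet_derivative L (at (?l z)) (?l u)) has_derivative
        (\<lambda>h. frechet_derivative (\<lambda>Z. frechet_derivative L (at Z) (?l u)) (at (?l y)) (?l h))) (at y)"
      by (rule has_derivative_compose_linear[OF bl g[unfolded frechet_derivative_works]])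
    from has_derivative_has_pd[OF this] show
      "has_pd i (\<lambda>z. frechet_derivative L (at (?l z)) (?l u)) (hess L (?l y) (?l u) (?l (axis i 1))) y"
      by (simp add: hess_def)
  qed (rule eq)
  have "has_pd i (\<lambda>z. \<Sum>a\<in>UNIV. u $ a * pd a ?f z) (\<Sum>a\<in>UNIV. u $ a * pd i (pd a ?f) y) y" for i
    by (intro has_pd_sum has_pd_cmult Ck_on_has_pd[OF f1] W) simp
  then have axis: "hess L (?l y) (?l u) (?l (axis i 1)) = (\<Sum>a\<in>UNIV. u $ a * pd i (pd a ?f) y)" for i
    using hess has_pd_unique by blast
  have lin: "linear (\<lambda>w. hess L (?l y) (?l u) (?l w))"
    unfolding hess_def using linear_compose[OF linear_frame_lc linear_frechet_derivative[OF g]]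
    by (simp add: o_def)
  have "hess L (?l y) (?l u) (?l (\<Sum>i\<in>UNIV. w $ i *\<^sub>R axis i 1))
      = (\<Sum>i\<in>UNIV. w $ i * hess L (?l y) (?l u) (?l (axis i 1)))"
    by (simp add: linear_sum[OF lin] linear_cmul[OF lin])
  then show ?thesis
    by (simp add: axis basis_expansion flip: scalar_mult_eq_scaleR)
qed

lemma minkowski_function_frame:
  assumes "pseudo_minkowski \<omega> L" "is_basis b"
  shows "minkowski_function (frame_fun b L) (frame_lc b -` \<omega>)"
proof
  let ?l = "frame_lc b" and ?f = "frame_fun b L"
  have \<omega>: "open \<omega>" "Ck_on 4 L \<omega>" and cone: "\<And>y s. y \<in> \<omega> \<Longrightarrow> 0 < s \<Longrightarrow> s *\<^sub>R y \<in> \<omega>"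
    and hom: "\<And>y s. y \<in> closure \<omega> \<Longrightarrow> 0 < s \<Longrightarrow> L (s *\<^sub>R y) = s^2 * L y"
    and hess: "\<And>y u. y \<in> \<omega> \<Longrightarrow> u \<noteq> 0 \<Longrightarrow> \<exists>w. hess L y u w \<noteq> 0"
    using assms(1) by (auto simp: pseudo_minkowski_def)
  note bl = bounded_linear_frame_lc[of b]
  show open_W: "open (?l -` \<omega>)"
    using \<omega> by (auto intro!: open_vimage linear_continuous_on bl)
  show C4: "Ck_on 4 ?f (?l -` \<omega>)"
    using Ck_on_compose_linear[OF bl \<omega>] by (simp add: frame_fun_eq[abs_def])
  fix y assume y: "y \<in> ?l -` \<omega>"
  have scale: "?l (s *\<^sub>R y) = s *\<^sub>R ?l y" for s
    by (rule linear_cmul[OF linear_frame_lc])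
  show "(\<Sum>a\<in>UNIV. y $ a * pd a ?f y) = 2 * ?f y"
    using y by (intro homogeneous_euler[OF open_W y] Ck_on_differentiable[OF C4])
      (simp_all add: frame_fun_eq scale cone hom closure_subset[THEN subsetD])
  \<comment> \<open>By \<open>hess_frame\<close> a nonzero kernel vector would be a degenerate
    direction of the Hessian of \<open>L\<close>.\<close>
  have "u = 0" if "metric_tensor ?f y *v u = 0" for u
  proof (rule ccontr)
    assume "u \<noteq> 0"
    then have "?l u \<noteq> 0"
      using bij_frame_lc[OF assms(2)] linear_injective_0[OF linear_frame_lc] by (auto simp: bij_def)
    then obtain w where "hess L (?l y) (?l u) (?l w) \<noteq> 0"
      using hess[of "?l y" "?l u"] y bij_frame_lc[OF assms(2)] by (metis bij_pointE vimageD)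
    moreover have "(\<Sum>a\<in>UNIV. u $ a * pd i (pd a ?f) y) = 0" for i
      using arg_cong[OF that, of "\<lambda>v. v $ i"] by (simp add: metric_tensor_def matrix_vector_mult_def mult.commute)
    ultimately show False
      using hess_frame[OF \<omega>(1) Ck_on_le[OF \<omega>(2)], where b = b and y = y and u = u and w = w] y by simp
  qed
  then show "invertible (metric_tensor ?f y)"
    by (metis invertible_left_inverse matrix_left_invertible_ker)
qed

section \<open>Tangent vectors in a chart\<close>

lemma chart_homeomorphism:
  "smooth_atlas A \<Longrightarrow> c \<in> A \<Longrightarrow> homeomorphism (fst c) (snd c ` fst c) (snd c) (chart_inv c)"
  by (simp add: smooth_atlas_def)

lemma chart_inv_chart:
  "smooth_atlas A \<Longrightarrow> c \<in> A \<Longrightarrow> x \<in> fst c \<Longrightarrow> chart_inv c (snd c x) = x"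
  by (rule homeomorphism_apply1[OF chart_homeomorphism])

lemma open_chart_image:
  assumes "smooth_atlas A" "c \<in> A" "open V"
  shows "open (snd c ` (V \<inter> fst c))"
proof -
  have "openin (top_of_set (fst c)) (fst c \<inter> V)"
    by (rule openin_open_Int[OF assms(3)])
  then have "openin (top_of_set (snd c ` fst c)) (snd c ` (V \<inter> fst c))"
    using homeomorphism_imp_open_map[OF chart_homeomorphism[OF assms(1,2)]] by (simp add: Int_commute)
  moreover have "open (snd c ` fst c)"
    using assms by (simp add: smooth_atlas_def)
  ultimately show ?thesis using openin_open_trans by blast
qed

lemma has_derivative_coord_change:
  assumes "smooth_atlas A" "c \<in> A" "d \<in> A" "x \<in> fst c" "x \<in> fst d"
  shows "((snd d \<circ> chart_inv c) has_derivative coord_change c d x) (at (snd c x))"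
proof -
  have "Ck_on 1 (snd d \<circ> chart_inv c) (snd c ` (fst c \<inter> fst d))"
    using assms(1-3) by (simp only: smooth_atlas_def)
  then have "(snd d \<circ> chart_inv c) differentiable (at (snd c x))"
    by (rule Ck_on_differentiable) (use assms(4,5) in auto)
  then show ?thesis by (simp add: coord_change_def frechet_derivative_works)
qed

text \<open>The cocycle rule, by the chain rule. The composite of the two transition maps equals the
  direct one only on the image of the overlap of c and d, which is open.\<close>

lemma coord_change_trans:
  assumes "smooth_atlas A" "c \<in> A" "d \<in> A" "e \<in> A" "x \<in> fst c" "x \<in> fst d" "x \<in> fst e"
  shows "coord_change d e x (coord_change c d x y) = coord_change c e x y"
proof -
  have x: "(snd d \<circ> chart_inv c) (snd c x) = snd d x"
    using chart_inv_chart assms by (metis comp_apply)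
  have "((snd e \<circ> chart_inv d) \<circ> (snd d \<circ> chart_inv c) has_derivative
      coord_change d e x \<circ> coord_change c d x) (at (snd c x))"
    using has_derivative_coord_change[OF assms(1,2,3,5,6)] has_derivative_coord_change[OF assms(1,3,4,6,7)]
    by (intro diff_chain_at) (simp_all only: x)
  then have "((snd e \<circ> chart_inv c) has_derivative coord_change d e x \<circ> coord_change c d x) (at (snd c x))"
  proof (rule has_derivative_transform_within_open)
    have "open (fst d)" using assms by (simp add: smooth_atlas_def)
    then show "open (snd c ` (fst d \<inter> fst c))" by (rule open_chart_image[OF assms(1,2)])
    show "((snd e \<circ> chart_inv d) \<circ> (snd d \<circ> chart_inv c)) z = (snd e \<circ> chart_inv c) z"
      if "z \<in> snd c ` (fst d \<inter> fst c)" for z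
      using that chart_inv_chart[OF assms(1,2)] chart_inv_chart[OF assms(1,3)] by auto
  qed (use assms in auto)
  then have "coord_change d e x \<circ> coord_change c d x = coord_change c e x"
    using has_derivative_unique[OF _ has_derivative_coord_change[OF assms(1,2,4,5,7)]] by blast
  then show ?thesis by (metis comp_apply)
qed

lemma tvec_of_in_tangent_space:
  "smooth_atlas A \<Longrightarrow> c \<in> A \<Longrightarrow> x \<in> fst c \<Longrightarrow> tvec_of A c x y \<in> tangent_space A x"
  by (auto simp: tangent_space_def tvec_of_def coord_change_trans)

lemma tvec_of_components:
  assumes "c \<in> A" "x \<in> fst c" "v \<in> tangent_space A x"
  shows "tvec_of A c x (v c) = v"
proof (rule ext)
  fix d
  have "v d = coord_change c d x (v c)" if "d \<in> A" "x \<in> fst d"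
    using assms that unfolding tangent_space_def by blast
  moreover have "v d = 0" if "\<not> (d \<in> A \<and> x \<in> fst d)"
    using assms(3) that unfolding tangent_space_def by blast
  ultimately show "tvec_of A c x (v c) d = v d"
    by (metis tvec_of_def)
qed

lemma tvec_of_linear:
  assumes "smooth_atlas A" "c \<in> A" "x \<in> fst c"
  shows "tvec_of A c x (r *\<^sub>R y + s *\<^sub>R z) = (\<lambda>d. r *\<^sub>R tvec_of A c x y d + s *\<^sub>R tvec_of A c x z d)"
proof (rule ext)
  fix d
  show "tvec_of A c x (r *\<^sub>R y + s *\<^sub>R z) d = r *\<^sub>R tvec_of A c x y d + s *\<^sub>R tvec_of A c x z d"
  proof (cases "d \<in> A \<and> x \<in> fst d")
    case True
    then have "linear (coord_change c d x)"
      using has_derivative_linear[OF has_derivative_coord_change[OF assms(1,2) _ assms(3)]] by blast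
    then show ?thesis using True by (simp add: tvec_of_def linear_add linear_cmul)
  qed (auto simp: tvec_of_def)
qed

section \<open>The frame of a local model\<close>

definition frame_coord :: "('n::finite \<Rightarrow> 'v::euclidean_space) \<Rightarrow> 'v \<Rightarrow> real^'n" where
  "frame_coord b = inv (frame_lc b)"

text \<open>The dual vierbein read off directly from \<phi>, which is what
  \<open>local_model\<close> assumes to be C^1. \<open>vierbein\<close> involves the inverse of
  \<phi>, so its smoothness is derived from this matrix by inversion.\<close>

definition coframe ::
  "('m, 'n::finite) chart set \<Rightarrow> ('m \<Rightarrow> ('m, 'n) tvec \<Rightarrow> 'v::euclidean_space) \<Rightarrow> ('n \<Rightarrow> 'v)
     \<Rightarrow> ('m, 'n) chart \<Rightarrow> real^'n \<Rightarrow> real^'n^'n" where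
  "coframe A \<phi> b c \<xi> = (\<chi> a i.
     frame_coord b (\<phi> (chart_inv c \<xi>) (tvec_of A c (chart_inv c \<xi>) (axis i 1))) $ a)"

lemma frame_coord_lc: "is_basis b \<Longrightarrow> frame_coord b (frame_lc b y) = y"
  unfolding frame_coord_def using bij_frame_lc by (metis bij_is_inj inv_f_f)

lemma frame_lc_coord: "is_basis b \<Longrightarrow> frame_lc b (frame_coord b w) = w"
  unfolding frame_coord_def using bij_frame_lc by (metis bij_is_surj surj_f_inv_f)

lemma linear_frame_coord: "is_basis b \<Longrightarrow> linear (frame_coord b)"
proof (rule linearI)
  assume b: "is_basis b"
  show "frame_coord b (v + w) = frame_coord b v + frame_coord b w" for v w
    using frame_coord_lc[OF b, of "frame_coord b v + frame_coord b w"]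
    by (simp add: linear_add[OF linear_frame_lc] frame_lc_coord[OF b])
  show "frame_coord b (r *\<^sub>R v) = r *\<^sub>R frame_coord b v" for r v
    using frame_coord_lc[OF b, of "r *\<^sub>R frame_coord b v"]
    by (simp add: linear_cmul[OF linear_frame_lc] frame_lc_coord[OF b])
qed

locale local_frame =
  fixes A :: "('m::topological_space, 'n::finite) chart set" and \<Omega> F and \<omega> :: "'v::euclidean_space set"
    and L U \<phi> and b :: "'n \<Rightarrow> 'v" and \<kappa>
  assumes atlas: "smooth_atlas A"
    and \<Omega>: "\<Omega> \<subseteq> tangent_bundle A"
    and basis: "is_basis b"
    and model: "local_model A \<Omega> F \<omega> L U \<phi>"
    and chart: "\<kappa> \<in> A"
begin

abbreviation N where "N \<equiv> snd \<kappa> ` (U \<inter> fst \<kappa>)"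
abbreviation D where "D \<equiv> coframe A \<phi> b \<kappa>"
abbreviation E where "E \<equiv> vierbein A \<phi> b \<kappa>"

lemma open_N: "open N"
  using model by (intro open_chart_image[OF atlas chart]) (simp add: local_model_def)

lemma N_chart_inv: "\<xi> \<in> N \<Longrightarrow> chart_inv \<kappa> \<xi> \<in> U" "\<xi> \<in> N \<Longrightarrow> chart_inv \<kappa> \<xi> \<in> fst \<kappa>"
  using chart_inv_chart[OF atlas chart] by auto

lemma model_iso: "x \<in> U \<Longrightarrow> linear_iso_on (tangent_space A x) (\<phi> x)"
  and model_cone: "x \<in> U \<Longrightarrow> \<phi> x ` (\<Omega> `` {x}) = \<omega>"
  and model_L: "x \<in> U \<Longrightarrow> v \<in> fibre_closure A \<Omega> x \<Longrightarrow> L (\<phi> x v) = F (x, v)"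
  using model unfolding local_model_def by blast+

lemma coframe_apply:
  assumes "\<xi> \<in> N"
  shows "D \<xi> *v y = frame_coord b (\<phi> (chart_inv \<kappa> \<xi>) (tvec_of A \<kappa> (chart_inv \<kappa> \<xi>) y))"
proof -
  let ?x = "chart_inv \<kappa> \<xi>"
  let ?\<Phi> = "\<lambda>y. \<phi> ?x (tvec_of A \<kappa> ?x y)"
  have x: "?x \<in> U" "?x \<in> fst \<kappa>" using N_chart_inv[OF assms] .
  have comb: "?\<Phi> (r *\<^sub>R y + s *\<^sub>R z) = r *\<^sub>R ?\<Phi> y + s *\<^sub>R ?\<Phi> z" for r s y z
    using model_iso[OF x(1)] tvec_of_in_tangent_space[OF atlas chart x(2)]
    unfolding tvec_of_linear[OF atlas chart x(2)] linear_iso_on_def by blast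
  have "linear ?\<Phi>"
    using comb[of 1 _ 1] comb[of _ _ 0] by (intro linearI) simp_all
  then have "linear (\<lambda>y. frame_coord b (?\<Phi> y))"
    using linear_compose[OF _ linear_frame_coord[OF basis]] by (simp add: o_def)
  then have "matrix (\<lambda>y. frame_coord b (?\<Phi> y)) *v y = frame_coord b (?\<Phi> y)"
    by (rule fun_cong[OF matrix_vector_mul(2)])
  moreover have "matrix (\<lambda>y. frame_coord b (?\<Phi> y)) = D \<xi>"
    by (simp add: matrix_def coframe_def)
  ultimately show ?thesis by simp
qed

lemma coframe_C1: "Ck_on 1 (\<lambda>\<xi>. D \<xi> $ a $ i) N"
proof -
  have "Ck_on 1 (\<lambda>\<xi>. \<phi> (chart_inv \<kappa> \<xi>) (tvec_of A \<kappa> (chart_inv \<kappa> \<xi>) (axis i 1))) N"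
    using model chart by (simp only: local_model_def)
  moreover have "bounded_linear (\<lambda>w. frame_coord b w $ a)"
    using linear_frame_coord[OF basis] linear_conv_bounded_linear bounded_linear_compose[OF bounded_linear_vec_nth]
    by blast
  ultimately show ?thesis
    using Ck_on_bounded_linear[OF _ open_N] by (simp add: coframe_def)
qed

lemma coframe_vierbein:
  assumes "\<xi> \<in> N"
  shows "D \<xi> ** E \<xi> = mat 1" "E \<xi> ** D \<xi> = mat 1"
proof -
  let ?x = "chart_inv \<kappa> \<xi>"
  have x: "?x \<in> U" "?x \<in> fst \<kappa>" using N_chart_inv[OF assms] .
  have col: "D \<xi> *v column a (E \<xi>) = axis a 1" for a
  proof -
    let ?v = "inv_into (tangent_space A ?x) (\<phi> ?x) (b a)"
    have img: "b a \<in> \<phi> ?x ` tangent_space A ?x"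
      using model_iso[OF x(1)] by (simp add: linear_iso_on_def bij_betw_def)
    have "tvec_of A \<kappa> ?x (?v \<kappa>) = ?v"
      by (rule tvec_of_components[OF chart x(2) inv_into_into[OF img]])
    moreover have "column a (E \<xi>) = ?v \<kappa>"
      by (simp add: column_def vierbein_def vec_eq_iff)
    ultimately show ?thesis
      using f_inv_into_f[OF img] frame_coord_lc[OF basis, of "axis a 1"]
      by (simp add: coframe_apply[OF assms] frame_lc_axis)
  qed
  have "(\<Sum>k\<in>UNIV. D \<xi> $ i $ k * E \<xi> $ k $ a) = axis a 1 $ i" for a i
    unfolding col[symmetric] by (simp add: matrix_vector_mult_def column_def)
  then show DE: "D \<xi> ** E \<xi> = mat 1"
    by (simp add: vec_eq_iff matrix_matrix_mult_def mat_def axis_def)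
  then show "E \<xi> ** D \<xi> = mat 1"
    by (rule matrix_left_right_inverse[THEN iffD1])
qed

lemma dual_vierbein_eq: "\<xi> \<in> N \<Longrightarrow> dual_vierbein A \<phi> b \<kappa> \<xi> = D \<xi>"
  unfolding dual_vierbein_def by (rule matrix_inv_unique) (simp_all add: coframe_vierbein)

lemma vierbein_C1: "Ck_on 1 (\<lambda>\<xi>. E \<xi> $ i $ a) N"
proof -
  have "Ck_on 1 (\<lambda>\<xi>. matrix_inv (D \<xi>) $ i $ a) N"
  proof (rule Ck_on_matrix_inv[OF open_N coframe_C1])
    show "invertible (D \<xi>)" if "\<xi> \<in> N" for \<xi>
      unfolding invertible_def by (rule exI[of _ "E \<xi>"]) (simp add: coframe_vierbein[OF that])
  qed
  then show ?thesis
    by (rule Ck_on_transform[OF _ open_N]) (simp only: matrix_inv_unique[OF coframe_vierbein])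
qed

text \<open>Some vector of the cone at the point has the same image under \<phi>, and \<phi> is
  injective on the tangent space.\<close>

lemma tvec_of_in_cone:
  assumes "\<xi> \<in> N" "frame_lc b (D \<xi> *v y) \<in> \<omega>"
  shows "(chart_inv \<kappa> \<xi>, tvec_of A \<kappa> (chart_inv \<kappa> \<xi>) y) \<in> \<Omega>"
proof -
  let ?x = "chart_inv \<kappa> \<xi>"
  have x: "?x \<in> U" "?x \<in> fst \<kappa>" using N_chart_inv[OF assms(1)] .
  have "\<phi> ?x (tvec_of A \<kappa> ?x y) \<in> \<phi> ?x ` (\<Omega> `` {?x})"
    using assms(2) by (simp add: coframe_apply[OF assms(1)] frame_lc_coord[OF basis] model_cone[OF x(1)])
  then obtain v where v: "(?x, v) \<in> \<Omega>" "\<phi> ?x (tvec_of A \<kappa> ?x y) = \<phi> ?x v" by auto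
  have "v \<in> tangent_space A ?x" using v(1) \<Omega> by (auto simp: tangent_bundle_def)
  then have "tvec_of A \<kappa> ?x y = v"
    using v(2) model_iso[OF x(1)] tvec_of_in_tangent_space[OF atlas chart x(2), of y]
    unfolding linear_iso_on_def bij_betw_def inj_on_def by blast
  then show ?thesis using v(1) by simp
qed

lemma coord_fun_eq:
  assumes "\<xi> \<in> N" "D \<xi> *v y \<in> frame_lc b -` \<omega>"
  shows "coord_fun A F \<kappa> \<xi> y = frame_fun b L (D \<xi> *v y)"
proof -
  let ?x = "chart_inv \<kappa> \<xi>"
  let ?v = "tvec_of A \<kappa> ?x y"
  have x: "?x \<in> U" "?x \<in> fst \<kappa>" using N_chart_inv[OF assms(1)] .
  have "(?x, ?v) \<in> \<Omega>" using tvec_of_in_cone assms by simp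
  then have "?v \<in> fibre_closure A \<Omega> ?x"
    using tvec_of_in_tangent_space[OF atlas chart x(2)]
    by (auto simp: fibre_closure_def intro!: closure_subset[THEN subsetD])
  then show ?thesis
    using model_L[OF x(1)]
    by (simp add: coord_fun_def frame_fun_eq coframe_apply[OF assms(1)] frame_lc_coord[OF basis])
qed

lemma coframe_vector:
  assumes "p \<in> U \<inter> fst \<kappa>" "(p, v) \<in> \<Omega>"
  shows "D (snd \<kappa> p) *v v \<kappa> \<in> frame_lc b -` \<omega>"
proof -
  have p: "snd \<kappa> p \<in> N" "chart_inv \<kappa> (snd \<kappa> p) = p"
    using assms chart_inv_chart[OF atlas chart] by auto
  have "v \<in> tangent_space A p" using assms(2) \<Omega> by (auto simp: tangent_bundle_def)
  then have "D (snd \<kappa> p) *v v \<kappa> = frame_coord b (\<phi> p v)"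
    using tvec_of_components[OF chart] assms(1) by (simp add: coframe_apply[OF p(1)] p(2))
  then show ?thesis
    using model_cone[of p] assms by (auto simp: frame_lc_coord[OF basis])
qed

text \<open>Differentiating \<open>D ** E = mat 1\<close> turns the brackets of the frame into the exterior derivative
  of the coframe.\<close>

lemma commutation_coframe:
  assumes "\<xi> \<in> N"
    and bracket: "\<And>a d. lie_bracket (\<lambda>\<xi>. column a (E \<xi>)) (\<lambda>\<xi>. column d (E \<xi>)) \<xi>
      = (\<Sum>c\<in>UNIV. C c a d *\<^sub>R column c (E \<xi>))"
  shows "pd i (\<lambda>x. D x $ c $ j) \<xi> - pd j (\<lambda>x. D x $ c $ i) \<xi>
      = - (\<Sum>a\<in>UNIV. \<Sum>d\<in>UNIV. C c a d * D \<xi> $ a $ i * D \<xi> $ d $ j)" (is ?deriv)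
    and "C c a d = - C c d a" (is ?antisym)
proof -
  note DE = coframe_vierbein[OF assms(1)]
  define dD where "dD i c j = pd i (\<lambda>x. D x $ c $ j) \<xi>" for i c j
  define dE where "dE i j c = pd i (\<lambda>x. E x $ j $ c) \<xi>" for i j c
  have dDE: "(\<Sum>j\<in>UNIV. D \<xi> $ c $ j * dE i j d) = - (\<Sum>j\<in>UNIV. dD i c j * E \<xi> $ j $ d)" for i c d
  proof -
    have "has_pd i (\<lambda>x. \<Sum>j\<in>UNIV. D x $ c $ j * E x $ j $ d)
        (\<Sum>j\<in>UNIV. dD i c j * E \<xi> $ j $ d + D \<xi> $ c $ j * dE i j d) \<xi>"
      unfolding dD_def dE_def
      by (intro has_pd_sum has_pd_mult Ck_on_has_pd[OF coframe_C1] Ck_on_has_pd[OF vierbein_C1] assms(1)) simp_all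
    then have "has_pd i (\<lambda>x. kdelta c d)
        (\<Sum>j\<in>UNIV. dD i c j * E \<xi> $ j $ d + D \<xi> $ c $ j * dE i j d) \<xi>"
      by (rule has_pd_transform[OF _ open_N assms(1)]) (rule matrix_mult_kdelta[OF coframe_vierbein(1)])
    then have "(\<Sum>j\<in>UNIV. dD i c j * E \<xi> $ j $ d + D \<xi> $ c $ j * dE i j d) = 0"
      using has_pd_unique has_pd_const by blast
    then show ?thesis by (simp add: sum.distrib)
  qed
  \<comment> \<open>The exterior derivative of e^c evaluated on e_a and e_d; for a coframe this is
    minus e^c of the bracket of e_a and e_d.\<close>
  define Z where "Z a d = (\<Sum>i\<in>UNIV. \<Sum>j\<in>UNIV. (dD i c j - dD j c i) * E \<xi> $ i $ a * E \<xi> $ j $ d)" for a d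
  have C: "C c a d = - Z a d" for a d
  proof -
    have "(\<Sum>m\<in>UNIV. D \<xi> $ c $ m * (\<Sum>e\<in>UNIV. E \<xi> $ m $ e * C e a d)) = C c a d"
    proof -
      have "(\<Sum>m\<in>UNIV. D \<xi> $ c $ m * (\<Sum>e\<in>UNIV. E \<xi> $ m $ e * C e a d))
          = (\<Sum>e\<in>UNIV. (\<Sum>m\<in>UNIV. D \<xi> $ c $ m * E \<xi> $ m $ e) * C e a d)"
        unfolding sum_distrib_left sum_distrib_right by (rule trans[OF sum.swap]) (simp add: mult.assoc)
      then show ?thesis by (simp add: matrix_mult_kdelta[OF DE(1)])
    qed
    moreover have "(\<Sum>e\<in>UNIV. E \<xi> $ m $ e * C e a d)
        = (\<Sum>i\<in>UNIV. E \<xi> $ i $ a * dE i m d - E \<xi> $ i $ d * dE i m a)" for m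
      using arg_cong[OF bracket[of a d], of "\<lambda>v. v $ m"]
      by (simp add: lie_bracket_def column_def dE_def mult.commute)
    ultimately have "C c a d = (\<Sum>m\<in>UNIV. D \<xi> $ c $ m * (\<Sum>i\<in>UNIV. E \<xi> $ i $ a * dE i m d - E \<xi> $ i $ d * dE i m a))"
      by simp
    also have "\<dots> = (\<Sum>i\<in>UNIV. E \<xi> $ i $ a * (\<Sum>m\<in>UNIV. D \<xi> $ c $ m * dE i m d))
        - (\<Sum>i\<in>UNIV. E \<xi> $ i $ d * (\<Sum>m\<in>UNIV. D \<xi> $ c $ m * dE i m a))"
      unfolding sum_distrib_left sum_subtractf[symmetric]
      by (rule trans[OF sum.swap]) (simp add: algebra_simps)
    also have "\<dots> = - (\<Sum>i\<in>UNIV. \<Sum>j\<in>UNIV. dD i c j * E \<xi> $ i $ a * E \<xi> $ j $ d)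
        + (\<Sum>i\<in>UNIV. \<Sum>j\<in>UNIV. dD i c j * E \<xi> $ i $ d * E \<xi> $ j $ a)"
      unfolding dDE by (simp add: sum_negf sum_distrib_left mult_ac)
    also have "(\<Sum>i\<in>UNIV. \<Sum>j\<in>UNIV. dD i c j * E \<xi> $ i $ d * E \<xi> $ j $ a)
        = (\<Sum>i\<in>UNIV. \<Sum>j\<in>UNIV. dD j c i * E \<xi> $ i $ a * E \<xi> $ j $ d)"
      by (rule trans[OF sum.swap]) (simp add: mult_ac)
    finally show ?thesis
      by (simp add: Z_def left_diff_distrib sum_subtractf)
  qed
  have "Z a d = - Z d a"
    unfolding Z_def sum_negf[symmetric]
    by (rule trans[OF sum.swap]) (simp add: algebra_simps)
  then show ?antisym by (simp add: C)
  \<comment> \<open>Back from frame to coordinate components: each D cancels one E in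
    \<open>Z\<close>.\<close>
  have "(\<Sum>a\<in>UNIV. \<Sum>d\<in>UNIV. Z a d * D \<xi> $ a $ i * D \<xi> $ d $ j) = dD i c j - dD j c i"
  proof -
    have Z: "Z a d = (\<Sum>l\<in>UNIV. (\<Sum>k\<in>UNIV. (dD k c l - dD l c k) * E \<xi> $ k $ a) * E \<xi> $ l $ d)" for a d
      unfolding Z_def sum_distrib_right by (rule sum.swap)
    have "(\<Sum>a\<in>UNIV. \<Sum>d\<in>UNIV. Z a d * D \<xi> $ a $ i * D \<xi> $ d $ j)
        = (\<Sum>a\<in>UNIV. (\<Sum>d\<in>UNIV. Z a d * D \<xi> $ d $ j) * D \<xi> $ a $ i)"
      unfolding sum_distrib_right by (intro sum.cong refl) (simp only: mult_ac)
    also have "\<dots> = dD i c j - dD j c i"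
      unfolding Z sum_transform_inverse[OF DE(2)] ..
    finally show ?thesis .
  qed
  then show ?deriv
    by (simp add: C dD_def sum_negf)
qed

end

theorem mainTheorem7:
  fixes A :: "('m::{t2_space, second_countable_topology}, 'n::finite) chart set"
    and \<Omega> :: "('m \<times> ('m, 'n) tvec) set"
    and F :: "'m \<times> ('m, 'n) tvec \<Rightarrow> real"
    and \<omega> :: "'v::euclidean_space set"
    and L :: "'v \<Rightarrow> real"
    and b :: "'n \<Rightarrow> 'v"
    and U :: "'m set"
    and \<phi> :: "'m \<Rightarrow> ('m, 'n) tvec \<Rightarrow> 'v"
    and \<kappa> :: "('m, 'n) chart"
    and C :: "'m \<Rightarrow> 'n \<Rightarrow> 'n \<Rightarrow> 'n \<Rightarrow> real"
    and p :: 'm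
    and v :: "('m, 'n) tvec"
  assumes minkowski: "pseudo_minkowski \<omega> L"
    and finsler: "pseudo_finsler A \<Omega> F"
    and modeled: "modeled_on A \<Omega> F \<omega> L"
    and basis: "is_basis b"
    and local: "local_model A \<Omega> F \<omega> L U \<phi>"
    and chart: "\<kappa> \<in> A"
    and commutation: "\<And>x a d. x \<in> U \<inter> fst \<kappa> \<Longrightarrow>
      lie_bracket (\<lambda>\<xi>. column a (vierbein A \<phi> b \<kappa> \<xi>)) (\<lambda>\<xi>. column d (vierbein A \<phi> b \<kappa> \<xi>)) (snd \<kappa> x)
        = (\<Sum>c\<in>UNIV. C x c a d *\<^sub>R column c (vierbein A \<phi> b \<kappa> (snd \<kappa> x)))"
    and point: "p \<in> U \<inter> fst \<kappa>"
    and vector: "(p, v) \<in> \<Omega>"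
    and berwald: "berwald_exists (coord_fun A F \<kappa>) (snd \<kappa> p) (v \<kappa>)"
  shows "let
      E = vierbein A \<phi> b \<kappa> (snd \<kappa> p);
      D = dual_vierbein A \<phi> b \<kappa> (snd \<kappa> p);
      f = frame_fun b L;
      y = D *v v \<kappa>;
      I = mean_cartan_up f y;
      J = mean_landsberg f (coord_fun A F \<kappa>) E D (snd \<kappa> p) (v \<kappa>);
      dI = (\<lambda>c m. pd c (\<lambda>z. mean_cartan_up f z m) y
                    + (\<Sum>s\<in>UNIV. cartan_up f y m s c * I s))
    in \<forall>c.
      J c = - 1/2 * (\<Sum>e\<in>UNIV. \<Sum>m\<in>UNIV. \<Sum>n\<in>UNIV. C p e m n *
              (y $ m * mean_cartan f y e * kdelta n c
               + I m * metric_tensor f y $ e $ c * y $ n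
               + I m * y_low f y e * kdelta n c
               + 2 * dI c m * y_low f y e * y $ n)) \<and>
      J c = (\<Sum>m\<in>UNIV. \<Sum>n\<in>UNIV. \<Sum>e\<in>UNIV. kcoef f y (C p) m n e * y $ e *
              (I m * kdelta n c + y $ n * dI c m)) \<and>
      (g_yy f y \<noteq> 0 \<longrightarrow>
        J c = (\<Sum>m\<in>UNIV. \<Sum>n\<in>UNIV. \<Sum>e\<in>UNIV. kcoef f y (C p) m n e * y $ e *
              (antisym2 (\<lambda>n m. hproj f y n c * I m) n m
               + antisym2 (\<lambda>n m. y $ n *
                   (\<Sum>a\<in>UNIV. \<Sum>d\<in>UNIV. hproj f y a c * hproj f y m d * vcartan_I f y a d)) n m)))"
proof -
  have finsler': "smooth_atlas A" "\<Omega> \<subseteq> tangent_bundle A"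
    using finsler by (auto simp: pseudo_finsler_def)
  interpret local_frame A \<Omega> F \<omega> L U \<phi> b \<kappa>
    using finsler' basis local chart by unfold_locales
  interpret minkowski_function "frame_fun b L" "frame_lc b -` \<omega>"
    by (rule minkowski_function_frame[OF minkowski basis])
  let ?\<xi> = "snd \<kappa> p" and ?\<L> = "coord_fun A F \<kappa>"
  have \<xi>: "?\<xi> \<in> N" using point by blast
  note DE = coframe_vierbein[OF \<xi>]
  \<comment> \<open>This also yields the antisymmetry of \<open>C p\<close> in its lower indices,
    which is not among the assumptions.\<close>
  note bracket = commutation_coframe[OF \<xi> commutation[OF point]]
  have y: "D ?\<xi> *v v \<kappa> \<in> frame_lc b -` \<omega>"
    by (rule coframe_vector[OF point vector])
  have landsberg: "landsberg (frame_fun b L) ?\<L> (E ?\<xi>) (D ?\<xi>) ?\<xi> (v \<kappa>) a d e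
      = 1/2 * lsum (C p) a d e (D ?\<xi> *v v \<kappa>)" for a d e
    \<comment> \<open>The open premise is the splitting of the spray; \<open>spray_eq\<close> proves
      it and thereby fixes the quadratic coefficients B.\<close>
    by (rule landsberg_eq[OF DE(1) bracket(2) y _ berwald])
      (rule spray_eq[OF open_N \<xi> coframe_C1 coord_fun_eq DE bracket(2) bracket(1)])
  show ?thesis
    unfolding Let_def dual_vierbein_eq[OF \<xi>]
    using mean_landsberg_formulas[OF y bracket(2) landsberg] by blast
qed

end
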